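(* Let $K$ be one of the fields $\mathbb{Q}$, $\mathbb{Q}(\sqrt{-1})$, $\mathbb{Q}(\sqrt{-2})$, and let $D$ be the discriminant of $K$. Then there exists a random variable $X$ taking values in $(0,\infty)$ such that for every $s\in\mathbb{C}$ the expectation $\mathbb{E}(X^s)$ is finite and $$\mathbb{E}(X^s)=|D|^{-s/2}\,\xi_K(s).$$
   Context: For a number field $K$ with $r_1$ real and $r_2$ complex embeddings, the Dedekind zeta function is $\zeta_K(s)=\prod_{\mathfrak p}(1-N(\mathfrak p)^{-s})^{-1}$ for $\mathrm{Re}(s)>1$ (product over nonzero prime ideals of $\mathcal{O}_K$, $N(\mathfrak p)=\#\mathcal O_K/\mathfrak p$). Set $\Gamma_{\mathbb R}(s)=\pi^{-s/2}\Gamma(s/2)$ and $\Gamma_{\mathbb C}(s)=(2\pi)^{1-s}\Gamma(s)$, and $Z_K(s)=\Gamma_{\mathbb R}(s)^{r_1}\Gamma_{\mathbb C}(s)^{r_2}\zeta_K(s)$, which extends meromorphically to $\mathbb C$ with only simple poles at $s=0,1$. Let $c_K=\frac{2^{r_1}(2\pi)^{r_2}hR}{w}$, where $h$ is the class number, $R$ the regulator and $w$ the number of roots of unity of $K$. The Dedekind xi function is $\xi_K(s)=c_K^{-1}s(s-1)|D|^{s/2}Z_K(s)$; it is entire, satisfies $\xi_K(s)=\xi_K(1-s)$ and $\xi_K(0)=\xi_K(1)=1$. *)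

theory Defs
  imports "HOL-Analysis.Analysis" "HOL-Probability.Probability"
begin

text \<open>The three number fields of the statement, each realised as a subfield of the
complex numbers.  Q(sqrt(-1)) and Q(sqrt(-2)) are embedded via sqrt(-1) = i and
sqrt(-2) = i * sqrt 2.\<close>

datatype qfield = FieldQ | FieldQi | FieldQsqrtm2

definition ring_of_integers :: "qfield \<Rightarrow> complex set" where
  "ring_of_integers K = (case K of
      FieldQ \<Rightarrow> {of_int a | a. True}
    | FieldQi \<Rightarrow> {of_int a + of_int b * \<i> | a b. True}
    | FieldQsqrtm2 \<Rightarrow> {of_int a + of_int b * (\<i> * of_real (sqrt 2)) | a b. True})"

definition is_ideal :: "complex set \<Rightarrow> complex set \<Rightarrow> bool" where
  "is_ideal R I \<longleftrightarrow> I \<subseteq> R \<and> 0 \<in> I \<and> (\<forall>x\<in>I. \<forall>y\<in>I. x + y \<in> I \<and> - x \<in> I)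
      \<and> (\<forall>r\<in>R. \<forall>x\<in>I. r * x \<in> I)"

definition is_nonzero_prime_ideal :: "complex set \<Rightarrow> complex set \<Rightarrow> bool" where
  "is_nonzero_prime_ideal R P \<longleftrightarrow> is_ideal R P \<and> P \<noteq> {0} \<and> P \<noteq> R
      \<and> (\<forall>a\<in>R. \<forall>b\<in>R. a * b \<in> P \<longrightarrow> a \<in> P \<or> b \<in> P)"

definition ideal_norm :: "complex set \<Rightarrow> complex set \<Rightarrow> nat" where
  "ideal_norm R I = card {{y \<in> R. x - y \<in> I} | x. x \<in> R}"

text \<open>Dedekind zeta function for Re s > 1, as the Euler product over the nonzero prime
ideals (taken as the limit of the finite partial products over primes of norm at most x;
the product converges absolutely, so the order is irrelevant).\<close>
definition dedekind_zeta :: "qfield \<Rightarrow> complex \<Rightarrow> complex" where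
  "dedekind_zeta K s = Lim at_top (\<lambda>x::real.
      \<Prod>P\<in>{P. is_nonzero_prime_ideal (ring_of_integers K) P
               \<and> real (ideal_norm (ring_of_integers K) P) \<le> x}.
         inverse (1 - of_nat (ideal_norm (ring_of_integers K) P) powr (- s)))"

definition Gamma_R :: "complex \<Rightarrow> complex" where
  "Gamma_R s = of_real pi powr (- s / 2) * Gamma (s / 2)"

definition Gamma_C :: "complex \<Rightarrow> complex" where
  "Gamma_C s = of_real (2 * pi) powr (1 - s) * Gamma s"

definition r1 :: "qfield \<Rightarrow> nat" where
  "r1 K = (case K of FieldQ \<Rightarrow> 1 | _ \<Rightarrow> 0)"
definition r2 :: "qfield \<Rightarrow> nat" where
  "r2 K = (case K of FieldQ \<Rightarrow> 0 | _ \<Rightarrow> 1)"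
definition discriminant :: "qfield \<Rightarrow> int" where
  "discriminant K = (case K of FieldQ \<Rightarrow> 1 | FieldQi \<Rightarrow> -4 | FieldQsqrtm2 \<Rightarrow> -8)"
definition class_number :: "qfield \<Rightarrow> nat" where
  "class_number K = 1"
definition regulator :: "qfield \<Rightarrow> real" where
  "regulator K = 1"
definition num_roots_of_unity :: "qfield \<Rightarrow> nat" where
  "num_roots_of_unity K = (case K of FieldQi \<Rightarrow> 4 | _ \<Rightarrow> 2)"

definition c_const :: "qfield \<Rightarrow> real" where
  "c_const K = 2 ^ r1 K * (2 * pi) ^ r2 K * real (class_number K) * regulator K
                 / real (num_roots_of_unity K)"

definition completed_zeta :: "qfield \<Rightarrow> complex \<Rightarrow> complex" where
  "completed_zeta K s = Gamma_R s ^ r1 K * Gamma_C s ^ r2 K * dedekind_zeta K s"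

text \<open>xi_K is the entire function agreeing with c_K^-1 s (s-1) |D|^(s/2) Z_K(s) on Re s > 1
(unique by the identity theorem).\<close>
definition dedekind_xi :: "qfield \<Rightarrow> complex \<Rightarrow> complex" where
  "dedekind_xi K = (THE f. f holomorphic_on UNIV \<and>
      (\<forall>s. 1 < Re s \<longrightarrow> f s = inverse (of_real (c_const K)) * s * (s - 1)
            * of_real \<bar>real_of_int (discriminant K)\<bar> powr (s / 2) * completed_zeta K s))"

end

theory Submission
  imports Defs "HOL-Complex_Analysis.Complex_Analysis" "HOL-Real_Asymp.Real_Asymp"
begin

text \<open>
  Let \<open>\<Theta>(y)\<close> be the theta series of the ring of integers, summing \<open>exp (- c |z|\<^sup>2 y)\<close> over all
  \<open>z\<close>, with \<open>c\<close> chosen such that \<open>\<Theta>(1/y) = y\<^sup>k \<Theta>(y)\<close>, where \<open>k = 1/2\<close> for the rationals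
  and \<open>k = 1\<close> for the quadratic fields.  With \<open>E = y d/dy\<close>, the function
  \<open>g = E (E + k) \<Theta>\<close> satisfies the same inversion formula, and each term
  \<open>u (u - 1 - k) exp (- u)\<close>, \<open>u = c |z|\<^sup>2 y\<close>, is nonnegative for \<open>y \<ge> 1\<close> because \<open>c > 1 + k\<close>.
  Hence \<open>g \<ge> 0\<close> everywhere, all its moments are finite, \<open>g dy / (k y)\<close> is a probability
  measure, and its Mellin transform at \<open>k s\<close> is entire and agrees with the completed zeta
  function times the polynomial factor for \<open>Re s > 1\<close>.  The theta inversion comes from Polya's
  binomial argument; the Euler product is turned into a sum over ring elements by sieving, all
  three rings being Euclidean with respect to the absolute value.
\<close>

section \<open>Inversion of the theta function\<close>

text \<open>Integration by parts turns E into multiplication by \<open>-w\<close>, so E (E + k) is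
  the polynomial factor \<open>w (w - k)\<close> in disguise. Analytically, E removes the constant 1
  to which the theta series tends at infinity, and E + k removes the y^(-k) that it resembles at 0.
  These two terms cause the poles of the completed zeta function; without them g decays faster than
  any power of y at both ends. The constant c is pi for the rationals and 2 pi / sqrt |D| for the
  quadratic fields. Since the smallest nonzero |z|^2 is 1, positivity rests on the size of c alone,
  and the tightest case is pi / sqrt 2 > 2 for Q(sqrt(-2)). Densities are written in the variable v
  = ln y: there E is d/dv, inversion is the reflection of v, and Mellin transforms are exponential
  moments. Since \<open>dedekind_xi\<close> is a definite description, the moment function also
  serves as the entire continuation that it asks for.\<close>

text \<open>The sum of \<open>exp (- a * n^2)\<close> over all integers, with \<open>n\<close> and
  \<open>-n\<close> paired; see \<open>has_sum_jtheta\<close>.\<close>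

definition jtheta :: "real \<Rightarrow> real" where
  "jtheta a = 1 + 2 * (\<Sum>n. exp (- a * (real n + 1)\<^sup>2))"

section \<open>Gaussian limits of cosine powers\<close>

text \<open>The derivative of \<open>exp (x^2 / 2) * cos x\<close> has the sign of
  \<open>x * cos x - sin x\<close>, which is nonpositive on this interval, so the product stays
  below its value 1 at 0.\<close>

lemma cos_le_exp_neg_half_square:
  assumes "0 \<le> x" "x \<le> pi / 2"
  shows "cos x \<le> exp (- (x\<^sup>2 / 2))"
proof -
  have tan: "x * cos x \<le> sin x" if "0 \<le> x" "x \<le> pi / 2" for x :: real
  proof -
    have "sin 0 - 0 * cos 0 \<le> sin x - x * cos x"
      using that
      by (intro DERIV_nonneg_imp_nondecreasing[of 0 x "\<lambda>x. sin x - x * cos x"])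
         (auto intro!: exI derivative_eq_intros mult_nonneg_nonneg sin_ge_zero)
    thus ?thesis by simp
  qed
  have "exp (x\<^sup>2 / 2) * cos x \<le> exp (0\<^sup>2 / 2) * cos 0"
  proof (rule DERIV_nonpos_imp_nonincreasing[of 0 x "\<lambda>x. exp (x\<^sup>2 / 2) * cos x"])
    fix y assume y: "0 \<le> y" "y \<le> x"
    have "((\<lambda>x. exp (x\<^sup>2 / 2) * cos x) has_real_derivative exp (y\<^sup>2 / 2) * (y * cos y - sin y)) (at y)"
      by (auto intro!: derivative_eq_intros simp: algebra_simps)
    moreover have "exp (y\<^sup>2 / 2) * (y * cos y - sin y) \<le> 0"
      using tan[of y] y assms by (intro mult_nonneg_nonpos) auto
    ultimately show "\<exists>z. ((\<lambda>x. exp (x\<^sup>2 / 2) * cos x) has_real_derivative z) (at y) \<and> z \<le> 0"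
      by blast
  qed fact
  thus ?thesis by (simp add: exp_minus field_simps)
qed

lemma one_minus_ge_exp:
  assumes "u < (1::real)"
  shows "exp (- (u / (1 - u))) \<le> 1 - u"
proof -
  have "1 / (1 - u) = 1 + u / (1 - u)" using assms by (simp add: field_simps)
  also have "\<dots> \<le> exp (u / (1 - u))" by (rule exp_ge_add_one_self)
  finally show ?thesis using assms by (simp add: exp_minus field_simps)
qed

lemma cos_ge_exp:
  assumes "x\<^sup>2 < (2::real)"
  shows "exp (- (x\<^sup>2 / 2 / (1 - x\<^sup>2 / 2))) \<le> cos x"
proof -
  have "1 - x\<^sup>2 / 2 \<le> cos x"
  proof -
    have "cos x = 1 - 2 * (sin (x/2))\<^sup>2" using cos_double_sin[of "x/2"] by simp
    moreover have "(sin (x/2))\<^sup>2 \<le> (x/2)\<^sup>2"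
      using abs_sin_x_le_abs_x[of "x/2"] by (simp only: abs_le_square_iff)
    ultimately show ?thesis by (simp add: power2_eq_square)
  qed
  with one_minus_ge_exp[of "x\<^sup>2/2"] assms show ?thesis by linarith
qed

text \<open>The two exponential bounds on the cosine put \<open>- m x^2\<close> and
  \<open>- m x^2 / (1 - x^2 / 2)\<close> into the exponent, and these have the same limit once
  \<open>x\<close> tends to 0.\<close>

lemma cos_power_tendsto:
  fixes x :: "nat \<Rightarrow> real"
  assumes x: "\<And>m. 0 \<le> x m" and x0: "x \<longlonglongrightarrow> 0" and lim: "(\<lambda>m. real m * (x m)\<^sup>2) \<longlonglongrightarrow> L"
  shows "(\<lambda>m. cos (x m) ^ (2 * m)) \<longlonglongrightarrow> exp (- L)"
proof (rule tendsto_sandwich)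
  have ev: "eventually (\<lambda>m. x m < 1) sequentially"
    using order_tendstoD(2)[OF x0, of 1] by simp
  show "eventually (\<lambda>m. exp (- (real m * (x m)\<^sup>2 / (1 - (x m)\<^sup>2 / 2))) \<le> cos (x m) ^ (2 * m)) sequentially"
    using ev
  proof eventually_elim
    case (elim m)
    have "(x m)\<^sup>2 \<le> 1\<^sup>2" using elim x[of m] by (intro power_mono) auto
    hence "exp (- ((x m)\<^sup>2 / 2 / (1 - (x m)\<^sup>2 / 2))) ^ (2*m) \<le> cos (x m) ^ (2*m)"
      by (intro power_mono cos_ge_exp) auto
    also have "exp (- ((x m)\<^sup>2 / 2 / (1 - (x m)\<^sup>2 / 2))) ^ (2*m) = exp (- (real m * (x m)\<^sup>2 / (1 - (x m)\<^sup>2 / 2)))"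
    proof -
      have "2 * real m * - (v / 2 / w) = - (real m * v / w)" for v w :: real by simp
      thus ?thesis by (simp only: exp_of_nat_mult[symmetric] of_nat_mult of_nat_numeral)
    qed
    finally show ?case .
  qed
  show "eventually (\<lambda>m. cos (x m) ^ (2 * m) \<le> exp (- (real m * (x m)\<^sup>2))) sequentially"
    using ev
  proof eventually_elim
    case (elim m)
    have "cos (x m) ^ (2*m) \<le> exp (- ((x m)\<^sup>2 / 2)) ^ (2*m)"
      using elim x[of m] pi_gt3
      by (intro power_mono cos_le_exp_neg_half_square cos_ge_zero) auto
    thus ?case by (simp add: exp_of_nat_mult[symmetric])
  qed
  show "(\<lambda>m. exp (- (real m * (x m)\<^sup>2))) \<longlonglongrightarrow> exp (- L)"
    by (intro tendsto_intros lim)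
  have "(\<lambda>m. exp (- (real m * (x m)\<^sup>2 / (1 - (x m)\<^sup>2 / 2)))) \<longlonglongrightarrow> exp (- (L / (1 - 0\<^sup>2/2)))"
    by (intro tendsto_intros lim x0) auto
  thus "(\<lambda>m. exp (- (real m * (x m)\<^sup>2 / (1 - (x m)\<^sup>2 / 2)))) \<longlonglongrightarrow> exp (- L)" by simp
qed

section \<open>Gaussian limits of binomial ratios\<close>

text \<open>Fourier coefficient of \<open>cos x ^ (2 * m)\<close> at distance \<open>i\<close> from
  the centre, relative to the central one. It is the discrete counterpart of
  \<open>exp (- i^2 / m)\<close> and is 0 for \<open>i > m\<close>.\<close>

definition binom_ratio :: "nat \<Rightarrow> nat \<Rightarrow> real" where
  "binom_ratio m i = real ((2 * m) choose (m + i)) / real ((2 * m) choose m)"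

lemma binom_ratio_0 [simp]: "binom_ratio m 0 = 1"
  by (simp add: binom_ratio_def)

lemma binom_ratio_nonneg: "binom_ratio m i \<ge> 0"
  by (simp add: binom_ratio_def)

lemma binom_ratio_Suc:
  assumes "i < m"
  shows "binom_ratio m (Suc i) = binom_ratio m i * ((real m - real i) / (real m + real i + 1))"
proof -
  have "Suc (m + i) * ((2 * m) choose Suc (m + i)) = (2 * m - (m + i)) * ((2 * m) choose (m + i))"
    by (metis binomial_absorption binomial_absorb_comp)
  hence "real (Suc (m + i)) * real ((2 * m) choose Suc (m + i)) =
      real (2 * m - (m + i)) * real ((2 * m) choose (m + i))"
    by (metis of_nat_mult)
  moreover have "real (2 * m - (m + i)) = real m - real i" using assms by simp
  ultimately have "real ((2 * m) choose Suc (m + i)) * (real m + real i + 1) =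
      (real m - real i) * real ((2 * m) choose (m + i))" by (simp add: algebra_simps)
  hence "real ((2 * m) choose (m + Suc i)) = real ((2 * m) choose (m + i)) * ((real m - real i) / (real m + real i + 1))"
    by (simp add: field_simps del: of_nat_Suc)
  thus ?thesis unfolding binom_ratio_def by (simp only: times_divide_eq_left)
qed

text \<open>Consecutive ratios are \<open>1 - u\<close> with
  \<open>u = (2 i + 1) / (m + i + 1)\<close>, and \<open>1 - u\<close> is at most
  \<open>exp (- u)\<close>; the numerators \<open>2 i + 1\<close> add up to a square. The fixed
  bound \<open>n\<close> on \<open>i\<close> keeps one denominator throughout the induction.\<close>

lemma binom_ratio_le:
  assumes "i \<le> n" "n \<le> m" "0 < m"
  shows "binom_ratio m i \<le> exp (- ((real i)\<^sup>2 / (real m + real n)))"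
  using assms
proof (induction i)
  case (Suc i)
  define u where "u = (2 * real i + 1) / (real m + real i + 1)"
  have "binom_ratio m (Suc i) = binom_ratio m i * ((real m - real i) / (real m + real i + 1))"
    using Suc.prems by (intro binom_ratio_Suc) auto
  also have "\<dots> \<le> exp (- ((real i)\<^sup>2 / (real m + real n))) * ((real m - real i) / (real m + real i + 1))"
    using Suc by (intro mult_right_mono) auto
  also have "(real m - real i) / (real m + real i + 1) = 1 + (- u)"
    unfolding u_def by (simp add: field_simps)
  also have "1 + (- u) \<le> exp (- ((2 * real i + 1) / (real m + real n)))"
  proof -
    have "(2 * real i + 1) / (real m + real n) \<le> u"
      unfolding u_def using Suc.prems by (intro divide_left_mono mult_pos_pos) auto
    moreover have "1 + (- u) \<le> exp (- u)" by (rule exp_ge_add_one_self)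
    moreover have "exp (- u) \<le> exp (- ((2 * real i + 1) / (real m + real n)))"
      using calculation(1) by simp
    ultimately show ?thesis by linarith
  qed
  also have "exp (- ((real i)\<^sup>2 / (real m + real n))) * exp (- ((2 * real i + 1) / (real m + real n)))
      = exp (- ((real (Suc i))\<^sup>2 / (real m + real n)))"
    unfolding exp_add[symmetric]
    by (simp add: power2_eq_square add_divide_distrib algebra_simps)
  finally show ?case by (simp add: mult_left_mono)
qed auto

text \<open>The same telescoping from below: the consecutive ratio is \<open>1 / (1 + u)\<close>
  with \<open>u = (2 i + 1) / (m - i)\<close>, and \<open>1 + u\<close> is at most
  \<open>exp u\<close>.\<close>

lemma binom_ratio_ge:
  assumes "i \<le> n" "n < m"
  shows "binom_ratio m i \<ge> exp (- ((real i)\<^sup>2 / (real m - real n)))"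
  using assms
proof (induction i)
  case (Suc i)
  define u where "u = (2 * real i + 1) / (real m - real i)"
  have "exp (- ((real (Suc i))\<^sup>2 / (real m - real n))) =
     exp (- ((real i)\<^sup>2 / (real m - real n))) * exp (- ((2 * real i + 1) / (real m - real n)))"
    unfolding exp_add[symmetric]
    by (simp add: power2_eq_square add_divide_distrib algebra_simps)
  also have "\<dots> \<le> binom_ratio m i * ((real m - real i) / (real m + real i + 1))"
  proof (intro mult_mono)
    have "(2 * real i + 1) / (real m - real n) \<ge> u"
      unfolding u_def using Suc.prems by (intro divide_left_mono mult_pos_pos) auto
    hence "exp (- ((2 * real i + 1) / (real m - real n))) \<le> exp (- u)" by simp
    also have "exp u \<ge> 1 + u" by (rule exp_ge_add_one_self)
    hence "exp (- u) \<le> 1 / (1 + u)"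
      using Suc.prems unfolding exp_minus u_def by (simp add: field_simps)
    also have "1 + u = (real m + real i + 1) / (real m - real i)"
      unfolding u_def using Suc.prems by (simp add: field_simps)
    finally show "exp (- ((2 * real i + 1) / (real m - real n))) \<le> (real m - real i) / (real m + real i + 1)"
      by simp
  qed (use Suc binom_ratio_nonneg in auto)
  also have "\<dots> = binom_ratio m (Suc i)"
    using Suc.prems by (intro binom_ratio_Suc [symmetric]) auto
  finally show ?case .
qed auto

text \<open>Convergence of \<open>i^2 / m\<close> forces \<open>i / m\<close> to 0, so the
  denominators \<open>m + i\<close> and \<open>m - i\<close> of the two bounds, taken with
  \<open>n = i\<close>, are both asymptotic to \<open>m\<close>.\<close>

lemma binom_ratio_tendsto:
  assumes lim: "(\<lambda>m. (real (i m))\<^sup>2 / real m) \<longlonglongrightarrow> L"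
  shows "(\<lambda>m. binom_ratio m (i m)) \<longlonglongrightarrow> exp (- L)"
proof -
  have "(\<lambda>m. sqrt ((real (i m))\<^sup>2 / real m * (1 / real m))) \<longlonglongrightarrow> sqrt (L * 0)"
    by (intro tendsto_intros lim lim_1_over_n)
  moreover have "eventually (\<lambda>m. sqrt ((real (i m))\<^sup>2 / real m * (1 / real m)) = real (i m) / real m) sequentially"
    using eventually_gt_at_top[of 0]
    by eventually_elim (simp add: real_sqrt_divide power2_eq_square[symmetric])
  ultimately have im: "(\<lambda>m. real (i m) / real m) \<longlonglongrightarrow> 0"
    using tendsto_cong by (simp add: tendsto_cong)
  have ev: "eventually (\<lambda>m. i m < m) sequentially"
    using order_tendstoD(2)[OF im zero_less_one] eventually_gt_at_top[of 0]
    by eventually_elim (simp add: field_simps)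
  show ?thesis
  proof (rule tendsto_sandwich)
    show "eventually (\<lambda>m. exp (- ((real (i m))\<^sup>2 / real m / (1 - real (i m) / real m))) \<le> binom_ratio m (i m)) sequentially"
      using ev
    proof eventually_elim
      case (elim m)
      have "(real (i m))\<^sup>2 / real m / (1 - real (i m) / real m) = (real (i m))\<^sup>2 / (real m - real (i m))"
        using elim by (simp add: field_simps)
      with binom_ratio_ge[of "i m" "i m" m] elim show ?case by (simp only: order.refl)
    qed
    show "eventually (\<lambda>m. binom_ratio m (i m) \<le> exp (- ((real (i m))\<^sup>2 / real m / (1 + real (i m) / real m)))) sequentially"
      using ev
    proof eventually_elim
      case (elim m)
      have "(real (i m))\<^sup>2 / real m / (1 + real (i m) / real m) = (real (i m))\<^sup>2 / (real m + real (i m))"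
        using elim by (simp add: field_simps)
      with binom_ratio_le[of "i m" "i m" m] elim show ?case by (simp only: order.refl)
    qed
    have "(\<lambda>m. exp (- ((real (i m))\<^sup>2 / real m / (1 - real (i m) / real m)))) \<longlonglongrightarrow> exp (- (L / (1 - 0)))"
      by (intro tendsto_intros lim im) auto
    thus "(\<lambda>m. exp (- ((real (i m))\<^sup>2 / real m / (1 - real (i m) / real m)))) \<longlonglongrightarrow> exp (- L)" by simp
    have "(\<lambda>m. exp (- ((real (i m))\<^sup>2 / real m / (1 + real (i m) / real m)))) \<longlonglongrightarrow> exp (- (L / (1 + 0)))"
      by (intro tendsto_intros lim im) auto
    thus "(\<lambda>m. exp (- ((real (i m))\<^sup>2 / real m / (1 + real (i m) / real m)))) \<longlonglongrightarrow> exp (- L)" by simp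
  qed
qed

section \<open>Polya's finite identity\<close>

lemma sum_cos_roots_of_unity:
  assumes "0 < l"
  shows "(\<Sum>j<l. cos (2 * pi * real j * real d / real l)) = (if l dvd d then real l else 0)"
proof -
  define z where "z = exp (2 * of_real pi * \<i> * of_nat d / of_nat l)"
  have "(\<Sum>j<l. cos (2 * pi * real j * real d / real l)) = Re (\<Sum>j<l. z ^ j)"
  proof (subst Re_sum, intro sum.cong refl)
    fix j
    have "z ^ j = cis (2 * pi * real j * real d / real l)"
      unfolding z_def cis_conv_exp exp_of_nat_mult[symmetric] by (simp add: algebra_simps)
    thus "cos (2 * pi * real j * real d / real l) = Re (z ^ j)" by simp
  qed
  also have "(\<Sum>j<l. z ^ j) = (if l dvd d then of_nat l else 0)"
  proof (cases "l dvd d")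
    case True
    hence "z = 1" unfolding z_def using complex_root_unity_eq_1[of l d] assms by simp
    thus ?thesis using True by simp
  next
    case False
    hence "z \<noteq> 1" unfolding z_def using complex_root_unity_eq_1[of l d] assms by simp
    moreover have "z ^ l = 1" unfolding z_def using complex_root_unity[of l d] assms by simp
    ultimately show ?thesis using False by (simp add: sum_gp_strict)
  qed
  finally show ?thesis by simp
qed

lemma sum_symmetric_about:
  fixes f :: "nat \<Rightarrow> real"
  assumes "\<And>i. i \<in> {1..m} \<Longrightarrow> f (m - i) = f (m + i)"
  shows "(\<Sum>k\<le>2*m. f k) = f m + 2 * (\<Sum>i=1..m. f (m + i))"
proof -
  have "{..2*m} = {..<m} \<union> ({m} \<union> {m+1..2*m})" by auto
  hence "(\<Sum>k\<le>2*m. f k) = (\<Sum>k<m. f k) + (f m + (\<Sum>k=m+1..2*m. f k))"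
    by (simp, subst sum.union_disjoint) auto
  also have "(\<Sum>k<m. f k) = (\<Sum>i=1..m. f (m - i))"
    by (rule sum.reindex_bij_witness[of _ "\<lambda>i. m - i" "\<lambda>i. m - i"]) auto
  also have "\<dots> = (\<Sum>i=1..m. f (m + i))" using assms by (intro sum.cong) auto
  also have "(\<Sum>k=m+1..2*m. f k) = (\<Sum>i=1..m. f (m + i))"
    by (rule sum.reindex_bij_witness[of _ "\<lambda>i. m + i" "\<lambda>i. i - m"]) auto
  finally show ?thesis by simp
qed

lemma cos_power_even_expansion:
  "4 ^ m * cos x ^ (2 * m) =
     real ((2 * m) choose m) + 2 * (\<Sum>i=1..m. real ((2 * m) choose (m + i)) * cos (2 * real i * x))"
proof -
  have "complex_of_real (4 ^ m * cos x ^ (2 * m)) = (cis x + cis (- x)) ^ (2 * m)"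
  proof -
    have "cis x + cis (- x) = of_real (2 * cos x)" by (simp add: complex_eq_iff)
    thus ?thesis by (simp add: power_mult_distrib power_mult)
  qed
  also have "\<dots> = (\<Sum>k\<le>2*m. of_nat ((2*m) choose k) * cis x ^ k * cis (- x) ^ (2 * m - k))"
    by (rule binomial_ring)
  finally have "4 ^ m * cos x ^ (2 * m) =
      Re (\<Sum>k\<le>2*m. of_nat ((2*m) choose k) * cis x ^ k * cis (- x) ^ (2 * m - k))"
    by (metis Re_complex_of_real)
  also have "\<dots> = (\<Sum>k\<le>2*m. real ((2*m) choose k) * cos (2 * (real k - real m) * x))"
    unfolding Re_sum
  proof (intro sum.cong refl)
    fix k assume "k \<in> {..2*m}"
    hence "cis x ^ k * cis (- x) ^ (2 * m - k) = cis (2 * (real k - real m) * x)"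
      unfolding Complex.DeMoivre cis_mult by (simp add: of_nat_diff algebra_simps)
    thus "Re (of_nat ((2*m) choose k) * cis x ^ k * cis (- x) ^ (2 * m - k)) =
      real ((2*m) choose k) * cos (2 * (real k - real m) * x)"
      by (simp add: mult.assoc)
  qed
  also have "\<dots> = real ((2 * m) choose m) + 2 * (\<Sum>i=1..m. real ((2 * m) choose (m + i)) * cos (2 * real i * x))"
  proof (subst sum_symmetric_about)
    fix i assume i: "i \<in> {1..m}"
    have "(2 * m) choose (m - i) = (2 * m) choose (m + i)"
      using binomial_symmetric[of "m - i" "2 * m"] i by (simp add: algebra_simps)
    moreover have "cos (2 * (real (m - i) - real m) * x) = cos (2 * (real (m + i) - real m) * x)"
      using cos_minus[of "2 * real i * x"] i by (simp add: of_nat_diff)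
    ultimately show "real ((2*m) choose (m - i)) * cos (2 * (real (m - i) - real m) * x) =
        real ((2*m) choose (m + i)) * cos (2 * (real (m + i) - real m) * x)" by simp
  qed simp
  finally show ?thesis .
qed

text \<open>Polya's finite form of the theta inversion: summing the binomial expansion of
  \<open>(2 cos x)^(2m)\<close> over \<open>x = pi j / l\<close> keeps only the coefficients at distance
  divisible by \<open>l\<close> from the centre.\<close>

lemma binomial_theta_identity:
  assumes l: "l = 2 * p + 1"
  shows "1 + 2 * (\<Sum>j. if j < p then cos (pi * real (j + 1) / real l) ^ (2 * m) else 0) =
     real l * real ((2 * m) choose m) / 4 ^ m * (1 + 2 * (\<Sum>n. binom_ratio m (l * (n + 1))))"
proof -
  define c where "c j = cos (pi * real j / real l) ^ (2 * m)" for j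
  have l0: "l > 0" using l by simp
  \<comment> \<open>Because \<open>l\<close> is odd, the nonzero residues pair off as
    \<open>j\<close> and \<open>l - j\<close> without a fixed point; the two cosines differ by a
    sign, which the even exponent removes.\<close>
  have "(\<Sum>j<l. c j) = 1 + 2 * (\<Sum>j<p. c (j + 1))"
  proof -
    have "{..<l} = {0} \<union> ({1..p} \<union> {p+1..2*p})" using l by auto
    hence "(\<Sum>j<l. c j) = c 0 + ((\<Sum>j=1..p. c j) + (\<Sum>j=p+1..2*p. c j))"
      by (simp add: sum.union_disjoint)
    also have "(\<Sum>j=p+1..2*p. c j) = (\<Sum>j=1..p. c (l - j))"
      by (rule sum.reindex_bij_witness[of _ "\<lambda>i. l - i" "\<lambda>i. l - i"]) (auto simp: l)
    also have "\<dots> = (\<Sum>j=1..p. c j)"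
    proof (intro sum.cong refl)
      fix j assume j: "j \<in> {1..p}"
      have "pi * real (l - j) / real l = pi - pi * real j / real l"
        using j l l0 by (simp add: of_nat_diff field_simps)
      hence "cos (pi * real (l - j) / real l) = - cos (pi * real j / real l)"
        by (simp add: cos_diff)
      thus "c (l - j) = c j" unfolding c_def by (simp add: power_mult)
    qed
    also have "(\<Sum>j=1..p. c j) = (\<Sum>j<p. c (j + 1))"
      by (rule sum.reindex_bij_witness[of _ "\<lambda>i. i + 1" "\<lambda>i. i - 1"]) auto
    finally show ?thesis by (simp add: c_def)
  qed
  \<comment> \<open>Padding by zeros gives a series over all naturals, the shape to which Tannery's
    theorem applies later.\<close>
  moreover have "(\<Sum>j. if j < p then c (j + 1) else 0) = (\<Sum>j<p. c (j + 1))"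
    by (subst suminf_finite[of "{..<p}"]) auto
  moreover have "4 ^ m * (\<Sum>j<l. c j) =
     real l * (real ((2 * m) choose m) + 2 * (\<Sum>i=1..m. if l dvd i then real ((2 * m) choose (m + i)) else 0))"
  proof -
    have "4 ^ m * (\<Sum>j<l. c j) = (\<Sum>j<l. real ((2 * m) choose m) +
        2 * (\<Sum>i=1..m. real ((2 * m) choose (m + i)) * cos (2 * real i * (pi * real j / real l))))"
      unfolding sum_distrib_left c_def cos_power_even_expansion ..
    also have "\<dots> = real l * real ((2 * m) choose m) + 2 *
        (\<Sum>i=1..m. \<Sum>j<l. real ((2 * m) choose (m + i)) * cos (2 * real i * (pi * real j / real l)))"
      by (subst sum.swap) (simp add: sum.distrib sum_distrib_left)
    also have "(\<Sum>i=1..m. \<Sum>j<l. real ((2 * m) choose (m + i)) * cos (2 * real i * (pi * real j / real l)))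
      = (\<Sum>i=1..m. real l * (if l dvd i then real ((2 * m) choose (m + i)) else 0))"
    proof (intro sum.cong refl)
      fix i
      have "(\<Sum>j<l. cos (2 * real i * (pi * real j / real l))) = (\<Sum>j<l. cos (2 * pi * real j * real i / real l))"
        by (simp add: algebra_simps)
      also have "\<dots> = (if l dvd i then real l else 0)"
        by (rule sum_cos_roots_of_unity[OF l0])
      finally show "(\<Sum>j<l. real ((2 * m) choose (m + i)) * cos (2 * real i * (pi * real j / real l))) =
        real l * (if l dvd i then real ((2 * m) choose (m + i)) else 0)"
        by (simp add: sum_distrib_left[symmetric])
    qed
    finally show ?thesis by (simp add: sum_distrib_left[symmetric] algebra_simps)
  qed
  moreover have "(\<Sum>i=1..m. if l dvd i then real ((2 * m) choose (m + i)) else 0) =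
      real ((2 * m) choose m) * (\<Sum>n. binom_ratio m (l * (n + 1)))"
  proof -
    have "(\<Sum>n. binom_ratio m (l * (n + 1))) = (\<Sum>n<m div l. binom_ratio m (l * (n + 1)))"
    proof (rule suminf_finite)
      fix n assume "n \<notin> {..<m div l}"
      hence "m < l * (n + 1)" using l0
        by (metis Suc_eq_plus1 div_less_iff_less_mult lessThan_iff less_Suc_eq_le mult.commute not_less)
      thus "binom_ratio m (l * (n + 1)) = 0" by (simp add: binom_ratio_def)
    qed auto
    moreover have "(\<Sum>i=1..m. if l dvd i then real ((2 * m) choose (m + i)) else 0) =
      (\<Sum>i\<in>{i\<in>{1..m}. l dvd i}. real ((2 * m) choose (m + i)))"
      by (simp only: sum.inter_filter finite_atLeastAtMost)
    moreover have "\<dots> = (\<Sum>n<m div l. real ((2 * m) choose (m + l * (n + 1))))"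
    proof (rule sum.reindex_bij_witness[of _ "\<lambda>n. l * (n + 1)" "\<lambda>i. i div l - 1"])
      fix n assume n: "n \<in> {..<m div l}"
      hence "n + 1 \<le> m div l" by simp
      hence "(n + 1) * l \<le> m" using l0 by (simp add: less_eq_div_iff_mult_less_eq)
      thus "l * (n + 1) \<in> {i \<in> {1..m}. l dvd i}" using l0 by (simp add: mult.commute)
      show "l * (n + 1) div l - 1 = n" using l0 by simp
    next
      fix i assume i: "i \<in> {i \<in> {1..m}. l dvd i}"
      then obtain k where k: "i = l * k" by auto
      with i l0 have k0: "k > 0" by (auto intro: Nat.gr0I)
      show 1: "l * (i div l - 1 + 1) = i" using k k0 l0 by simp
      have "k \<le> m div l" using i k l0 by (simp add: less_eq_div_iff_mult_less_eq mult.commute)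
      thus "i div l - 1 \<in> {..<m div l}" using k k0 l0 by simp
      show "real ((2 * m) choose (m + l * (i div l - 1 + 1))) = real ((2 * m) choose (m + i))"
        unfolding 1 ..
    qed
    moreover have "real ((2 * m) choose m) * (\<Sum>n<m div l. binom_ratio m (l * (n + 1))) =
        (\<Sum>n<m div l. real ((2 * m) choose (m + l * (n + 1))))"
      unfolding sum_distrib_left by (intro sum.cong refl) (simp add: binom_ratio_def)
    ultimately show ?thesis by simp
  qed
  ultimately show ?thesis unfolding c_def[symmetric] by (simp add: field_simps)
qed

section \<open>The limit of Polya's identity\<close>

lemma summable_exp_neg: "a > 0 \<Longrightarrow> summable (\<lambda>n. exp (- a * (real n + 1)))"
proof -
  assume "a > 0"
  hence "summable (\<lambda>n. exp (- a) * exp (- a) ^ n)"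
    by (intro summable_mult summable_geometric) auto
  thus ?thesis by (simp add: exp_of_nat_mult[symmetric] exp_add[symmetric] algebra_simps)
qed

lemma exp_neg_square_le: "a \<ge> 0 \<Longrightarrow> exp (- a * (real n + 1)\<^sup>2) \<le> exp (- a * (real n + 1))"
  by (simp add: power2_eq_square mult_left_mono algebra_simps)

lemma summable_exp_neg_square: "a > 0 \<Longrightarrow> summable (\<lambda>n. exp (- a * (real n + 1)\<^sup>2))"
  by (rule summable_comparison_test_ev[OF _ summable_exp_neg[of a]])
     (intro always_eventually allI, use exp_neg_square_le[of a] in simp)

lemma jtheta_pos: "a > 0 \<Longrightarrow> jtheta a > 0"
  unfolding jtheta_def using suminf_nonneg[OF summable_exp_neg_square[of a]] by simp

lemma tannery_sequentially:
  fixes a :: "nat \<Rightarrow> nat \<Rightarrow> real"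
  assumes "\<And>k. (\<lambda>n. a k n) \<longlonglongrightarrow> b k"
  assumes "eventually (\<lambda>n. \<forall>k. norm (a k n) \<le> M k) sequentially" "summable M"
  shows "(\<lambda>n. suminf (\<lambda>k. a k n)) \<longlonglongrightarrow> suminf b"
proof -
  have "eventually (\<lambda>(k,n). norm (a k n) \<le> M k) (at_top \<times>\<^sub>F sequentially)"
    unfolding eventually_prod_filter
    by (rule exI[of _ "\<lambda>_. True"], rule exI[of _ "\<lambda>n. \<forall>k. norm (a k n) \<le> M k"]) (use assms in auto)
  from tannerys_theorem[OF assms(1) this assms(3)] show ?thesis by simp
qed

text \<open>By dominated convergence for series, the cosine side of Polya's identity tends to
  \<open>jtheta (pi^2 / L)\<close> and the binomial series to \<open>jtheta L\<close>. The prefactor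
  is the quotient of the two sides, so its limit is the quotient of the theta values.\<close>

lemma central_binomial_theta_limit:
  fixes p :: "nat \<Rightarrow> nat"
  assumes L: "L > 0" and lim: "(\<lambda>m. (real (2 * p m + 1))\<^sup>2 / real m) \<longlonglongrightarrow> L"
  shows "(\<lambda>m. real (2 * p m + 1) * real ((2 * m) choose m) / 4 ^ m) \<longlonglongrightarrow> jtheta (pi\<^sup>2 / L) / jtheta L"
proof -
  define l where "l m = 2 * p m + 1" for m
  note lim = lim[folded l_def]
  have ev1: "eventually (\<lambda>m. (real (l m))\<^sup>2 / real m > L / 2) sequentially"
    using order_tendstoD(1)[OF lim, of "L/2"] L by simp
  have ev2: "eventually (\<lambda>m. (real (l m))\<^sup>2 / real m < 2 * L) sequentially"
    using order_tendstoD(2)[OF lim, of "2*L"] L by simp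
  have invlim: "(\<lambda>m. real m / (real (l m))\<^sup>2) \<longlonglongrightarrow> 1 / L"
    using tendsto_inverse[OF lim] L by (simp add: field_simps)
  have "(\<lambda>m. \<Sum>n. binom_ratio m (l m * (n + 1))) \<longlonglongrightarrow> (\<Sum>n. exp (- L * (real n + 1)\<^sup>2))"
  proof (rule tannery_sequentially)
    fix n
    have "(\<lambda>m. (real (l m))\<^sup>2 / real m * (real n + 1)\<^sup>2) \<longlonglongrightarrow> L * (real n + 1)\<^sup>2"
      by (intro tendsto_intros lim)
    hence "(\<lambda>m. (real (l m * (n + 1)))\<^sup>2 / real m) \<longlonglongrightarrow> L * (real n + 1)\<^sup>2"
      by (simp only: power_mult_distrib of_nat_mult of_nat_add of_nat_1 times_divide_eq_left)
    from binom_ratio_tendsto[OF this]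
    show "(\<lambda>m. binom_ratio m (l m * (n + 1))) \<longlonglongrightarrow> exp (- L * (real n + 1)\<^sup>2)" by simp
  next
    \<comment> \<open>One factor 2 in \<open>L / 4\<close> comes from
      \<open>l^2 / m > L / 2\<close>, the other from the denominator \<open>m + m\<close> when
      \<open>binom_ratio_le\<close> is used with \<open>n = m\<close>.\<close>
    show "eventually (\<lambda>m. \<forall>n. norm (binom_ratio m (l m * (n + 1))) \<le> exp (- (L/4) * (real n + 1))) sequentially"
      using ev1 eventually_gt_at_top[of 0]
    proof eventually_elim
      case (elim m)
      show ?case
      proof
        fix n
        have "binom_ratio m (l m * (n + 1)) \<le> exp (- (L/4) * (real n + 1)\<^sup>2)"
        proof (cases "l m * (n + 1) \<le> m")
          case True
          have "binom_ratio m (l m * (n + 1)) \<le> exp (- ((real (l m * (n + 1)))\<^sup>2 / (real m + real m)))"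
            using True elim by (intro binom_ratio_le) auto
          also have "(real (l m * (n + 1)))\<^sup>2 / (real m + real m) = ((real (l m))\<^sup>2 / real m) / 2 * (real n + 1)\<^sup>2"
            unfolding of_nat_mult power_mult_distrib by (simp add: add.commute)
          also have "exp (- ((real (l m))\<^sup>2 / real m / 2 * (real n + 1)\<^sup>2)) \<le> exp (- (L/4 * (real n + 1)\<^sup>2))"
            using elim unfolding exp_le_cancel_iff neg_le_iff_le
            by (intro mult_right_mono) (simp_all add: mult.commute)
          finally show ?thesis by simp
        next
          case False
          hence "2 * m choose (m + l m * (n + 1)) = 0" by (intro binomial_eq_0) linarith
          thus ?thesis by (simp only: binom_ratio_def) simp
        qed
        also have "\<dots> \<le> exp (- (L/4) * (real n + 1))" using L exp_neg_square_le[of "L/4" n] by simp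
        finally show "norm (binom_ratio m (l m * (n + 1))) \<le> exp (- (L/4) * (real n + 1))"
          using binom_ratio_nonneg by simp
      qed
    qed
    show "summable (\<lambda>n. exp (- (L/4) * (real n + 1)))" using L by (intro summable_exp_neg) auto
  qed
  hence R: "(\<lambda>m. 1 + 2 * (\<Sum>n. binom_ratio m (l m * (n + 1)))) \<longlonglongrightarrow> jtheta L"
    unfolding jtheta_def by (intro tendsto_intros)
  define c where "c j m = (if j < p m then cos (pi * real (j + 1) / real (l m)) ^ (2 * m) else 0)" for j m
  have linf: "filterlim (\<lambda>m. real (l m)) at_top sequentially"
  proof (rule filterlim_at_top_mono)
    show "filterlim (\<lambda>m. sqrt (L / 2 * real m)) at_top sequentially" using L by real_asymp
    show "eventually (\<lambda>m. sqrt (L / 2 * real m) \<le> real (l m)) sequentially"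
      using ev1 eventually_gt_at_top[of 0]
      by eventually_elim (auto intro!: real_le_lsqrt simp: field_simps)
  qed
  have x0: "(\<lambda>m. pi * real (j + 1) / real (l m)) \<longlonglongrightarrow> 0" for j
    by (rule real_tendsto_divide_at_top[OF tendsto_const linf])
  have "(\<lambda>m. \<Sum>j. c j m) \<longlonglongrightarrow> (\<Sum>j. exp (- (pi\<^sup>2 / L) * (real j + 1)\<^sup>2))"
  proof (rule tannery_sequentially)
    fix j
    have "(\<lambda>m. real m * (pi * real (j + 1) / real (l m))\<^sup>2) = 
          (\<lambda>m. real m / (real (l m))\<^sup>2 * (pi * real (j + 1))\<^sup>2)"
      by (simp add: power_divide)
    moreover have "\<dots> \<longlonglongrightarrow> 1 / L * (pi * real (j + 1))\<^sup>2"
      by (intro tendsto_intros invlim)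
    ultimately have "(\<lambda>m. cos (pi * real (j + 1) / real (l m)) ^ (2 * m)) \<longlonglongrightarrow> exp (- (1 / L * (pi * real (j + 1))\<^sup>2))"
      by (intro cos_power_tendsto x0) auto
    also have "1 / L * (pi * real (j + 1))\<^sup>2 = pi\<^sup>2 / L * (real j + 1)\<^sup>2" 
      by (simp add: power_mult_distrib add.commute)
    finally have *: "(\<lambda>m. cos (pi * real (j + 1) / real (l m)) ^ (2 * m)) \<longlonglongrightarrow> exp (- (pi\<^sup>2 / L) * (real j + 1)\<^sup>2)"
      by simp
    \<comment> \<open>For fixed \<open>j\<close> the cutoff \<open>j < p m\<close> holds for all
      large \<open>m\<close>.\<close>
    have "eventually (\<lambda>m. real (l m) > real (2 * j + 1)) sequentially"
      using linf by (auto simp: filterlim_at_top_dense)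
    hence "eventually (\<lambda>m. cos (pi * real (j + 1) / real (l m)) ^ (2 * m) = c j m) sequentially"
      by eventually_elim (auto simp: c_def l_def)
    thus "(\<lambda>m. c j m) \<longlonglongrightarrow> exp (- (pi\<^sup>2 / L) * (real j + 1)\<^sup>2)"
      using * by (rule Lim_transform_eventually[rotated])
  next
    show "eventually (\<lambda>m. \<forall>j. norm (c j m) \<le> exp (- (pi\<^sup>2 / (2 * L)) * (real j + 1))) sequentially"
      using ev2 eventually_gt_at_top[of 0]
    proof eventually_elim
      case (elim m)
      have lm: "real (l m) > 0" by (simp add: l_def)
      show ?case
      proof
        fix j
        show "norm (c j m) \<le> exp (- (pi\<^sup>2 / (2 * L)) * (real j + 1))"
        proof (cases "j < p m")
          case True
          define x where "x = pi * real (j + 1) / real (l m)"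
          have x: "0 \<le> x" "x \<le> pi / 2"
          proof -
            show "0 \<le> x" by (simp add: x_def)
            \<comment> \<open>The cutoff \<open>j < p m\<close> keeps the angle in the range where
              the cosine bound is valid.\<close>
            have "2 * real (j + 1) \<le> real (l m)" using True by (simp add: l_def)
            hence "pi * (2 * real (j + 1)) \<le> pi * real (l m)" by (intro mult_left_mono) auto
            thus "x \<le> pi / 2" unfolding x_def using lm by (simp add: field_simps)
          qed
          have "norm (c j m) = cos x ^ (2 * m)"
            using True by (simp add: c_def x_def power_mult power_abs)
          also have "\<dots> \<le> exp (- (x\<^sup>2 / 2)) ^ (2 * m)"
            using x by (intro power_mono cos_le_exp_neg_half_square cos_ge_zero) auto
          also have "\<dots> = exp (- (pi\<^sup>2 * (real m / (real (l m))\<^sup>2)) * (real j + 1)\<^sup>2)"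
            by (simp add: exp_of_nat_mult[symmetric] x_def power_divide power_mult_distrib add.commute)
          also have "\<dots> \<le> exp (- (pi\<^sup>2 / (2 * L)) * (real j + 1)\<^sup>2)"
          proof -
            have "1 / (2 * L) \<le> real m / (real (l m))\<^sup>2"
              using elim L lm by (simp add: field_simps)
            hence "pi\<^sup>2 * (1 / (2 * L)) \<le> pi\<^sup>2 * (real m / (real (l m))\<^sup>2)"
              by (intro mult_left_mono) auto
            hence "pi\<^sup>2 * (1 / (2 * L)) * (real j + 1)\<^sup>2 \<le> pi\<^sup>2 * (real m / (real (l m))\<^sup>2) * (real j + 1)\<^sup>2"
              by (intro mult_right_mono) auto
            thus ?thesis by simp
          qed
          also have "\<dots> \<le> exp (- (pi\<^sup>2 / (2 * L)) * (real j + 1))"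
            using L by (intro exp_neg_square_le) auto
          finally show ?thesis .
        qed (simp add: c_def)
      qed
    qed
    show "summable (\<lambda>j. exp (- (pi\<^sup>2 / (2 * L)) * (real j + 1)))"
      using L by (intro summable_exp_neg) auto
  qed
  hence "(\<lambda>m. 1 + 2 * (\<Sum>j. c j m)) \<longlonglongrightarrow> jtheta (pi\<^sup>2 / L)"
    unfolding jtheta_def by (intro tendsto_intros)
  hence "(\<lambda>m. (1 + 2 * (\<Sum>j. c j m)) / (1 + 2 * (\<Sum>n. binom_ratio m (l m * (n + 1))))) \<longlonglongrightarrow> jtheta (pi\<^sup>2 / L) / jtheta L"
    using jtheta_pos[OF L] by (intro tendsto_divide R) auto
  moreover have "eventually (\<lambda>m. (1 + 2 * (\<Sum>j. c j m)) / (1 + 2 * (\<Sum>n. binom_ratio m (l m * (n + 1)))) =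
     real (l m) * real ((2 * m) choose m) / 4 ^ m) sequentially"
    using order_tendstoD(1)[OF R jtheta_pos[OF L]]
  proof eventually_elim
    case (elim m)
    thus ?case using binomial_theta_identity[of "l m" "p m" m] unfolding c_def by (simp add: l_def)
  qed
  ultimately show ?thesis unfolding l_def by (rule Lim_transform_eventually)
qed

text \<open>Comparing with \<open>t = 1\<close>, where the quotient of theta values is 1, avoids the
  asymptotics of the central binomial coefficient.\<close>

theorem jtheta_inversion:
  assumes t: "t > 0"
  shows "jtheta (pi / t) = sqrt t * jtheta (pi * t)"
proof -
  \<comment> \<open>The odd number \<open>2 p + 1\<close> lies within 1 of
    \<open>sqrt (pi t m)\<close>, so its square over \<open>m\<close> tends to
    \<open>L = pi t\<close>, for which \<open>pi^2 / L\<close> is \<open>pi / t\<close>.\<close>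
  define p where "p t m = nat \<lfloor>sqrt (pi * t) * sqrt (real m) / 2\<rfloor>" for t :: real and m :: nat
  have preal: "real (2 * p t m + 1) = 2 * real_of_int \<lfloor>sqrt (pi * t) * sqrt (real m) / 2\<rfloor> + 1" if "t > 0" for t m
    using that by (simp add: p_def)
  have lim: "(\<lambda>m. (real (2 * p t m + 1))\<^sup>2 / real m) \<longlonglongrightarrow> pi * t" if "t > 0" for t
  proof -
    have "(\<lambda>m. (2 * real_of_int \<lfloor>c * sqrt (real m) / 2\<rfloor> + 1)\<^sup>2 / real m) \<longlonglongrightarrow> c\<^sup>2" if "c > 0" for c :: real
      using that by real_asymp
    from this[of "sqrt (pi * t)"] show ?thesis unfolding preal[OF that] using that by simp
  qed
  have A: "(\<lambda>m. real (2 * p t m + 1) * real ((2 * m) choose m) / 4 ^ m) \<longlonglongrightarrow> jtheta (pi / t) / jtheta (pi * t)"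
    if "t > 0" for t
    using central_binomial_theta_limit[OF _ lim, OF _ that] that by (simp add: power2_eq_square)
  \<comment> \<open>The central binomial coefficient cancels here; what remains is the quotient of
    the odd numbers for \<open>t\<close> and for 1, which tends to \<open>sqrt t\<close>.\<close>
  have "(\<lambda>m. (real (2 * p t m + 1) * real ((2 * m) choose m) / 4 ^ m) /
             (real (2 * p 1 m + 1) * real ((2 * m) choose m) / 4 ^ m)) \<longlonglongrightarrow> (jtheta (pi / t) / jtheta (pi * t)) / 1"
    using A[of 1] jtheta_pos[of pi] by (intro tendsto_divide A t) auto
  moreover have "(\<lambda>m. (real (2 * p t m + 1) * real ((2 * m) choose m) / 4 ^ m) /
             (real (2 * p 1 m + 1) * real ((2 * m) choose m) / 4 ^ m)) = 
     (\<lambda>m. real (2 * p t m + 1) / real (2 * p 1 m + 1))"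
    by simp
  moreover have "(\<lambda>m. real (2 * p t m + 1) / real (2 * p 1 m + 1)) \<longlonglongrightarrow> sqrt t"
  proof -
    have "(\<lambda>m. (2 * real_of_int \<lfloor>c * sqrt (real m) / 2\<rfloor> + 1) / (2 * real_of_int \<lfloor>d * sqrt (real m) / 2\<rfloor> + 1))
        \<longlonglongrightarrow> c * inverse d" if "c > 0" "d > 0" for c d :: real
      using that by real_asymp
    from this[of "sqrt (pi * t)" "sqrt (pi * 1)"] show ?thesis
      unfolding preal[OF t] preal[OF zero_less_one] using t by (simp add: real_sqrt_mult field_simps)
  qed
  ultimately have "sqrt t = jtheta (pi / t) / jtheta (pi * t)"
    using LIMSEQ_unique by auto
  thus ?thesis using jtheta_pos[of "pi * t"] t by (simp add: field_simps)
qed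

section \<open>Probability densities from theta series\<close>

text \<open>The exponential is expanded in powers of \<open>s\<close> and integrated termwise,
  dominated by \<open>exp (|s| |v|)\<close>, which is at most
  \<open>exp (|s| v) + exp (- |s| v)\<close> and so integrable. The integral is then an everywhere
  convergent power series in \<open>s\<close>.\<close>

lemma holomorphic_moment_generating_function:
  fixes M :: "real measure"
  assumes sets: "sets M = sets borel" and int: "\<And>a. integrable M (\<lambda>v. exp (a * v))"
  shows "integrable M (\<lambda>v. exp (s * complex_of_real v))"
    and "(\<lambda>s. \<integral>v. exp (s * complex_of_real v) \<partial>M) holomorphic_on UNIV"
proof -
  note [measurable_cong] = sets
  have ints: "integrable M (\<lambda>v. exp (s * complex_of_real v))" for s
    by (rule Bochner_Integration.integrable_bound[OF int[of "Re s"]]) auto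
  thus "integrable M (\<lambda>v. exp (s * complex_of_real v))" .
  define h where "h s n v = (s * complex_of_real v) ^ n /\<^sub>R fact n" for s v and n :: nat
  have [measurable]: "h s n \<in> borel_measurable M" for s n
    unfolding h_def by measurable
  have abs_int: "integrable M (\<lambda>v. exp (cmod s * \<bar>v\<bar>))" for s
  proof (rule Bochner_Integration.integrable_bound)
    show "integrable M (\<lambda>v. exp (cmod s * v) + exp (- cmod s * v))"
      by (intro Bochner_Integration.integrable_add int)
    have "exp (cmod s * \<bar>v\<bar>) \<le> exp (cmod s * v) + exp (- cmod s * v)" for v
      by (cases "v \<ge> 0") (auto simp: add_increasing add_increasing2)
    thus "AE v in M. norm (exp (cmod s * \<bar>v\<bar>)) \<le> norm (exp (cmod s * v) + exp (- cmod s * v))"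
      by (intro AE_I2) (simp add: add_pos_pos)
  qed measurable
  have norm_h: "norm (h s n v) = (cmod s * \<bar>v\<bar>) ^ n /\<^sub>R fact n" for s n v
    by (simp add: h_def norm_mult norm_power norm_inverse)
  have partial: "(\<Sum>i<n. norm (h s i v)) \<le> exp (cmod s * \<bar>v\<bar>)" for s n v
  proof -
    have "(\<lambda>n. norm (h s n v)) sums exp (cmod s * \<bar>v\<bar>)"
      unfolding norm_h by (rule exp_converges)
    thus ?thesis by (intro sum_le_suminf[THEN order_trans]) (auto simp: sums_iff)
  qed
  have int_h: "integrable M (h s n)" for s n
  proof (rule Bochner_Integration.integrable_bound[OF abs_int[of s]])
    have "norm (h s n v) \<le> exp (cmod s * \<bar>v\<bar>)" for v
      by (rule order_trans[OF member_le_sum partial[of s v "Suc n"]]) auto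
    thus "AE v in M. norm (h s n v) \<le> norm (exp (cmod s * \<bar>v\<bar>))" by auto
  qed measurable
  have "(\<lambda>n. \<integral>v. h s n v \<partial>M) sums (\<integral>v. (\<Sum>n. h s n v) \<partial>M)" for s
  proof (rule sums_integral)
    show "AE v in M. summable (\<lambda>n. norm (h s n v))"
      unfolding norm_h by (intro AE_I2 sums_summable[OF exp_converges])
    show "summable (\<lambda>n. \<integral>v. norm (h s n v) \<partial>M)"
    proof (rule summableI_nonneg_bounded)
      fix n
      have "(\<Sum>i<n. \<integral>v. norm (h s i v) \<partial>M) = (\<integral>v. (\<Sum>i<n. norm (h s i v)) \<partial>M)"
        by (intro Bochner_Integration.integral_sum[symmetric] integrable_norm int_h)
      also have "\<dots> \<le> (\<integral>v. exp (cmod s * \<bar>v\<bar>) \<partial>M)"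
        by (intro integral_mono abs_int partial Bochner_Integration.integrable_sum integrable_norm int_h)
      finally show "(\<Sum>i<n. \<integral>v. norm (h s i v) \<partial>M) \<le> (\<integral>v. exp (cmod s * \<bar>v\<bar>) \<partial>M)" .
    qed auto
  qed (rule int_h)
  moreover have "(\<Sum>n. h s n v) = exp (s * complex_of_real v)" for s v
    using exp_converges[of "s * complex_of_real v"] unfolding h_def by (simp add: sums_iff)
  moreover define a where "a n = (\<integral>v. h 1 n v \<partial>M)" for n
  have "(\<integral>v. h s n v \<partial>M) = a n * s ^ n" for s n
  proof -
    have "h s n v = s ^ n * h 1 n v" for v
      by (simp add: h_def power_mult_distrib)
    thus ?thesis by (simp add: a_def)
  qed
  ultimately have sums: "(\<lambda>n. a n * s ^ n) sums (\<integral>v. exp (s * complex_of_real v) \<partial>M)" for s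
    by simp
  hence "(\<lambda>s. \<integral>v. exp (s * complex_of_real v) \<partial>M) = (\<lambda>s. \<Sum>n. a n * s ^ n)"
    by (auto simp: sums_iff)
  moreover have "(\<lambda>s. \<Sum>n. a n * s ^ n) holomorphic_on UNIV"
  proof -
    have "((\<lambda>x. \<Sum>n. a n * x ^ n) has_field_derivative (\<Sum>n. diffs a n * s ^ n)) (at s)" for s
      by (rule termdiffs_strong_converges_everywhere) (use sums in \<open>auto simp: sums_iff\<close>)
    thus ?thesis unfolding holomorphic_on_def field_differentiable_def by auto
  qed
  ultimately show "(\<lambda>s. \<integral>v. exp (s * complex_of_real v) \<partial>M) holomorphic_on UNIV" by simp
qed

text \<open>Euler's integral under the substitution \<open>t = l * exp v\<close>. It is done for
  \<open>l = 1\<close> first; the factor \<open>l\<close> is then a translation of \<open>v\<close>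
  by \<open>ln l\<close>, which leaves Lebesgue measure invariant.\<close>

lemma has_bochner_integral_Gamma_exp:
  assumes w: "Re w > 0" and l: "l > 0"
  shows "has_bochner_integral lborel (\<lambda>v. exp (w * of_real v) * of_real (exp (- l * exp v)))
           (of_real l powr (- w) * Gamma w)"
proof -
  define f where "f v = exp (w * of_real v) * complex_of_real (exp (- exp v))" for v :: real
  have [measurable]: "f \<in> borel_measurable borel" unfolding f_def by measurable
  have im: "range (exp :: real \<Rightarrow> real) = {0<..}"
    by (auto simp: image_iff) (metis exp_ln)
  have f_eq: "\<bar>exp v\<bar> *\<^sub>R (complex_of_real (exp v) powr (w - 1) / of_real (exp (exp v))) = f v" for v
  proof -
    have "complex_of_real (exp v) powr (w - 1) = exp (w * of_real v) / of_real (exp v)"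
      by (simp add: powr_def Ln_of_real algebra_simps exp_diff exp_of_real)
    thus ?thesis by (simp add: f_def scaleR_conv_of_real exp_minus field_simps)
  qed
  have "(\<lambda>v. \<bar>exp v\<bar> *\<^sub>R (complex_of_real (exp v) powr (w - 1) / of_real (exp (exp v))))
           absolutely_integrable_on UNIV \<and>
        integral UNIV (\<lambda>v. \<bar>exp v\<bar> *\<^sub>R (complex_of_real (exp v) powr (w - 1) / of_real (exp (exp v)))) = Gamma w"
  proof (subst has_absolute_integral_change_of_variables_real[of UNIV exp exp
          "\<lambda>t. complex_of_real t powr (w - 1) / of_real (exp t)"])
    show "(\<lambda>t. complex_of_real t powr (w - 1) / of_real (exp t)) absolutely_integrable_on range exp \<and>
        integral (range exp) (\<lambda>t. complex_of_real t powr (w - 1) / of_real (exp t)) = Gamma w"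
      unfolding im using absolutely_integrable_Gamma_integral'[OF w] Gamma_integral_complex'[OF w]
      by (auto simp: has_integral_iff)
  qed (auto intro!: derivative_eq_intros simp: inj_def)
  hence abs: "f absolutely_integrable_on UNIV" and int: "integral UNIV f = Gamma w"
    unfolding f_eq by auto
  have "integrable lborel f"
    using abs unfolding set_integrable_def by (simp add: integrable_completion)
  moreover from this have "(\<integral>v. f v \<partial>lborel) = Gamma w"
    using int by (metis integral_lborel)
  ultimately have "has_bochner_integral lborel f (Gamma w)"
    by (simp add: has_bochner_integral_iff)
  hence "has_bochner_integral lborel (\<lambda>v. f (ln l + 1 * v)) (Gamma w /\<^sub>R \<bar>1\<bar>)"
    by (subst (asm) lborel_has_bochner_integral_real_affine_iff[of 1 _ _ "ln l"]) auto
  hence "has_bochner_integral lborel (\<lambda>v. of_real l powr (- w) * f (ln l + 1 * v)) (of_real l powr (- w) * (Gamma w /\<^sub>R \<bar>1\<bar>))"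
    by (intro has_bochner_integral_mult_right)
  also have "(\<lambda>v. of_real l powr (- w) * f (ln l + 1 * v)) = (\<lambda>v. exp (w * of_real v) * of_real (exp (- l * exp v)))"
  proof
    fix v
    have "of_real l powr (- w) * exp (w * of_real (ln l + v)) = exp (w * of_real v)"
      using l by (simp add: powr_def Ln_of_real algebra_simps exp_add[symmetric])
    moreover have "exp (ln l + v) = l * exp v" using l by (simp add: exp_add)
    ultimately show "of_real l powr (- w) * f (ln l + 1 * v) = exp (w * of_real v) * of_real (exp (- l * exp v))"
      unfolding f_def by (metis (no_types, lifting) mult.assoc mult_1 mult_minus_left)
  qed
  finally show ?thesis by simp
qed

section \<open>Theta series in the logarithmic variable\<close>

text \<open>In the application \<open>r m\<close> counts the ring elements with squared absolute
  value \<open>m\<close>. The same \<open>k\<close> is the weight of the inversion formula and a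
  bound beyond which the Dirichlet series of \<open>r\<close> converges.\<close>

locale theta_series =
  fixes r :: "nat \<Rightarrow> real" and c k :: real
  assumes r_nonneg: "\<And>m. r m \<ge> 0" and r_0: "r 0 = 1" and k_pos: "0 < k" and c_gt: "1 + k < c"
    and summable_r: "\<And>\<sigma>. \<sigma> > k \<Longrightarrow> summable (\<lambda>m. r m * real m powr (- \<sigma>))"
    and inversion: "\<And>y. y > 0 \<Longrightarrow>
          (\<Sum>m. r m * exp (- c * real m / y)) = y powr k * (\<Sum>m. r m * exp (- c * real m * y))"
begin

lemma c_pos: "c > 0" using k_pos c_gt by simp

text \<open>The growth of \<open>r\<close> is controlled through its Dirichlet series, so the terms
  are compared with those at exponent \<open>k + 1\<close>; the geometric factor beats every power
  of \<open>m\<close>.\<close>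

lemma summable_powser:
  assumes "0 \<le> q" "q < 1"
  shows "summable (\<lambda>m. r m * real m ^ p * q ^ m)"
proof (cases "q = 0")
  case True
  thus ?thesis by (intro summable_finite[of "{0}"]) auto
next
  case False
  define b where "b = - ln q"
  have b: "b > 0" "q = exp (- b)" using assms False by (simp_all add: b_def)
  have "((\<lambda>m. real m powr (real p + (k + 1)) * exp (- b * real m)) \<longlongrightarrow> 0) sequentially"
    using b k_pos by real_asymp
  hence "eventually (\<lambda>m. real m powr (real p + (k + 1)) * exp (- b * real m) < 1) sequentially"
    by (rule order_tendstoD) simp
  hence "eventually (\<lambda>m. norm (r m * real m ^ p * q ^ m) \<le> r m * real m powr (- (k + 1))) sequentially"
    using eventually_gt_at_top[of 0]
  proof eventually_elim
    case (elim m)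
    have "real m ^ p * q ^ m = real m powr (- (k + 1)) * (real m powr (real p + (k + 1)) * exp (- b * real m))"
      using elim by (simp add: b exp_of_nat_mult[symmetric] powr_realpow[symmetric] powr_add[symmetric] mult.commute)
    also have "\<dots> \<le> real m powr (- (k + 1)) * 1"
      using elim by (intro mult_left_mono) auto
    finally have "r m * (real m ^ p * q ^ m) \<le> r m * real m powr (- (k + 1))"
      using r_nonneg by (intro mult_left_mono) auto
    thus ?case using r_nonneg[of m] assms by (simp add: mult.assoc)
  qed
  thus ?thesis by (rule summable_comparison_test_ev) (use summable_r[of "k+1"] in simp)
qed

text \<open>The p-th iterate of \<open>q d/dq\<close> on the generating function of
  \<open>r\<close>; with \<open>q = exp (- c y)\<close> it yields the derivatives of the theta
  series.\<close>

definition powser :: "nat \<Rightarrow> real \<Rightarrow> real" where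
  "powser p q = (\<Sum>m. r m * real m ^ p * q ^ m)"

lemma powser_deriv:
  assumes "0 < q" "q < 1"
  shows "(powser p has_real_derivative powser (Suc p) q / q) (at q)"
proof -
  define K where "K = (1 + q) / 2"
  have K: "0 \<le> K" "K < 1" "q < K" using assms by (auto simp: K_def)
  have q: "summable (\<lambda>m. r m * real m ^ p * x ^ m)" if "norm x < 1" for x
    by (rule powser_inside[OF summable_powser[of "(1 + norm x) / 2"]]) (use that in auto)
  have "((\<lambda>q. \<Sum>m. (r m * real m ^ p) * q ^ m) has_real_derivative (\<Sum>n. diffs (\<lambda>m. r m * real m ^ p) n * q ^ n)) (at q)"
    by (rule termdiffs_strong[OF summable_powser[OF K(1,2)]]) (use K assms in auto)
  moreover have "summable (\<lambda>n. diffs (\<lambda>m. r m * real m ^ p) n * q ^ n)"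
    by (rule termdiff_converges[of q 1]) (use assms q in auto)
  from sums_mult[OF diffs_equiv[OF this], of q]
  have "(\<lambda>n. r n * real n ^ Suc p * q ^ n) sums (q * (\<Sum>n. diffs (\<lambda>m. r m * real m ^ p) n * q ^ n))"
  proof (rule back_subst[of "\<lambda>f. f sums _"], intro ext)
    fix n show "q * (of_nat n * (r n * real n ^ p) * q ^ (n - Suc 0)) = r n * real n ^ Suc p * q ^ n"
      by (cases n) auto
  qed
  hence "powser (Suc p) q = q * (\<Sum>n. diffs (\<lambda>m. r m * real m ^ p) n * q ^ n)"
    unfolding powser_def by (simp add: sums_iff)
  ultimately show ?thesis using assms unfolding powser_def [abs_def] by simp
qed

text \<open>With \<open>v = ln y\<close> and \<open>u = c m y\<close>, this sums
  \<open>r m * u^p * exp (- u)\<close> over \<open>m\<close>, see \<open>A_sums\<close>. So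
  \<open>A 0\<close> is the theta series in the variable \<open>v\<close>.\<close>

definition A :: "nat \<Rightarrow> real \<Rightarrow> real" where
  "A p v = (c * exp v) ^ p * powser p (exp (- c * exp v))"

lemma A_sums: "(\<lambda>m. r m * ((c * real m * exp v) ^ p * exp (- c * real m * exp v))) sums A p v"
proof -
  have "(\<lambda>m. r m * real m ^ p * exp (- c * exp v) ^ m) sums powser p (exp (- c * exp v))"
    unfolding powser_def using c_pos by (intro summable_sums summable_powser) auto
  from sums_mult[OF this, of "(c * exp v) ^ p"] show ?thesis
    unfolding A_def
    by (rule back_subst[of "\<lambda>f. f sums _"])
       (simp add: fun_eq_iff power_mult_distrib exp_of_nat_mult[symmetric] mult_ac)
qed

text \<open>Since \<open>du/dv = u\<close>, differentiating \<open>u^p * exp (- u)\<close> gives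
  \<open>p\<close> times itself minus the term with exponent \<open>p + 1\<close>.\<close>

lemma A_deriv: "(A p has_real_derivative real p * A p v - A (Suc p) v) (at v)"
proof -
  define q where "q = exp (- c * exp v)"
  have q: "0 < q" "q < 1" using c_pos by (auto simp: q_def)
  have "((\<lambda>v. powser p (exp (- c * exp v))) has_real_derivative
      (powser (Suc p) q / q) * (q * (- c * exp v))) (at v)"
    unfolding q_def
    by (rule DERIV_chain2[of "powser p"])
       (use powser_deriv[OF q] in \<open>auto simp: q_def intro!: derivative_eq_intros\<close>)
  moreover have "((\<lambda>v. (c * exp v) ^ p) has_real_derivative real p * (c * exp v) ^ p) (at v)"
  proof (cases p)
    case (Suc n)
    have "((\<lambda>v. (c * exp v) ^ Suc n) has_real_derivative real (Suc n) * (c * exp v) ^ n * (c * exp v)) (at v)"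
      by (rule DERIV_power_Suc[THEN DERIV_cong]) (auto intro!: derivative_eq_intros)
    thus ?thesis by (simp add: Suc mult_ac)
  qed simp
  from DERIV_mult'[OF this calculation]
  have "((\<lambda>v. (c * exp v) ^ p * powser p (exp (- c * exp v))) has_real_derivative
      (c * exp v) ^ p * ((powser (Suc p) q / q) * (q * (- c * exp v))) + real p * (c * exp v) ^ p * powser p q) (at v)"
    by (simp only: q_def)
  thus ?thesis unfolding A_def [abs_def] using q by (simp add: q_def algebra_simps)
qed

lemma A_nonneg: "A p v \<ge> 0"
  by (rule sums_le[OF _ sums_zero A_sums[of v p]]) (use c_pos r_nonneg in auto)

lemma A0_inversion: "A 0 (- v) = exp (k * v) * A 0 v"
proof -
  have A0: "A 0 v = (\<Sum>m. r m * exp (- c * real m * exp v))" for v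
    using A_sums[of v 0] by (simp add: sums_iff)
  show ?thesis using inversion[of "exp v"]
    by (simp add: A0 exp_minus powr_def field_simps)
qed

text \<open>This is the derivative of \<open>A0_inversion\<close> in \<open>v\<close>, each side
  differentiated by \<open>A_deriv\<close>.\<close>

lemma A1_inversion: "A 1 (- v) = exp (k * v) * (k * A 0 v - A 1 v)"
proof -
  have "((\<lambda>v. A 0 (- v)) has_real_derivative (real 0 * A 0 (- v) - A 1 (- v)) * (- 1)) (at v)"
    by (rule DERIV_chain2[of "A 0"]) (use A_deriv[of 0 "-v"] in \<open>auto intro!: derivative_eq_intros\<close>)
  moreover have "((\<lambda>v. exp (k * v) * A 0 v) has_real_derivative exp (k * v) * (k * A 0 v - A 1 v)) (at v)"
    using A_deriv[of 0 v] by (auto intro!: derivative_eq_intros simp: algebra_simps)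
  ultimately show ?thesis unfolding A0_inversion using DERIV_unique by fastforce
qed

text \<open>Up to the factor \<open>k\<close>, \<open>G\<close> is the density of the logarithm of the random variable:
  \<open>G = E (E + k) A\<^sub>0\<close> with \<open>E = d/dv\<close>, which has Mellin multiplier \<open>w (w - k)\<close>.\<close>

definition G :: "real \<Rightarrow> real" where "G v = A 2 v - (1 + k) * A 1 v"

text \<open>Reflection of \<open>v\<close> combined with the factor \<open>exp (k v)\<close> turns E
  into -(E + k) and E + k into -E, so it preserves their product. In the proof this amounts to
  differentiating \<open>A1_inversion\<close> once more and subtracting
  \<open>k * A 1 (- v)\<close>.\<close>

lemma G_reflect: "G (- v) = exp (k * v) * G v"
proof -
  have "((\<lambda>v. A 1 (- v)) has_real_derivative (real 1 * A 1 (- v) - A 2 (- v)) * (- 1)) (at v)"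
    by (rule DERIV_chain2[of "A 1"])
       (use A_deriv[of 1 "-v"] in \<open>auto intro!: derivative_eq_intros simp: numeral_2_eq_2\<close>)
  moreover have "((\<lambda>v. exp (k * v) * (k * A 0 v - A 1 v)) has_real_derivative
      exp (k * v) * (k * (k * A 0 v - A 1 v) + (k * (- A 1 v) - (A 1 v - A 2 v)))) (at v)"
    using A_deriv[of 0 v] A_deriv[of 1 v]
    by (auto intro!: derivative_eq_intros simp: algebra_simps numeral_2_eq_2)
  ultimately have "A 2 (- v) - A 1 (- v) = exp (k * v) * (k * (k * A 0 v - A 1 v) + (k * (- A 1 v) - (A 1 v - A 2 v)))"
    unfolding A1_inversion using DERIV_unique by fastforce
  hence "A 2 (- v) - A 1 (- v) - k * A 1 (- v) = exp (k * v) * (A 2 v - (1 + k) * A 1 v)"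
    unfolding A1_inversion by (simp add: algebra_simps)
  thus ?thesis unfolding G_def by (simp add: algebra_simps)
qed

lemma G_sums: "(\<lambda>m. r m * (((c * real m * exp v)\<^sup>2 - (1 + k) * (c * real m * exp v)) * exp (- c * real m * exp v))) sums G v"
  using sums_diff[OF A_sums[of v 2] sums_mult[OF A_sums[of v 1], of "1 + k"]]
  unfolding G_def by (simp add: algebra_simps)

lemma G_nonneg: "G v \<ge> 0"
proof -
  have pos: "G v \<ge> 0" if "v \<ge> 0" for v
  proof (rule sums_le[OF _ sums_zero G_sums[of v]])
    fix m
    show "0 \<le> r m * (((c * real m * exp v)\<^sup>2 - (1 + k) * (c * real m * exp v)) * exp (- c * real m * exp v))"
    proof (cases "m = 0")
      case False
      have "c * 1 * 1 \<le> c * real m * exp v"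
        using False that c_pos by (intro mult_mono) auto
      hence "0 \<le> (c * real m * exp v - (1 + k)) * (c * real m * exp v)"
        using c_gt c_pos by (intro mult_nonneg_nonneg) (linarith | simp)+
      hence "0 \<le> (c * real m * exp v)\<^sup>2 - (1 + k) * (c * real m * exp v)"
        by (simp add: power2_eq_square algebra_simps)
      thus ?thesis by (intro mult_nonneg_nonneg r_nonneg) auto
    qed simp
  qed
  show ?thesis
  proof (cases "v \<ge> 0")
    case False
    hence "exp (k * v) * G v \<ge> 0" using G_reflect[of v] pos[of "-v"] by simp
    thus ?thesis by (simp add: zero_le_mult_iff)
  qed (rule pos)
qed

section \<open>Decay, total mass and Mellin transform of the density\<close>

lemma A_measurable [measurable]: "A p \<in> borel_measurable borel"
  by (intro borel_measurable_continuous_onI continuous_at_imp_continuous_on ballI DERIV_isCont[OF A_deriv])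

lemma G_measurable [measurable]: "G \<in> borel_measurable borel"
  unfolding G_def [abs_def] by measurable



text \<open>For \<open>m > 0\<close> and nonnegative \<open>v\<close>, \<open>m (exp v - 1)\<close>
  is at least \<open>exp v - 1\<close>, so the doubly exponential factor
  \<open>exp (- c (exp v - 1))\<close>, independent of \<open>m\<close>, can be taken out of the
  series.\<close>

lemma A1_decay: "v \<ge> 0 \<Longrightarrow> A 1 v \<le> A 1 0 * (exp v * exp (- c * (exp v - 1)))"
proof (rule sums_le[OF _ A_sums sums_mult2[OF A_sums]])
  fix m assume v: "v \<ge> 0"
  show "r m * ((c * real m * exp v) ^ 1 * exp (- c * real m * exp v)) \<le>
     r m * ((c * real m * exp 0) ^ 1 * exp (- c * real m * exp 0)) * (exp v * exp (- c * (exp v - 1)))"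
  proof (cases "m = 0")
    case False
    have "1 * (exp v - 1) \<le> real m * (exp v - 1)"
      using False v by (intro mult_right_mono) auto
    hence "c * (exp v - 1) \<le> c * (real m * (exp v - 1))"
      using c_pos by (intro mult_left_mono) auto
    hence "exp (- c * real m * exp v) \<le> exp (- c * real m * exp 0) * exp (- c * (exp v - 1))"
      unfolding exp_add[symmetric] by (simp add: algebra_simps)
    hence "(r m * (c * real m * exp v)) * exp (- c * real m * exp v) \<le>
        (r m * (c * real m * exp v)) * (exp (- c * real m * exp 0) * exp (- c * (exp v - 1)))"
      using c_pos r_nonneg by (intro mult_left_mono) auto
    thus ?thesis by (simp add: mult_ac)
  qed simp
qed

lemma A1_exp_tendsto: "((\<lambda>v. exp (a * v) * A 1 v) \<longlongrightarrow> 0) at_top"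
proof (rule tendsto_sandwich)
  show "eventually (\<lambda>v. 0 \<le> exp (a * v) * A 1 v) at_top"
    by (simp add: A_nonneg)
  \<comment> \<open>A positive exponent above \<open>a\<close>, so that the limit below involves no
    case distinction on the sign of \<open>a\<close>.\<close>
  define b where "b = \<bar>a\<bar> + 1"
  have b: "b > 0" "a \<le> b" by (auto simp: b_def)
  show "eventually (\<lambda>v. exp (a * v) * A 1 v \<le> A 1 0 * (exp (b * v) * (exp v * exp (- c * (exp v - 1))))) at_top"
    using eventually_ge_at_top[of 0]
  proof eventually_elim
    case (elim v)
    have "exp (a * v) * A 1 v \<le> exp (b * v) * (A 1 0 * (exp v * exp (- c * (exp v - 1))))"
      using elim b A_nonneg[of 1] by (intro mult_mono A1_decay) (auto intro: mult_right_mono)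
    thus ?case by (simp only: mult_ac)
  qed
  have "((\<lambda>v. exp (b * v) * (exp v * exp (- c * (exp v - 1)))) \<longlongrightarrow> 0) at_top"
    using c_pos b(1) by real_asymp
  from tendsto_mult_left[OF this, of "A 1 0"]
  show "((\<lambda>v. A 1 0 * (exp (b * v) * (exp v * exp (- c * (exp v - 1))))) \<longlongrightarrow> 0) at_top"
    by simp
qed auto

text \<open>The limit is the constant term \<open>r 0\<close>. The other terms are dominated by
  those of \<open>A 1\<close>, because \<open>u = c m exp v\<close> is at least 1 for
  \<open>m > 0\<close> and nonnegative \<open>v\<close>.\<close>

lemma A0_tendsto: "(A 0 \<longlongrightarrow> 1) at_top"
proof -
  have A1: "(A 1 \<longlongrightarrow> 0) at_top" using A1_exp_tendsto[of 0] by simp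
  have le: "A 0 v \<le> 1 + A 1 v \<and> 1 \<le> A 0 v" if "v \<ge> 0" for v
  proof
    have one: "(\<lambda>m. if m = 0 then 1 else 0 :: real) sums 1"
      using sums_single[of 0 "\<lambda>_. 1 :: real"] by simp
    have cm: "c * real m * exp v \<ge> 1" if "m \<noteq> 0" for m
    proof -
      have "c * 1 * 1 \<le> c * real m * exp v"
        using that \<open>v \<ge> 0\<close> c_pos by (intro mult_mono) auto
      thus ?thesis using c_gt k_pos by linarith
    qed
    show "A 0 v \<le> 1 + A 1 v"
    proof (rule sums_le[OF _ A_sums sums_add[OF one A_sums]])
      fix m
      show "r m * ((c * real m * exp v) ^ 0 * exp (- c * real m * exp v)) \<le>
        (if m = 0 then 1 else 0) + r m * ((c * real m * exp v) ^ 1 * exp (- c * real m * exp v))"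
      proof (cases "m = 0")
        case False
        have "1 * exp (- c * real m * exp v) \<le> (c * real m * exp v) * exp (- c * real m * exp v)"
          using cm[OF False] by (intro mult_right_mono) auto
        hence "r m * exp (- c * real m * exp v) \<le> r m * ((c * real m * exp v) * exp (- c * real m * exp v))"
          using r_nonneg by (intro mult_left_mono) auto
        thus ?thesis using False by simp
      qed (simp add: r_0)
    qed
    show "1 \<le> A 0 v"
      by (rule sums_le[OF _ one A_sums]) (auto simp: r_0 r_nonneg)
  qed
  show ?thesis
  proof (rule tendsto_sandwich)
    show "eventually (\<lambda>v. 1 \<le> A 0 v) at_top" "eventually (\<lambda>v. A 0 v \<le> 1 + A 1 v) at_top"
      using eventually_ge_at_top[of 0] by (eventually_elim, use le in auto)+
    show "((\<lambda>v. 1 + A 1 v) \<longlongrightarrow> 1) at_top" using tendsto_add[OF tendsto_const A1, of 1] by simp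
  qed auto
qed

text \<open>The total mass is the Mellin transform at \<open>w = 0\<close>, outside the half-plane
  of \<open>G_mellin\<close>, and is therefore computed from a primitive. The value \<open>k\<close>
  is the limit of \<open>k * A 0\<close> at infinity and becomes the normalising constant of the
  density.\<close>

lemma G_integral: "has_bochner_integral lborel G k"
proof -
  \<comment> \<open>a primitive of \<open>G\<close>, which the inversion formula makes vanish at minus infinity\<close>
  define H where "H v = k * A 0 v - A 1 v" for v
  have H: "(H has_real_derivative G v) (at v)" for v
    unfolding H_def [abs_def] G_def using A_deriv[of 0 v] A_deriv[of 1 v]
    by (auto intro!: derivative_eq_intros simp: algebra_simps numeral_2_eq_2)
  have "(H \<longlongrightarrow> k * 1 - 0) at_top"
    unfolding H_def [abs_def] using A1_exp_tendsto[of 0] by (intro tendsto_intros A0_tendsto) simp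
  moreover have "(H \<longlongrightarrow> 0) at_bot"
  proof -
    have "H v = exp (- k * v) * A 1 (- v)" for v
      unfolding A1_inversion H_def by (simp add: exp_minus)
    moreover have "((\<lambda>v. exp (- k * v) * A 1 (- v)) \<longlongrightarrow> 0) at_bot"
      using A1_exp_tendsto[of k] unfolding filterlim_at_bot_mirror by simp
    ultimately show ?thesis by presburger
  qed
  moreover have "isCont G v" for v
    unfolding G_def [abs_def] by (intro continuous_intros DERIV_isCont[OF A_deriv])
  ultimately have "set_integrable lborel (einterval (-\<infinity>) \<infinity>) G" "(LBINT x=-\<infinity>..\<infinity>. G x) = k - 0"
    using G_nonneg H
    by (intro interval_integral_FTC_nonneg[where F = H]; simp add: ereal_tendsto_simps1)+
  thus ?thesis
    by (simp add: has_bochner_integral_iff set_integrable_def interval_lebesgue_integral_def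
                  set_lebesgue_integral_def)
qed

lemma Gamma_integral_shift:
  assumes "Re w > 0" "l > 0"
  shows "has_bochner_integral lborel
           (\<lambda>v. exp (w * of_real v) * of_real ((l * exp v) ^ p * exp (- l * exp v)))
           (of_real l powr (- w) * Gamma (w + of_nat p))"
proof -
  have "has_bochner_integral lborel (\<lambda>v. of_real l ^ p * (exp ((w + of_nat p) * of_real v) * of_real (exp (- l * exp v))))
       (of_real l ^ p * (of_real l powr (- (w + of_nat p)) * Gamma (w + of_nat p)))"
    using assms by (intro has_bochner_integral_mult_right has_bochner_integral_Gamma_exp) auto
  also have "of_real l ^ p * (of_real l powr (- (w + of_nat p)) * Gamma (w + of_nat p)) = 
       of_real l powr (- w) * Gamma (w + of_nat p)"
    using assms by (simp add: powr_diff powr_nat')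
  also have "(\<lambda>v. of_real l ^ p * (exp ((w + of_nat p) * of_real v) * of_real (exp (- l * exp v)))) =
      (\<lambda>v. exp (w * of_real v) * complex_of_real ((l * exp v) ^ p * exp (- l * exp v)))"
    by (simp add: fun_eq_iff distrib_right exp_add exp_of_nat_mult exp_of_real power_mult_distrib)
  finally show ?thesis .
qed

text \<open>Termwise integration. The factor of each term is
  \<open>Gamma (w + 2) - (1 + k) * Gamma (w + 1) = w (w - k) Gamma w\<close>. The interchange holds
  because the integrals of the norms are bounded by a constant times
  \<open>r m * m powr (- Re w)\<close>.\<close>

lemma G_mellin:
  assumes w: "Re w > k"
  shows "has_bochner_integral lborel (\<lambda>v. exp (w * of_real v) * of_real (G v))
     (w * (w - of_real k) * Gamma w * of_real c powr (- w) * (\<Sum>m. of_real (r m) * of_nat m powr (- w)))"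
proof -
  define \<sigma> where "\<sigma> = Re w"
  have w0: "Re w > 0" using w k_pos by simp
  have s0: "\<sigma> > 0" using w0 by (simp add: \<sigma>_def)
  define h where "h l v = ((l * exp v)\<^sup>2 - (1 + k) * (l * exp v)) * exp (- l * exp v)" for l v :: real
  define \<phi> where "\<phi> m v = exp (w * complex_of_real v) * of_real (r m * h (c * real m) v)" for m v
  have [measurable]: "\<phi> m \<in> borel_measurable borel" for m
    unfolding \<phi>_def h_def by measurable
  have int: "has_bochner_integral lborel (\<phi> m)
      (w * (w - of_real k) * Gamma w * of_real c powr (- w) * (of_real (r m) * of_nat m powr (- w)))" for m
  proof (cases "m = 0")
    \<comment> \<open>At \<open>m = 0\<close> the polynomial in \<open>u\<close> vanishes, and on
      the other side \<open>0 powr (- w)\<close> is 0 by convention.\<close>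
    case True
    thus ?thesis by (simp add: \<phi>_def [abs_def] h_def has_bochner_integral_zero)
  next
    case False
    define l where "l = c * real m"
    have l: "l > 0" using False c_pos by (simp add: l_def)
    have "has_bochner_integral lborel
       (\<lambda>v. of_real (r m) * (exp (w * of_real v) * of_real ((l * exp v) ^ 2 * exp (- l * exp v))
           - of_real (1 + k) * (exp (w * of_real v) * of_real ((l * exp v) ^ 1 * exp (- l * exp v)))))
       (of_real (r m) * (of_real l powr (- w) * Gamma (w + of_nat 2) - of_real (1 + k) * (of_real l powr (- w) * Gamma (w + of_nat 1))))"
      by (intro has_bochner_integral_mult_right has_bochner_integral_diff Gamma_integral_shift l w0)
    also have "(\<lambda>v. of_real (r m) * (exp (w * of_real v) * of_real ((l * exp v) ^ 2 * exp (- l * exp v))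
           - of_real (1 + k) * (exp (w * of_real v) * of_real ((l * exp v) ^ 1 * exp (- l * exp v))))) = \<phi> m"
      by (simp add: fun_eq_iff \<phi>_def h_def l_def[symmetric] algebra_simps)
    also have "Gamma (w + of_nat 2) = (w + 1) * (w * Gamma w)"
    proof -
      have "Gamma (w + of_nat 2) = Gamma ((w + 1) + 1)" by (simp add: add.assoc)
      also have "\<dots> = (w + 1) * Gamma (w + 1)"
        using w0 by (intro Gamma_plus1) (auto elim!: nonpos_Ints_cases simp: complex_eq_iff)
      also have "Gamma (w + 1) = w * Gamma w"
        using w0 by (intro Gamma_plus1) (auto elim!: nonpos_Ints_cases)
      finally show ?thesis .
    qed
    also have "Gamma (w + of_nat 1) = w * Gamma w"
      unfolding of_nat_1 using w0 by (intro Gamma_plus1) (auto elim!: nonpos_Ints_cases)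
    also have "of_real l powr (- w) = of_real c powr (- w) * of_nat m powr (- w)"
      unfolding l_def using c_pos powr_times_real[of "of_real c" "of_nat m" "-w"] by simp
    finally show ?thesis
      by (rule back_subst[of "has_bochner_integral lborel (\<phi> m)"]) (simp add: algebra_simps)
  qed
  have bound: "(\<integral>v. norm (\<phi> m v) \<partial>lborel) \<le> 
     (c powr (- \<sigma>) * (Gamma (\<sigma> + 2) + (1 + k) * Gamma (\<sigma> + 1))) * (r m * real m powr (- \<sigma>))" for m
  proof (cases "m = 0")
    case True
    thus ?thesis by (simp add: \<phi>_def h_def)
  next
    case False
    define l where "l = c * real m"
    have l: "l > 0" using False c_pos by (simp add: l_def)
    have real: "has_bochner_integral lborel (\<lambda>v. exp (\<sigma> * v) * ((l * exp v) ^ p * exp (- l * exp v)))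
        (l powr (- \<sigma>) * Gamma (\<sigma> + real p))" for p
    proof -
      have "has_bochner_integral lborel
           (\<lambda>v. Re (exp (of_real \<sigma> * of_real v) * of_real ((l * exp v) ^ p * exp (- l * exp v))))
           (Re (of_real l powr (- of_real \<sigma>) * Gamma (of_real \<sigma> + of_nat p)))"
        using s0 l by (intro has_bochner_integral_bounded_linear[OF bounded_linear_Re] Gamma_integral_shift) auto
      also have "(\<lambda>v. Re (exp (of_real \<sigma> * of_real v) * of_real ((l * exp v) ^ p * exp (- l * exp v)))) =
         (\<lambda>v. exp (\<sigma> * v) * ((l * exp v) ^ p * exp (- l * exp v)))"
        by (simp add: fun_eq_iff Re_exp)
      also have "of_real l powr (- of_real \<sigma>) * Gamma (of_real \<sigma> + of_nat p :: complex) =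
          of_real (l powr (- \<sigma>) * Gamma (\<sigma> + real p))"
        using l by (simp add: powr_of_real[symmetric] flip: Gamma_complex_of_real)
      finally show ?thesis by simp
    qed
    have "(\<integral>v. norm (\<phi> m v) \<partial>lborel) \<le> (\<integral>v. r m * (exp (\<sigma> * v) * ((l * exp v) ^ 2 * exp (- l * exp v))
           + (1 + k) * (exp (\<sigma> * v) * ((l * exp v) ^ 1 * exp (- l * exp v)))) \<partial>lborel)"
    proof (rule integral_mono)
      show "integrable lborel (\<lambda>v. norm (\<phi> m v))"
        using int[of m] by (intro integrable_norm) (simp add: has_bochner_integral_iff)
      show "integrable lborel (\<lambda>v. r m * (exp (\<sigma> * v) * ((l * exp v) ^ 2 * exp (- l * exp v))
           + (1 + k) * (exp (\<sigma> * v) * ((l * exp v) ^ 1 * exp (- l * exp v)))))"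
        using real[of 2] real[of 1] unfolding has_bochner_integral_iff
        by (intro integrable_mult_right Bochner_Integration.integrable_add) auto
      fix v
      have "norm (\<phi> m v) = r m * (exp (\<sigma> * v) * (\<bar>(l * exp v)\<^sup>2 - (1 + k) * (l * exp v)\<bar> * exp (- l * exp v)))"
        unfolding \<phi>_def norm_mult norm_of_real using r_nonneg[of m] by (simp add: h_def \<sigma>_def l_def abs_mult)
      also have "\<bar>(l * exp v)\<^sup>2 - (1 + k) * (l * exp v)\<bar> \<le> (l * exp v)\<^sup>2 + (1 + k) * (l * exp v)"
        using k_pos l by (intro order_trans[OF abs_triangle_ineq4]) simp
      finally show "norm (\<phi> m v) \<le> r m * (exp (\<sigma> * v) * ((l * exp v) ^ 2 * exp (- l * exp v))
           + (1 + k) * (exp (\<sigma> * v) * ((l * exp v) ^ 1 * exp (- l * exp v))))"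
        using r_nonneg by (simp add: mult_left_mono mult_right_mono algebra_simps)
    qed
    also have "\<dots> = r m * (l powr (- \<sigma>) * Gamma (\<sigma> + real 2) + (1 + k) * (l powr (- \<sigma>) * Gamma (\<sigma> + real 1)))"
      by (intro has_bochner_integral_integral_eq has_bochner_integral_mult_right has_bochner_integral_add real)
    also have "l powr (- \<sigma>) = c powr (- \<sigma>) * real m powr (- \<sigma>)"
      unfolding l_def using c_pos by (simp add: powr_mult)
    finally show ?thesis by (simp add: algebra_simps)
  qed
  have sums: "(\<lambda>m. \<phi> m v) sums (exp (w * of_real v) * of_real (G v))" for v
    unfolding \<phi>_def h_def
    using sums_mult[OF sums_of_real[OF G_sums[of v], where 'a = complex], of "exp (w * of_real v)"]
    by (simp add: mult_ac)
  have norm_sum: "summable (\<lambda>m. norm (\<phi> m v))" for v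
  proof (rule summable_comparison_test)
    show "\<exists>N. \<forall>n\<ge>N. norm (norm (\<phi> n v)) \<le> exp (\<sigma> * v) *
        (r n * ((c * real n * exp v) ^ 2 * exp (- c * real n * exp v)) +
         (1 + k) * (r n * ((c * real n * exp v) ^ 1 * exp (- c * real n * exp v))))"
    proof (intro exI allI impI)
      fix n
      have "norm (norm (\<phi> n v)) = exp (\<sigma> * v) * (r n * (\<bar>(c * real n * exp v)\<^sup>2 - (1 + k) * (c * real n * exp v)\<bar> * exp (- c * real n * exp v)))"
        unfolding \<phi>_def norm_mult norm_of_real using r_nonneg[of n] by (simp add: h_def \<sigma>_def abs_mult)
      also have "\<bar>(c * real n * exp v)\<^sup>2 - (1 + k) * (c * real n * exp v)\<bar> \<le> (c * real n * exp v)\<^sup>2 + (1 + k) * (c * real n * exp v)"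
        using k_pos c_pos by (intro order_trans[OF abs_triangle_ineq4]) simp
      finally show "norm (norm (\<phi> n v)) \<le> exp (\<sigma> * v) *
        (r n * ((c * real n * exp v) ^ 2 * exp (- c * real n * exp v)) +
         (1 + k) * (r n * ((c * real n * exp v) ^ 1 * exp (- c * real n * exp v))))"
        using r_nonneg by (simp add: mult_left_mono mult_right_mono algebra_simps)
    qed
    show "summable (\<lambda>n. exp (\<sigma> * v) *
        (r n * ((c * real n * exp v) ^ 2 * exp (- c * real n * exp v)) +
         (1 + k) * (r n * ((c * real n * exp v) ^ 1 * exp (- c * real n * exp v)))))"
      by (intro summable_mult summable_add sums_summable[OF A_sums])
  qed
  have sum_int: "summable (\<lambda>m. \<integral>v. norm (\<phi> m v) \<partial>lborel)"
  proof (rule summable_comparison_test)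
    show "\<exists>N. \<forall>m\<ge>N. norm (\<integral>v. norm (\<phi> m v) \<partial>lborel) \<le>
     (c powr (- \<sigma>) * (Gamma (\<sigma> + 2) + (1 + k) * Gamma (\<sigma> + 1))) * (r m * real m powr (- \<sigma>))"
      using bound by auto
    show "summable (\<lambda>m. (c powr (- \<sigma>) * (Gamma (\<sigma> + 2) + (1 + k) * Gamma (\<sigma> + 1))) * (r m * real m powr (- \<sigma>)))"
      using w by (intro summable_mult summable_r) (simp add: \<sigma>_def)
  qed
  have intphi: "integrable lborel (\<phi> m)" for m
    using int[of m] by (simp add: has_bochner_integral_iff)
  have "integrable lborel (\<lambda>v. \<Sum>m. \<phi> m v)"
    by (rule integrable_suminf[OF intphi AE_I2[OF norm_sum] sum_int])
  moreover have "(\<integral>v. (\<Sum>m. \<phi> m v) \<partial>lborel) = (\<Sum>m. integral\<^sup>L lborel (\<phi> m))"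
    by (rule integral_suminf[OF intphi AE_I2[OF norm_sum] sum_int])
  moreover have "(\<lambda>v. \<Sum>m. \<phi> m v) = (\<lambda>v. exp (w * of_real v) * of_real (G v))"
    using sums by (auto simp: sums_iff)
  moreover have "(\<Sum>m. integral\<^sup>L lborel (\<phi> m)) =
     (\<Sum>m. w * (w - of_real k) * Gamma w * of_real c powr (- w) * (of_real (r m) * of_nat m powr (- w)))"
    using int by (intro suminf_cong) (simp add: has_bochner_integral_iff)
  moreover have "summable (\<lambda>m. complex_of_real (r m) * of_nat m powr (- w))"
  proof (rule summable_norm_cancel)
    have "norm (complex_of_real (r m) * of_nat m powr (- w)) = r m * real m powr (- \<sigma>)" for m
      using r_nonneg norm_powr_real_powr[of "of_nat m" "-w"] by (simp add: norm_mult \<sigma>_def)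
    thus "summable (\<lambda>m. norm (complex_of_real (r m) * of_nat m powr (- w)))"
      using summable_r[of \<sigma>] w by (simp add: \<sigma>_def)
  qed
  ultimately show ?thesis
    by (simp add: has_bochner_integral_iff suminf_mult)
qed

text \<open>Exponents above \<open>k\<close> come from \<open>G_mellin\<close>; reflection carries
  the resulting decay at plus infinity over to minus infinity, so every real \<open>a\<close> is
  reached.\<close>

lemma G_exp_integrable: "integrable lborel (\<lambda>v. exp (a * v) * G v)"
proof -
  \<comment> \<open>\<open>b > k\<close> is the range of \<open>G_mellin\<close>; \<open>b\<close>
    dominates \<open>a\<close> for \<open>v\<close> nonnegative, and \<open>k - a\<close> for
    \<open>v\<close> negative, where reflection replaces \<open>a\<close> by
    \<open>k - a\<close>.\<close>
  define b where "b = max (max a (k - a)) (k + 1)"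
  have b: "a \<le> b" "k - a \<le> b" "b > k" by (auto simp: b_def)
  have "integrable lborel (\<lambda>v. Re (exp (of_real b * of_real v) * of_real (G v)))"
    using G_mellin[of "of_real b"] b unfolding has_bochner_integral_iff
    by (intro integrable_Re) auto
  hence int: "integrable lborel (\<lambda>v. exp (b * v) * G v)"
    by (simp add: Re_exp)
  hence int': "integrable lborel (\<lambda>v. exp (b * (- v)) * G (- v))"
    using lborel_integrable_real_affine[OF int, of "-1" 0] by simp
  have le: "exp (a * v) * G v \<le> exp (b * v) * G v + exp (b * (- v)) * G (- v)" for v
  proof (cases "v \<ge> 0")
    case True
    hence "exp (a * v) * G v \<le> exp (b * v) * G v"
      using b G_nonneg by (intro mult_right_mono) (auto intro: mult_right_mono)
    thus ?thesis using G_nonneg by (simp add: add_increasing2)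
  next
    case False
    have "exp (a * v) * G v = exp ((k - a) * (- v)) * G (- v)"
      unfolding G_reflect by (simp add: mult.assoc[symmetric] exp_add[symmetric] algebra_simps)
    also have "\<dots> \<le> exp (b * (- v)) * G (- v)"
      using False b G_nonneg by (intro mult_right_mono) (auto intro: mult_right_mono_neg)
    finally show ?thesis using G_nonneg by (simp add: add_increasing)
  qed
  show ?thesis
  proof (rule Bochner_Integration.integrable_bound[OF Bochner_Integration.integrable_add[OF int int']])
    show "AE v in lborel. norm (exp (a * v) * G v) \<le> norm (exp (b * v) * G v + exp (b * (- v)) * G (- v))"
      using le G_nonneg by (intro AE_I2) (simp add: abs_mult)
  qed measurable
qed

text \<open>The measure is the law of \<open>v = ln y\<close>. The transform is identified for
  \<open>Re w > k\<close> only; integrability of all real exponentials is what allows its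
  continuation afterwards.\<close>

theorem theta_series_random_variable:
  obtains M :: "real measure" where "prob_space M" "sets M = sets borel"
    "\<And>a. integrable M (\<lambda>v. exp (a * v))"
    "\<And>w. Re w > k \<Longrightarrow> (\<integral>v. exp (w * of_real v) \<partial>M) =
       w * (w - of_real k) / of_real k * Gamma w * of_real c powr (- w) *
       (\<Sum>m. of_real (r m) * of_nat m powr (- w))"
proof
  define M where "M = density lborel (\<lambda>v. G v / k)"
  have nn: "AE v in lborel. 0 \<le> G v / k" using G_nonneg k_pos by auto
  show "sets M = sets borel" by (simp add: M_def)
  show "prob_space M"
  proof
    have "emeasure M (space M) = (\<integral>\<^sup>+ v. ennreal (G v / k) \<partial>lborel)"
      by (simp add: M_def emeasure_density)
    also have "\<dots> = ennreal (\<integral>v. G v / k \<partial>lborel)"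
      using G_integral nn by (intro nn_integral_eq_integral) (auto simp: has_bochner_integral_iff)
    also have "\<dots> = 1" using G_integral k_pos by (simp add: has_bochner_integral_iff)
    finally show "emeasure M (space M) = 1" .
  qed
  show "integrable M (\<lambda>v. exp (a * v))" for a
    unfolding M_def using nn G_exp_integrable[of a]
    by (subst integrable_density) (auto simp: mult.commute)
  show "(\<integral>v. exp (w * of_real v) \<partial>M) =
       w * (w - of_real k) / of_real k * Gamma w * of_real c powr (- w) *
       (\<Sum>m. of_real (r m) * of_nat m powr (- w))" if "Re w > k" for w
  proof -
    have "(\<integral>v. exp (w * of_real v) \<partial>M) = (\<integral>v. (G v / k) *\<^sub>R exp (w * complex_of_real v) \<partial>lborel)"
      unfolding M_def using nn by (subst integral_density) auto
    also have "\<dots> = (\<integral>v. exp (w * of_real v) * of_real (G v) / of_real k \<partial>lborel)"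
      by (simp add: scaleR_conv_of_real mult_ac)
    also have "\<dots> = (\<integral>v. exp (w * of_real v) * of_real (G v) \<partial>lborel) / of_real k"
      by simp
    also have "(\<integral>v. exp (w * of_real v) * of_real (G v) \<partial>lborel) =
       w * (w - of_real k) * Gamma w * of_real c powr (- w) * (\<Sum>m. of_real (r m) * of_nat m powr (- w))"
      using G_mellin[OF that] by (simp add: has_bochner_integral_iff)
    finally show ?thesis by simp
  qed
qed

end

section \<open>Euler products over norm-Euclidean rings\<close>

locale complex_subring =
  fixes R :: "complex set"
  assumes one_mem: "1 \<in> R"
    and add_mem: "\<And>x y. x \<in> R \<Longrightarrow> y \<in> R \<Longrightarrow> x + y \<in> R"
    and uminus_mem: "\<And>x. x \<in> R \<Longrightarrow> - x \<in> R"
    and mult_mem: "\<And>x y. x \<in> R \<Longrightarrow> y \<in> R \<Longrightarrow> x * y \<in> R"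
begin

abbreviation "Rmult b \<equiv> (\<lambda>x. x * b) ` R"

lemma zero_mem: "0 \<in> R" using add_mem[OF one_mem uminus_mem[OF one_mem]] by simp

lemma diff_mem: "x \<in> R \<Longrightarrow> y \<in> R \<Longrightarrow> x - y \<in> R"
  using add_mem[of x "- y"] uminus_mem by simp

lemma is_ideal_Rmult: "b \<in> R \<Longrightarrow> is_ideal R (Rmult b)"
  unfolding is_ideal_def
proof (intro conjI ballI; (elim imageE)?)
  assume b: "b \<in> R"
  show "Rmult b \<subseteq> R" using b mult_mem by auto
  show "0 \<in> Rmult b" using zero_mem by (force simp: image_iff)
  show "x + y \<in> Rmult b" if "x = x' * b" "x' \<in> R" "y = y' * b" "y' \<in> R" for x y x' y'
    using that add_mem[of x' y'] by (auto simp: image_iff intro!: bexI[of _ "x' + y'"] simp: distrib_right)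
  show "- x \<in> Rmult b" if "x = x' * b" "x' \<in> R" for x x'
    using that uminus_mem[of x'] by (auto simp: image_iff intro!: bexI[of _ "- x'"])
  show "r * x \<in> Rmult b" if "r \<in> R" "x = x' * b" "x' \<in> R" for r x x'
    using that mult_mem[of r x'] by (auto simp: image_iff mult.assoc intro!: bexI[of _ "r * x'"])
qed

text \<open>A transversal modulo the principal ideal of \<open>b\<close>. It replaces the cosets
  counted by \<open>ideal_norm\<close> with elements that can be added, multiplied and
  conjugated.\<close>

definition residue_system :: "complex \<Rightarrow> complex set \<Rightarrow> bool" where
  "residue_system b S \<longleftrightarrow> S \<subseteq> R \<and> (\<forall>x\<in>R. \<exists>!y. y \<in> S \<and> x - y \<in> Rmult b)"

lemma residue_class_eq_iff:
  assumes "b \<in> R" "x \<in> R" "y \<in> R"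
  shows "{z \<in> R. x - z \<in> Rmult b} = {z \<in> R. y - z \<in> Rmult b} \<longleftrightarrow> x - y \<in> Rmult b"
proof -
  have add: "u + v \<in> Rmult b" if "u \<in> Rmult b" "v \<in> Rmult b" for u v
    using is_ideal_Rmult[OF assms(1)] that by (auto simp: is_ideal_def)
  have minus: "- u \<in> Rmult b" if "u \<in> Rmult b" for u
    using is_ideal_Rmult[OF assms(1)] that by (auto simp: is_ideal_def)
  have zero: "0 \<in> Rmult b" using is_ideal_Rmult[OF assms(1)] by (simp add: is_ideal_def)
  show ?thesis
  proof
    assume eq: "{z \<in> R. x - z \<in> Rmult b} = {z \<in> R. y - z \<in> Rmult b}"
    have "y \<in> {z \<in> R. y - z \<in> Rmult b}" using assms zero by auto
    thus "x - y \<in> Rmult b" using eq by blast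
  next
    assume xy: "x - y \<in> Rmult b"
    have "x - z \<in> Rmult b \<longleftrightarrow> y - z \<in> Rmult b" for z
      using add[OF xy, of "y - z"] add[OF minus[OF xy], of "x - z"] by (simp only: diff_add_eq) (simp, blast)
    thus "{z \<in> R. x - z \<in> Rmult b} = {z \<in> R. y - z \<in> Rmult b}" by simp
  qed
qed

lemma ideal_norm_residue_system:
  assumes b: "b \<in> R" and S: "residue_system b S"
  shows "ideal_norm R (Rmult b) = card S"
proof -
  define cls where "cls x = {y \<in> R. x - y \<in> Rmult b}" for x
  have cls: "cls x = cls y \<longleftrightarrow> x - y \<in> Rmult b" if "x \<in> R" "y \<in> R" for x y
    unfolding cls_def by (rule residue_class_eq_iff[OF b that])
  have SR: "S \<subseteq> R" and ex1: "\<And>x. x \<in> R \<Longrightarrow> \<exists>!y. y \<in> S \<and> x - y \<in> Rmult b"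
    using S by (auto simp: residue_system_def)
  have "{{y \<in> R. x - y \<in> Rmult b} | x. x \<in> R} = cls ` R" by (auto simp: cls_def)
  also have "cls ` R = cls ` S"
  proof (intro equalityI subsetI)
    fix C assume "C \<in> cls ` R"
    then obtain x where x: "x \<in> R" "C = cls x" by auto
    then obtain y where "y \<in> S" "x - y \<in> Rmult b" using ex1 by blast
    thus "C \<in> cls ` S" using cls[of x y] x SR by auto
  qed (use SR in auto)
  finally have "ideal_norm R (Rmult b) = card (cls ` S)" by (simp only: ideal_norm_def)
  also have "inj_on cls S"
  proof (rule inj_onI)
    fix x y assume xy: "x \<in> S" "y \<in> S" "cls x = cls y"
    hence "x - y \<in> Rmult b" "x - x \<in> Rmult b" using cls[of x y] cls[of x x] SR by auto
    thus "x = y" using ex1[of x] xy SR by blast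
  qed
  hence "card (cls ` S) = card S" by (rule card_image)
  finally show ?thesis .
qed

text \<open>Two-digit expansion \<open>s + t * a\<close>: \<open>s\<close> is the remainder modulo
  \<open>a\<close>, and \<open>t\<close> is the remainder of the quotient modulo \<open>b\<close>.
  Hence the index is multiplicative.\<close>

lemma residue_system_mult:
  assumes ab: "a \<in> R" "b \<in> R" "a \<noteq> 0" and S: "residue_system a S" and T: "residue_system b T"
  shows "\<exists>U. residue_system (a * b) U \<and> card U = card S * card T"
proof -
  define \<phi> where "\<phi> = (\<lambda>(s, t). s + t * a)"
  have SR: "S \<subseteq> R" and S1: "\<And>x. x \<in> R \<Longrightarrow> \<exists>!y. y \<in> S \<and> x - y \<in> Rmult a"
    using S by (auto simp: residue_system_def)
  have TR: "T \<subseteq> R" and T1: "\<And>x. x \<in> R \<Longrightarrow> \<exists>!y. y \<in> T \<and> x - y \<in> Rmult b"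
    using T by (auto simp: residue_system_def)
  have uniq: "s = s' \<and> t = t'"
    if "x \<in> R" "s \<in> S" "t \<in> T" "s' \<in> S" "t' \<in> T"
      and m1: "x - (s + t * a) \<in> Rmult (a * b)" and m2: "x - (s' + t' * a) \<in> Rmult (a * b)"
    for x s t s' t'
  proof -
    obtain q where q: "q \<in> R" "x - (s + t * a) = q * (a * b)" using m1 by blast
    obtain q' where q': "q' \<in> R" "x - (s' + t' * a) = q' * (a * b)" using m2 by blast
    have 1: "x - s = (q * b + t) * a" using q(2) by (simp add: algebra_simps)
    have 2: "x - s' = (q' * b + t') * a" using q'(2) by (simp add: algebra_simps)
    have m: "q * b + t \<in> R" "q' * b + t' \<in> R" using q q' that TR ab add_mem mult_mem by auto
    have "x - s \<in> Rmult a" "x - s' \<in> Rmult a" using 1 2 m by blast+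
    hence ss: "s = s'" using S1[OF that(1)] that by blast
    have "(q * b + t) * a = (q' * b + t') * a" using 1 2 ss by metis
    hence eq: "q * b + t = q' * b + t'" using ab(3) by simp
    have "(q * b + t) - t = q * b" by simp
    moreover have "(q * b + t) - t' = q' * b" unfolding eq by simp
    ultimately have "(q * b + t) - t \<in> Rmult b" "(q * b + t) - t' \<in> Rmult b" using q q' by auto
    hence "t = t'" using T1[OF m(1)] that by blast
    with ss show ?thesis by simp
  qed
  have UR: "\<phi> ` (S \<times> T) \<subseteq> R" using SR TR ab by (auto simp: \<phi>_def intro!: add_mem mult_mem)
  have zero: "0 \<in> Rmult (a * b)" using zero_mem by (force simp: image_iff)
  have "residue_system (a * b) (\<phi> ` (S \<times> T))"
    unfolding residue_system_def
  proof (intro conjI ballI UR)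
    fix x assume x: "x \<in> R"
    obtain s where s: "s \<in> S" "x - s \<in> Rmult a" using S1[OF x] by blast
    then obtain q where q: "q \<in> R" "x - s = q * a" by auto
    obtain t where t: "t \<in> T" "q - t \<in> Rmult b" using T1[OF q(1)] by blast
    then obtain q' where q': "q' \<in> R" "q - t = q' * b" by auto
    have "x - (s + t * a) = (q - t) * a" using q by (simp add: algebra_simps)
    also have "\<dots> = q' * (a * b)" using q' by simp
    finally have mem: "x - (s + t * a) \<in> Rmult (a * b)" using q' by blast
    show "\<exists>!y. y \<in> \<phi> ` (S \<times> T) \<and> x - y \<in> Rmult (a * b)"
    proof (rule ex1I[of _ "s + t * a"])
      show "s + t * a \<in> \<phi> ` (S \<times> T) \<and> x - (s + t * a) \<in> Rmult (a * b)"
        using mem s t by (auto simp: \<phi>_def)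
      fix y assume y: "y \<in> \<phi> ` (S \<times> T) \<and> x - y \<in> Rmult (a * b)"
      then obtain s' t' where st': "s' \<in> S" "t' \<in> T" "y = s' + t' * a" by (auto simp: \<phi>_def)
      show "y = s + t * a" using uniq[OF x st'(1,2) s(1) t(1) _ mem] y st' by auto
    qed
  qed
  moreover have "inj_on \<phi> (S \<times> T)"
  proof (rule inj_onI, clarify)
    fix s t s' t' assume st: "s \<in> S" "t \<in> T" "s' \<in> S" "t' \<in> T" and eq: "\<phi> (s, t) = \<phi> (s', t')"
    have "s + t * a \<in> R" using st UR by (auto simp: \<phi>_def)
    from uniq[OF this st] zero eq show "s = s' \<and> t = t'" by (simp add: \<phi>_def)
  qed
  ultimately show ?thesis by (auto simp: card_image card_cartesian_product)
qed

end

section \<open>Ideals and primes in a norm-Euclidean ring\<close>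

text \<open>\<open>e\<close> is the degree of the field, 1 for the integers and 2 for the imaginary
  quadratic rings, which makes \<open>cmod z ^ e\<close> the norm of the ideal generated by
  \<open>z\<close>.\<close>

locale norm_euclidean_ring = complex_subring +
  fixes e :: nat
  assumes e_pos: "e > 0"
    and norm_Nats: "\<And>z. z \<in> R \<Longrightarrow> cmod z ^ e \<in> \<nat>"
    and euclid: "\<And>a b. a \<in> R \<Longrightarrow> b \<in> R \<Longrightarrow> b \<noteq> 0 \<Longrightarrow> \<exists>q\<in>R. cmod (a - q * b) < cmod b"
    and index: "\<And>b. b \<in> R \<Longrightarrow> b \<noteq> 0 \<Longrightarrow> real (ideal_norm R ((\<lambda>x. x * b) ` R)) = cmod b ^ e"
    and summable_norm_powr: "\<And>\<sigma>. \<sigma> > 1 \<Longrightarrow> (\<lambda>z. (cmod z ^ e) powr (- \<sigma>)) summable_on (R - {0})"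
begin

abbreviation "prime_ideal \<equiv> is_nonzero_prime_ideal R"

lemma cmod_ge_1: "z \<in> R \<Longrightarrow> z \<noteq> 0 \<Longrightarrow> cmod z \<ge> 1"
proof (rule ccontr)
  assume z: "z \<in> R" "z \<noteq> 0" "\<not> cmod z \<ge> 1"
  obtain n where n: "cmod z ^ e = real n" using norm_Nats[OF z(1)] by (auto elim: Nats_cases)
  have "0 < cmod z ^ e" using z by simp
  moreover have "cmod z ^ e < 1" using z e_pos by (simp add: power_less_one_iff)
  ultimately show False unfolding n by simp
qed

lemma minimal_norm:
  assumes "x \<in> S" "S \<subseteq> R"
  obtains b where "b \<in> S" "\<And>y. y \<in> S \<Longrightarrow> cmod b \<le> cmod y"
proof -
  define n where "n z = nat \<lfloor>cmod z ^ e\<rfloor>" for z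
  have n: "real (n z) = cmod z ^ e" if z: "z \<in> R" for z
  proof -
    obtain m where "cmod z ^ e = real m" using norm_Nats[OF z] by (rule Nats_cases)
    thus ?thesis by (simp add: n_def)
  qed
  obtain b where b: "b \<in> S" "\<And>y. y \<in> S \<Longrightarrow> n b \<le> n y"
    using ex_has_least_nat[of "\<lambda>z. z \<in> S" x n] assms by auto
  have "cmod b \<le> cmod y" if "y \<in> S" for y
  proof -
    have "real (n b) \<le> real (n y)" using b(2)[OF that] by simp
    moreover have "b \<in> R" "y \<in> R" using b(1) that assms by auto
    ultimately have "cmod b ^ e \<le> cmod y ^ e" by (simp only: n)
    thus ?thesis using e_pos by (simp add: power_mono_iff)
  qed
  with b(1) show ?thesis by (rule that)
qed

lemma ideal_principal:
  assumes I: "is_ideal R I"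
  obtains b where "b \<in> R" "I = Rmult b"
proof (cases "I = {0}")
  case True
  thus ?thesis using that[of 0] zero_mem by auto
next
  case False
  from I have IR: "I \<subseteq> R" "0 \<in> I" "\<And>x y. x \<in> I \<Longrightarrow> y \<in> I \<Longrightarrow> x + y \<in> I" "\<And>x. x \<in> I \<Longrightarrow> - x \<in> I"
    "\<And>r x. r \<in> R \<Longrightarrow> x \<in> I \<Longrightarrow> r * x \<in> I" by (auto simp: is_ideal_def)
  from False IR(2) obtain x where "x \<in> I - {0}" by auto
  then obtain b where b: "b \<in> I - {0}" "\<And>y. y \<in> I - {0} \<Longrightarrow> cmod b \<le> cmod y"
    using minimal_norm[of x "I - {0}"] IR(1) by blast
  have "I = Rmult b"
  proof (intro equalityI subsetI)
    fix x assume x: "x \<in> I"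
    obtain q where q: "q \<in> R" "cmod (x - q * b) < cmod b"
      using euclid[of x b] x b(1) IR(1) by auto
    have "x - q * b \<in> I" using IR(3)[OF x IR(4)[OF IR(5)[OF q(1), of b]]] b(1) by simp
    hence "x - q * b = 0" using b(2)[of "x - q * b"] q(2) by force
    thus "x \<in> Rmult b" using q(1) by auto
  qed (use b(1) IR(5) in auto)
  with that b(1) IR(1) show ?thesis by blast
qed

text \<open>Dividing 1 by \<open>z\<close> leaves a remainder of absolute value below 1, hence
  0.\<close>

lemma unit_inverse:
  assumes "z \<in> R" "cmod z = 1"
  obtains y where "y \<in> R" "y * z = 1"
proof -
  have "z \<noteq> 0" using assms by auto
  then obtain q where q: "q \<in> R" "cmod (1 - q * z) < cmod z" using euclid[OF one_mem assms(1)] by auto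
  have "1 - q * z = 0"
    using cmod_ge_1[of "1 - q * z"] q assms diff_mem[OF one_mem mult_mem[OF q(1) assms(1)]] by force
  thus ?thesis using that[of q] q by simp
qed

lemma prime_idealE:
  assumes "prime_ideal P"
  obtains b where "b \<in> R" "b \<noteq> 0" "P = Rmult b" "real (ideal_norm R P) = cmod b ^ e"
proof -
  obtain b where b: "b \<in> R" "P = Rmult b"
    using ideal_principal[of P] assms by (auto simp: is_nonzero_prime_ideal_def)
  have "b \<noteq> 0"
  proof
    assume "b = 0"
    hence "P = {0}" using b zero_mem by auto
    thus False using assms by (simp add: is_nonzero_prime_ideal_def)
  qed
  with b that index show ?thesis by blast
qed

lemma prime_ideal_no_unit:
  assumes P: "prime_ideal P" and z: "z \<in> R" "cmod z = 1"
  shows "z \<notin> P"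
proof
  assume "z \<in> P"
  obtain y where y: "y \<in> R" "y * z = 1" using unit_inverse[OF z] by auto
  have ideal: "is_ideal R P" and neq: "P \<noteq> R" using P by (auto simp: is_nonzero_prime_ideal_def)
  have "1 \<in> P" using ideal y \<open>z \<in> P\<close> unfolding is_ideal_def by metis
  hence "r \<in> P" if "r \<in> R" for r using ideal that unfolding is_ideal_def by (metis mult.right_neutral)
  moreover have "P \<subseteq> R" using ideal by (simp add: is_ideal_def)
  ultimately show False using neq by auto
qed

text \<open>If \<open>P\<close> is generated by \<open>a = d * b\<close> and \<open>Q\<close> by
  \<open>b\<close>, primality puts \<open>d\<close> or \<open>b\<close> into \<open>P\<close>: the
  first makes \<open>b\<close> a unit, the second gives equality. The sieve uses this to see that a
  generator of one prime lies in no other.\<close>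

lemma prime_ideal_maximal:
  assumes P: "prime_ideal P" and Q: "prime_ideal Q" and sub: "P \<subseteq> Q"
  shows "P = Q"
proof -
  obtain a where a: "a \<in> R" "a \<noteq> 0" "P = Rmult a" using prime_idealE[OF P] .
  obtain b where b: "b \<in> R" "b \<noteq> 0" "Q = Rmult b" using prime_idealE[OF Q] .
  have "a \<in> P" using a one_mem by (force simp: image_iff)
  then obtain d where d: "d \<in> R" "a = d * b" using sub b(3) by auto
  have "d \<in> P \<or> b \<in> P"
    using P d b(1) \<open>a \<in> P\<close> unfolding is_nonzero_prime_ideal_def by blast
  thus ?thesis
  proof
    assume "d \<in> P"
    then obtain y where y: "y \<in> R" "d = y * a" using a by auto
    have "a * (y * b) = (y * a) * b" by (simp add: mult_ac)
    also have "\<dots> = a" by (metis d(2) y(2))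
    finally have "y * b = 1" using a(2) by simp
    hence "1 \<in> Q" using b(3) y(1) by (auto simp: image_iff)
    thus ?thesis using prime_ideal_no_unit[OF Q one_mem] by simp
  next
    assume "b \<in> P"
    hence "Q \<subseteq> P" using P unfolding b(3) is_nonzero_prime_ideal_def is_ideal_def by auto
    thus ?thesis using sub by auto
  qed
qed

text \<open>A nonunit divisor of \<open>z\<close> of least absolute value generates a prime ideal.
  The norm bound ensures that an element surviving the sieve by all primes of norm at most
  \<open>x\<close> is a unit or has norm above \<open>x\<close>.\<close>

lemma exists_prime_ideal:
  assumes z: "z \<in> R" "z \<noteq> 0" "cmod z \<noteq> 1"
  obtains P where "prime_ideal P" "z \<in> P" "real (ideal_norm R P) \<le> cmod z ^ e"
proof -
  define S where "S = {d \<in> R. cmod d \<noteq> 1 \<and> (\<exists>x\<in>R. z = x * d)}"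
  have "z \<in> S" using z one_mem by (auto simp: S_def intro!: bexI[of _ 1])
  then obtain d where d: "d \<in> S" "\<And>y. y \<in> S \<Longrightarrow> cmod d \<le> cmod y"
    using minimal_norm[of z S] unfolding S_def by blast
  obtain x where x: "x \<in> R" "z = x * d" and dR: "d \<in> R" and d1: "cmod d \<noteq> 1"
    using d(1) by (auto simp: S_def)
  have d0: "d \<noteq> 0" using x z by auto
  have ideal: "is_ideal R (Rmult d)" by (rule is_ideal_Rmult[OF dR])
  have "prime_ideal (Rmult d)"
    unfolding is_nonzero_prime_ideal_def
  proof (intro conjI ideal ballI impI)
    have "d \<in> Rmult d" using one_mem by (force simp: image_iff)
    thus "Rmult d \<noteq> {0}" using d0 by auto
    show "Rmult d \<noteq> R"
    proof
      assume "Rmult d = R"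
      then obtain y where y: "y \<in> R" "1 = y * d" using one_mem by blast
      have "cmod y \<ge> 1" using y by (intro cmod_ge_1) auto
      moreover have "cmod d \<ge> 1" using dR d0 by (rule cmod_ge_1)
      moreover have "cmod y * cmod d = 1" using y(2) by (metis norm_mult norm_one)
      moreover have "1 * cmod d \<le> cmod y * cmod d" using \<open>cmod y \<ge> 1\<close> by (intro mult_right_mono) auto
      ultimately show False using d1 by simp
    qed
    fix a b assume ab: "a \<in> R" "b \<in> R" "a * b \<in> Rmult d"
    show "a \<in> Rmult d \<or> b \<in> Rmult d"
    proof (rule disjCI)
      assume bn: "b \<notin> Rmult d"
      \<comment> \<open>Bezout: this ideal is generated by a common divisor \<open>g\<close> of
        \<open>b\<close> and \<open>d\<close>, which minimality of \<open>d\<close> will force to be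
        a unit.\<close>
      define I where "I = {x * b + y * d | x y. x \<in> R \<and> y \<in> R}"
      have "is_ideal R I"
        unfolding is_ideal_def
      proof (intro conjI ballI)
        show "I \<subseteq> R" unfolding I_def using ab dR add_mem mult_mem by auto
        show "0 \<in> I" unfolding I_def using zero_mem by force
        fix s assume "s \<in> I"
        then obtain x y where s: "s = x * b + y * d" "x \<in> R" "y \<in> R" by (auto simp: I_def)
        {
          fix t assume "t \<in> I"
          then obtain x' y' where t: "t = x' * b + y' * d" "x' \<in> R" "y' \<in> R" by (auto simp: I_def)
          have "s + t = (x + x') * b + (y + y') * d" using s t by (simp add: algebra_simps)
          thus "s + t \<in> I" unfolding I_def using s t add_mem by blast
          have "- s = (- x) * b + (- y) * d" using s by simp
          thus "- s \<in> I" unfolding I_def using s uminus_mem by blast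
        }
      next
        fix r' s assume r': "r' \<in> R" and "s \<in> I"
        then obtain x y where s: "s = x * b + y * d" "x \<in> R" "y \<in> R" by (auto simp: I_def)
        have "r' * s = (r' * x) * b + (r' * y) * d" using s by (simp add: algebra_simps)
        thus "r' * s \<in> I" unfolding I_def using s r' mult_mem by blast
      qed
      then obtain g where g: "g \<in> R" "I = Rmult g" using ideal_principal by blast
      have "d = 0 * b + 1 * d" "b = 1 * b + 0 * d" by auto
      hence "d \<in> I" "b \<in> I" unfolding I_def using one_mem zero_mem by blast+
      then obtain f where f: "f \<in> R" "d = f * g" using g by auto
      have "cmod g = 1"
      proof (rule ccontr)
        \<comment> \<open>A nonunit \<open>g\<close> would be at least as large as \<open>d\<close>
          by minimality, so the cofactor \<open>f\<close> would be a unit and \<open>d\<close> would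
          divide \<open>b\<close>.\<close>
        assume g1: "cmod g \<noteq> 1"
        have "z = (x * f) * g" using x f by simp
        hence "g \<in> S" unfolding S_def using g g1 x f mult_mem by blast
        hence "cmod d \<le> cmod g" by (rule d(2))
        hence "cmod f * cmod g \<le> 1 * cmod g" using f by (simp add: norm_mult)
        moreover have "g \<noteq> 0" using f d0 by auto
        ultimately have "cmod f \<le> 1" by simp
        moreover have "cmod f \<ge> 1" using f d0 by (intro cmod_ge_1) auto
        ultimately obtain y where y: "y \<in> R" "y * f = 1" using unit_inverse[of f] f by auto
        have "g = y * d" using y f by (simp add: mult.assoc[symmetric])
        moreover obtain t where "t \<in> R" "b = t * g" using \<open>b \<in> I\<close> g by auto
        ultimately have "b = (t * y) * d" "t * y \<in> R" using y mult_mem by auto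
        with bn show False by blast
      qed
      then obtain y where y: "y \<in> R" "y * g = 1" using unit_inverse g by blast
      hence "1 \<in> I" using g by (auto simp: image_iff)
      then obtain u t where ut: "1 = u * b + t * d" "u \<in> R" "t \<in> R" by (auto simp: I_def)
      obtain m where m: "m \<in> R" "a * b = m * d" using ab by auto
      have "a = a * (u * b + t * d)" using ut by simp
      also have "\<dots> = (u * m + a * t) * d" using m(2) by (simp add: algebra_simps)
      finally show "a \<in> Rmult d" using ut m ab add_mem mult_mem by blast
    qed
  qed
  moreover have "z \<in> Rmult d" using x by auto
  moreover have "real (ideal_norm R (Rmult d)) \<le> cmod z ^ e"
    unfolding index[OF dR d0] using d(2)[OF \<open>z \<in> S\<close>] by (intro power_mono) auto
  ultimately show ?thesis by (rule that)
qed

section \<open>Sieve and Euler product\<close>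

text \<open>Finiteness is read off from summability: each element of norm at most \<open>x\<close>
  contributes at least \<open>x powr (- 2)\<close> to a convergent sum.\<close>

lemma finite_norm_le: "finite {z \<in> R - {0}. cmod z ^ e \<le> x}"
proof (cases "x > 0")
  case True
  define g where "g z = (cmod z ^ e) powr (- 2)" for z :: complex
  have g: "g summable_on (R - {0})" unfolding g_def by (rule summable_norm_powr) simp
  have card: "real (card F) * x powr (- 2) \<le> infsum g (R - {0})"
    if F: "F \<subseteq> {z \<in> R - {0}. cmod z ^ e \<le> x}" "finite F" for F
  proof -
    have "real (card F) * x powr (- 2) = (\<Sum>z\<in>F. x powr (- 2))" by simp
    also have "\<dots> \<le> (\<Sum>z\<in>F. g z)"
    proof (rule sum_mono)
      fix z assume "z \<in> F"
      hence "0 < cmod z ^ e" "cmod z ^ e \<le> x" using F by auto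
      thus "x powr (- 2) \<le> g z" unfolding g_def by (intro powr_mono2') auto
    qed
    also have "\<dots> \<le> infsum g (R - {0})"
      by (rule finite_sum_le_infsum[OF g]) (use F in \<open>auto simp: g_def\<close>)
    finally show ?thesis .
  qed
  show ?thesis
  proof (rule finite_if_finite_subsets_card_bdd[THEN conjunct1])
    fix F assume F: "F \<subseteq> {z \<in> R - {0}. cmod z ^ e \<le> x}" "finite F"
    have "real (card F) \<le> infsum g (R - {0}) / x powr (- 2)"
      using card[OF F] True by (simp add: pos_le_divide_eq)
    thus "card F \<le> nat \<lceil>infsum g (R - {0}) / x powr (- 2)\<rceil>" by linarith
  qed
next
  case False
  have "{z \<in> R - {0}. cmod z ^ e \<le> x} = {}"
  proof -
    have "0 < cmod z ^ e" if "z \<noteq> 0" for z using that by simp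
    hence "x < cmod z ^ e" if "z \<noteq> 0" for z using False that by (metis less_le_trans not_less)
    thus ?thesis by (auto simp: not_le)
  qed
  thus ?thesis by (simp only: finite.emptyI)
qed

lemma finite_prime_ideals: "finite {P. prime_ideal P \<and> real (ideal_norm R P) \<le> x}"
proof (rule finite_subset)
  show "{P. prime_ideal P \<and> real (ideal_norm R P) \<le> x} \<subseteq> Rmult ` {z \<in> R - {0}. cmod z ^ e \<le> x}"
  proof
    fix P assume "P \<in> {P. prime_ideal P \<and> real (ideal_norm R P) \<le> x}"
    hence P: "prime_ideal P" "real (ideal_norm R P) \<le> x" by auto
    obtain b where "b \<in> R" "b \<noteq> 0" "P = Rmult b" "real (ideal_norm R P) = cmod b ^ e"
      using prime_idealE[OF P(1)] .
    thus "P \<in> Rmult ` {z \<in> R - {0}. cmod z ^ e \<le> x}" using P(2) by auto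
  qed
qed (rule finite_imageI[OF finite_norm_le])

lemma norm_term: "cmod (complex_of_real (cmod z ^ e) powr (- s)) = (cmod z ^ e) powr (- Re s)"
  by (simp add: norm_powr_real_powr)

lemma summable_term:
  assumes "Re s > 1" "A \<subseteq> R - {0}"
  shows "(\<lambda>z. cmod (complex_of_real (cmod z ^ e) powr (- s))) summable_on A"
  unfolding norm_term using summable_norm_powr[OF assms(1)] assms(2) by (rule summable_on_subset_banach)

text \<open>Multiplying by \<open>1 - N(P)^(-s)\<close> removes the elements of \<open>P\<close> from the sum, because
  multiplication by a generator of \<open>P\<close> maps the surviving elements onto those in \<open>P\<close>.\<close>

lemma sieve:
  assumes s: "Re s > 1" and "finite F" "\<And>P. P \<in> F \<Longrightarrow> prime_ideal P"
  shows "(\<Sum>\<^sub>\<infinity>z\<in>{z \<in> R - {0}. \<forall>P\<in>F. z \<notin> P}. complex_of_real (cmod z ^ e) powr (- s)) =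
     (\<Prod>P\<in>F. 1 - of_nat (ideal_norm R P) powr (- s)) *
     (\<Sum>\<^sub>\<infinity>z\<in>R - {0}. complex_of_real (cmod z ^ e) powr (- s))"
  using assms(2,3)
proof (induction F rule: finite_induct)
  case (insert P F)
  define f where "f z = complex_of_real (cmod z ^ e) powr (- s)" for z
  define A where "A = {z \<in> R - {0}. \<forall>P\<in>F. z \<notin> P}"
  have P: "prime_ideal P" and F: "\<And>Q. Q \<in> F \<Longrightarrow> prime_ideal Q" using insert.prems by auto
  obtain b where b: "b \<in> R" "b \<noteq> 0" "P = Rmult b" "real (ideal_norm R P) = cmod b ^ e"
    using prime_idealE[OF P] .
  have fb: "f b = of_nat (ideal_norm R P) powr (- s)"
    unfolding f_def b(4)[symmetric] by simp
  have summ: "f summable_on B" if "B \<subseteq> R - {0}" for B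
    using abs_summable_summable[OF summable_term[OF s that]] unfolding f_def .
  \<comment> \<open>Multiplication by \<open>b\<close> brings no prime of \<open>F\<close> into
    play: such a prime would have to contain \<open>b\<close>, hence \<open>P\<close>, and would
    equal \<open>P\<close> by maximality.\<close>
  have AP: "A \<inter> P = (\<lambda>x. x * b) ` A"
  proof (intro equalityI subsetI)
    fix z assume z: "z \<in> A \<inter> P"
    then obtain x where x: "x \<in> R" "z = x * b" using b by auto
    have "x \<notin> Q" if "Q \<in> F" for Q
    proof
      assume "x \<in> Q"
      hence "z \<in> Q" using F[OF that] x b(1) unfolding is_nonzero_prime_ideal_def is_ideal_def
        by (metis mult.commute)
      thus False using z that by (auto simp: A_def)
    qed
    hence "x \<in> A" using x z by (auto simp: A_def)
    thus "z \<in> (\<lambda>x. x * b) ` A" using x by auto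
  next
    fix z assume "z \<in> (\<lambda>x. x * b) ` A"
    then obtain x where x: "x \<in> A" "z = x * b" by auto
    hence xR: "x \<in> R" "x \<noteq> 0" by (auto simp: A_def)
    have "z \<notin> Q" if Q: "Q \<in> F" for Q
    proof
      assume "z \<in> Q"
      hence "x \<in> Q \<or> b \<in> Q" using F[OF Q] x xR b(1) unfolding is_nonzero_prime_ideal_def by blast
      moreover have "x \<notin> Q" using x Q by (auto simp: A_def)
      ultimately have "b \<in> Q" by simp
      hence "P \<subseteq> Q" using F[OF Q] b unfolding is_nonzero_prime_ideal_def is_ideal_def by auto
      hence "P = Q" using prime_ideal_maximal P F[OF Q] by blast
      thus False using insert.hyps Q by simp
    qed
    thus "z \<in> A \<inter> P" using x xR b mult_mem by (auto simp: A_def)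
  qed
  have "infsum f (A \<inter> P) = infsum (f \<circ> (\<lambda>x. x * b)) A"
    unfolding AP using b(2) by (intro infsum_reindex) (auto simp: inj_on_def)
  also have "\<dots> = infsum (\<lambda>x. f b * f x) A"
  proof (rule infsum_cong)
    fix x assume "x \<in> A"
    have "complex_of_real (cmod x ^ e * cmod b ^ e) powr (- s) =
        complex_of_real (cmod x ^ e) powr (- s) * complex_of_real (cmod b ^ e) powr (- s)"
      unfolding of_real_mult by (rule powr_times_real) auto
    thus "(f \<circ> (\<lambda>x. x * b)) x = f b * f x"
      by (simp only: f_def o_def norm_mult power_mult_distrib mult.commute)
  qed
  also have "\<dots> = f b * infsum f A" by (rule infsum_cmult_right')
  finally have 1: "infsum f (A \<inter> P) = f b * infsum f A" .
  have "infsum f A = infsum f ((A \<inter> P) \<union> (A - P))" by (rule arg_cong[of _ _ "infsum f"]) auto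
  also have "\<dots> = infsum f (A \<inter> P) + infsum f (A - P)"
    by (intro infsum_Un_disjoint summ) (auto simp: A_def)
  finally have "infsum f (A - P) = (1 - f b) * infsum f A" unfolding 1 by (simp add: algebra_simps)
  moreover have "A - P = {z \<in> R - {0}. \<forall>Q\<in>insert P F. z \<notin> Q}" by (auto simp: A_def)
  ultimately show ?case
    using insert.IH[OF F] insert.hyps unfolding f_def[symmetric] A_def[symmetric] fb by simp
qed (simp add: set_diff_eq)

text \<open>Sieving by the primes of norm at most \<open>x\<close> leaves the units, each with term
  1, and elements of norm above \<open>x\<close>, whose total is a tail of a convergent sum. So the
  sieve factors times the full sum tend to the number of units. Dividing by that number reflects
  that each ideal has that many generators.\<close>

theorem euler_product:
  assumes s: "Re s > 1"
  shows "((\<lambda>x. \<Prod>P\<in>{P. prime_ideal P \<and> real (ideal_norm R P) \<le> x}.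
             inverse (1 - of_nat (ideal_norm R P) powr (- s))) \<longlongrightarrow>
          (\<Sum>\<^sub>\<infinity>z\<in>R - {0}. complex_of_real (cmod z ^ e) powr (- s)) / of_nat (card {z \<in> R. cmod z = 1})) at_top"
proof -
  define f where "f z = complex_of_real (cmod z ^ e) powr (- s)" for z
  define U where "U = {z \<in> R. cmod z = 1}"
  define F where "F x = {P. prime_ideal P \<and> real (ideal_norm R P) \<le> x}" for x
  define A where "A x = {z \<in> R - {0}. \<forall>P\<in>F x. z \<notin> P}" for x
  define B where "B x = {z \<in> R - {0}. cmod z ^ e \<le> x}" for x
  define D where "D x = (\<Prod>P\<in>F x. 1 - of_nat (ideal_norm R P) powr (- s))" for x
  define Z where "Z = infsum f (R - {0})"
  have finU: "finite U"
    by (rule finite_subset[OF _ finite_norm_le[of 1]]) (auto simp: U_def)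
  have "1 \<in> U" using one_mem by (simp add: U_def)
  hence cU: "card U \<noteq> 0" using finU by auto
  have abs: "(\<lambda>z. norm (f z)) summable_on C" if "C \<subseteq> R - {0}" for C
    using summable_term[OF s that] unfolding f_def .
  have DZ: "D x * Z = infsum f (A x)" for x
    unfolding D_def Z_def A_def f_def using finite_prime_ideals
    by (intro sieve[symmetric] s) (auto simp: F_def)
  have UA: "U \<subseteq> A x" for x
    using prime_ideal_no_unit by (auto simp: U_def A_def F_def)
  have AB: "A x - U \<subseteq> (R - {0}) - B x" for x
  proof
    fix z assume z: "z \<in> A x - U"
    hence zR: "z \<in> R" "z \<noteq> 0" "cmod z \<noteq> 1" by (auto simp: A_def U_def)
    then obtain P where P: "prime_ideal P" "z \<in> P" "real (ideal_norm R P) \<le> cmod z ^ e"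
      by (rule exists_prime_ideal)
    hence "P \<notin> F x" using z by (auto simp: A_def)
    hence "x < cmod z ^ e" using P by (auto simp: F_def)
    thus "z \<in> (R - {0}) - B x" using zR by (auto simp: B_def)
  qed
  have bound: "norm (infsum f (A x) - of_nat (card U)) \<le>
     infsum (\<lambda>z. norm (f z)) (R - {0}) - (\<Sum>z\<in>B x. norm (f z))" for x
  proof -
    have "infsum f (A x) = infsum f (U \<union> (A x - U))" using UA[of x] by (intro arg_cong[of _ _ "infsum f"]) auto
    also have "\<dots> = infsum f U + infsum f (A x - U)"
      using AB[of x] finU by (intro infsum_Un_disjoint abs_summable_summable[OF abs]) (auto simp: U_def)
    also have "infsum f U = of_nat (card U)" using finU by (simp add: f_def U_def)
    finally have "norm (infsum f (A x) - of_nat (card U)) = norm (infsum f (A x - U))" by simp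
    also have "\<dots> \<le> infsum (\<lambda>z. norm (f z)) (A x - U)"
      using AB[of x] by (intro norm_infsum_bound abs) auto
    also have "\<dots> \<le> infsum (\<lambda>z. norm (f z)) ((R - {0}) - B x)"
      using AB[of x] by (intro infsum_mono_neutral abs) auto
    also have "\<dots> = infsum (\<lambda>z. norm (f z)) (R - {0}) - infsum (\<lambda>z. norm (f z)) (B x)"
    proof -
      have "infsum (\<lambda>z. norm (f z)) (R - {0}) = infsum (\<lambda>z. norm (f z)) (B x \<union> ((R - {0}) - B x))"
        by (intro arg_cong[of _ _ "infsum _"]) (auto simp: B_def)
      also have "\<dots> = infsum (\<lambda>z. norm (f z)) (B x) + infsum (\<lambda>z. norm (f z)) ((R - {0}) - B x)"
        by (intro infsum_Un_disjoint abs) (auto simp: B_def)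
      finally show ?thesis by simp
    qed
    also have "infsum (\<lambda>z. norm (f z)) (B x) = (\<Sum>z\<in>B x. norm (f z))"
      using finite_norm_le by (intro infsum_finite) (simp add: B_def)
    finally show ?thesis .
  qed
  have "filterlim B (finite_subsets_at_top (R - {0})) at_top"
    unfolding filterlim_finite_subsets_at_top
  proof (intro allI impI)
    fix X assume X: "finite X \<and> X \<subseteq> R - {0}"
    show "eventually (\<lambda>y. finite (B y) \<and> X \<subseteq> B y \<and> B y \<subseteq> R - {0}) at_top"
      using eventually_ge_at_top[of "\<Sum>z\<in>X. cmod z ^ e"]
    proof eventually_elim
      case (elim y)
      have "cmod z ^ e \<le> y" if "z \<in> X" for z
        using member_le_sum[of z X "\<lambda>z. cmod z ^ e"] X that elim by auto
      thus ?case using X finite_norm_le by (auto simp: B_def)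
    qed
  qed
  moreover have "(sum (\<lambda>z. norm (f z)) \<longlongrightarrow> infsum (\<lambda>z. norm (f z)) (R - {0})) (finite_subsets_at_top (R - {0}))"
    using has_sum_infsum[OF abs[OF order.refl]] by (simp add: has_sum_def)
  ultimately have "((\<lambda>x. \<Sum>z\<in>B x. norm (f z)) \<longlongrightarrow> infsum (\<lambda>z. norm (f z)) (R - {0})) at_top"
    by (rule filterlim_compose[rotated])
  from tendsto_diff[OF tendsto_const this, of "infsum (\<lambda>z. norm (f z)) (R - {0})"]
  have "((\<lambda>x. infsum (\<lambda>z. norm (f z)) (R - {0}) - (\<Sum>z\<in>B x. norm (f z))) \<longlongrightarrow> 0) at_top"
    by simp
  hence "((\<lambda>x. infsum f (A x) - of_nat (card U)) \<longlongrightarrow> 0) at_top"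
    by (rule Lim_null_comparison[OF always_eventually[OF allI[OF bound]]])
  hence lim: "((\<lambda>x. D x * Z) \<longlongrightarrow> of_nat (card U)) at_top"
    unfolding DZ by (rule LIM_zero_cancel)
  \<comment> \<open>The full sum cannot vanish, because the limit \<open>card U\<close> is nonzero;
    the division below relies on it.\<close>
  have Z0: "Z \<noteq> 0"
  proof
    assume "Z = 0"
    with lim have "((\<lambda>x::real. 0 :: complex) \<longlongrightarrow> of_nat (card U)) at_top" by simp
    hence "of_nat (card U) = (0 :: complex)"
      by (intro tendsto_unique[OF trivial_limit_at_top_linorder _ tendsto_const])
    thus False using cU by simp
  qed
  have "((\<lambda>x. Z / (D x * Z)) \<longlongrightarrow> Z / of_nat (card U)) at_top"
    using lim cU by (intro tendsto_divide tendsto_const) auto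
  moreover have "Z / (D x * Z) = (\<Prod>P\<in>F x. inverse (1 - of_nat (ideal_norm R P) powr (- s)))" for x
    using Z0 prod_inversef[of "\<lambda>P. 1 - of_nat (ideal_norm R P) powr (- s)" "F x"]
    by (simp add: D_def divide_inverse o_def)
  ultimately show ?thesis unfolding F_def Z_def f_def U_def by simp
qed

end

section \<open>Theta series of norm-Euclidean rings\<close>

lemma has_sum_even_int:
  fixes f :: "int \<Rightarrow> real"
  assumes nonneg: "\<And>n. f n \<ge> 0" and even: "\<And>n. f (- n) = f n"
    and summable: "summable (\<lambda>n. f (int n + 1))"
  shows "(f has_sum (f 0 + 2 * (\<Sum>n. f (int n + 1)))) UNIV"
proof -
  define S where "S = (\<Sum>n. f (int n + 1))"
  have nat: "((\<lambda>n. f (int n + 1)) has_sum S) UNIV"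
    unfolding S_def using summable by (intro sums_nonneg_imp_has_sum summable_sums nonneg)
  have pos: "(f has_sum S) {0<..}"
    using nat
    by (subst (asm) has_sum_reindex_bij_witness[of _ "\<lambda>n. nat (n - 1)" "\<lambda>n. int n + 1" "{0<..}" f _ S]) auto
  have "(f has_sum S) {..<0}"
    using pos
    by (subst (asm) has_sum_reindex_bij_witness[of _ uminus uminus "{..<0}" f _ S]) (auto simp: even)
  with pos have "(f has_sum (S + S)) ({0<..} \<union> {..<0})"
    by (intro has_sum_Un_disjoint) auto
  hence "(f has_sum (f 0 + (S + S))) (insert 0 ({0<..} \<union> {..<0}))"
    by (intro has_sum_insert) auto
  moreover have "insert 0 ({0<..} \<union> {..<0}) = (UNIV :: int set)" by auto
  ultimately show ?thesis by (simp only: S_def mult_2)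
qed

lemma has_sum_jtheta:
  assumes "a > 0"
  shows "((\<lambda>n. exp (- a * (real_of_int n)\<^sup>2)) has_sum jtheta a) UNIV"
  using has_sum_even_int[of "\<lambda>n. exp (- a * (real_of_int n)\<^sup>2)"] summable_exp_neg_square[OF assms]
  by (simp add: jtheta_def)

text \<open>The \<open>max 1\<close> makes the term at \<open>n = 0\<close> equal to 1 instead of
  \<open>0 powr (- \<sigma>) = 0\<close>, so that products of such terms can dominate the lattice
  points on the axes in \<open>summable_quad_ring\<close>.\<close>

lemma summable_int_powr:
  assumes "\<sigma> > 1"
  shows "(\<lambda>n::int. (max 1 \<bar>real_of_int n\<bar>) powr (- \<sigma>)) summable_on UNIV"
proof -
  have "summable (\<lambda>n. real (Suc n) powr (- \<sigma>))"
    using assms by (subst summable_Suc_iff) (simp add: summable_real_powr_iff)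
  moreover have "(max 1 \<bar>real_of_int (int n + 1)\<bar>) powr (- \<sigma>) = real (Suc n) powr (- \<sigma>)" for n
    by (simp add: add.commute)
  ultimately have "summable (\<lambda>n. (max 1 \<bar>real_of_int (int n + 1)\<bar>) powr (- \<sigma>))" by simp
  from has_sum_even_int[OF _ _ this] show ?thesis by (auto intro: has_sum_imp_summable)
qed

lemma has_sum_product:
  fixes f g :: "'a \<Rightarrow> real"
  assumes f: "(f has_sum F) A" and g: "(g has_sum G) B" and nonneg: "\<And>x. f x \<ge> 0" "\<And>y. g y \<ge> 0"
  shows "((\<lambda>(x, y). f x * g y) has_sum (F * G)) (A \<times> B)"
proof -
  have 1: "((\<lambda>y. (case (x, y) of (x, y) \<Rightarrow> f x * g y)) has_sum (f x * G)) B" for x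
    using has_sum_cmult_right[OF g, of "f x"] by simp
  have 2: "((\<lambda>x. f x * G) has_sum (F * G)) A" by (rule has_sum_cmult_left[OF f])
  show ?thesis
    by (rule has_sum_SigmaI[OF 1 2], rule summable_on_SigmaI[OF 1])
       (use 2 nonneg in \<open>auto intro: has_sum_imp_summable\<close>)
qed

lemma has_sum_group_by:
  fixes h :: "nat \<Rightarrow> 'b :: real_normed_field"
  assumes fin: "\<And>m. finite {z \<in> A. n z = m}" and sum: "((\<lambda>z. h (n z)) has_sum S) A"
  shows "(\<lambda>m. of_nat (card {z \<in> A. n z = m}) * h m) sums S"
proof -
  have "((\<lambda>(m, z). h m) has_sum S) (Sigma UNIV (\<lambda>m. {z \<in> A. n z = m}))"
    using sum
    by (subst (asm) has_sum_reindex_bij_witness[of _ snd "\<lambda>z. (n z, z)"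
         "Sigma UNIV (\<lambda>m. {z \<in> A. n z = m})" "\<lambda>(m, z). h m" _ S]) auto
  hence "((\<lambda>m. of_nat (card {z \<in> A. n z = m}) * h m) has_sum S) UNIV"
    by (rule has_sum_SigmaD) (auto intro!: has_sum_finiteI fin)
  thus ?thesis by (rule has_sum_imp_sums)
qed

section \<open>Ring sums as theta and Dirichlet series\<close>

text \<open>\<open>T\<close> is a closed form of the theta sum, built from \<open>jtheta\<close> in
  the instances. The theta series runs over \<open>(cmod z)^2\<close> whatever \<open>e\<close> is,
  while the ideal norm is \<open>cmod z ^ e\<close>; this is the source of the weight
  \<open>e / 2\<close> and of the second integrality condition.\<close>

locale theta_ring = norm_euclidean_ring +
  fixes c :: real and T :: "real \<Rightarrow> real"
  assumes c_gt: "1 + real e / 2 < c"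
    and norm_square_Nats: "\<And>z. z \<in> R \<Longrightarrow> (cmod z)\<^sup>2 \<in> \<nat>"
    and theta_sum: "\<And>y. y > 0 \<Longrightarrow> ((\<lambda>z. exp (- c * (cmod z)\<^sup>2 * y)) has_sum T y) R"
    and theta_inversion: "\<And>y. y > 0 \<Longrightarrow> T (1 / y) = y powr (real e / 2) * T y"
begin

definition sqnorm :: "complex \<Rightarrow> nat" where "sqnorm z = nat \<lfloor>(cmod z)\<^sup>2\<rfloor>"

lemma sqnorm:
  assumes "z \<in> R"
  shows "real (sqnorm z) = (cmod z)\<^sup>2"
proof -
  obtain m where "(cmod z)\<^sup>2 = real m" using norm_square_Nats[OF assms] by (rule Nats_cases)
  thus ?thesis by (simp add: sqnorm_def)
qed

definition r :: "nat \<Rightarrow> nat" where "r m = card {z \<in> R. sqnorm z = m}"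

lemma finite_sqnorm: "finite {z \<in> R. sqnorm z = m}"
proof (rule finite_subset)
  show "{z \<in> R. sqnorm z = m} \<subseteq> insert 0 {z \<in> R - {0}. cmod z ^ e \<le> sqrt (real m) ^ e}"
    using sqnorm by (auto intro!: power_mono real_le_rsqrt)
qed (use finite_norm_le in simp)

lemma r_0: "r 0 = 1"
proof -
  have "{z \<in> R. sqnorm z = 0} = {0}"
  proof (intro equalityI subsetI)
    fix z assume "z \<in> {z \<in> R. sqnorm z = 0}"
    thus "z \<in> {0}" using sqnorm[of z] by simp
  qed (use zero_mem in \<open>auto simp: sqnorm_def\<close>)
  thus ?thesis by (simp add: r_def)
qed

lemma r_sums:
  fixes h :: "nat \<Rightarrow> 'b :: real_normed_field"
  assumes "((\<lambda>z. h (sqnorm z)) has_sum S) R"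
  shows "(\<lambda>m. of_nat (r m) * h m) sums S"
  unfolding r_def by (rule has_sum_group_by[OF finite_sqnorm assms])

text \<open>The change of variable \<open>w = k s\<close> with \<open>k = e / 2\<close> between the
  Mellin side and the zeta side.\<close>

lemma norm_term_sqnorm:
  fixes w :: complex
  assumes "z \<in> R - {0}"
  shows "of_nat (sqnorm z) powr (- w) = complex_of_real (cmod z ^ e) powr (- (w / of_real (real e / 2)))"
proof -
  have z: "cmod z > 0" and zR: "z \<in> R" using assms by auto
  have "complex_of_nat (sqnorm z) = of_real ((cmod z)\<^sup>2)" using sqnorm[OF zR] by (metis of_real_of_nat_eq)
  hence "of_nat (sqnorm z) powr (- w) = exp (- w * of_real (2 * ln (cmod z)))"
    using z by (simp add: powr_def Ln_of_real ln_realpow flip: of_real_power)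
  also have "\<dots> = complex_of_real (cmod z ^ e) powr (- (w / of_real (real e / 2)))"
    using z e_pos by (simp add: powr_def Ln_of_real ln_realpow field_simps flip: of_real_power)
  finally show ?thesis .
qed

lemma dirichlet_sums:
  assumes w: "Re w > real e / 2"
  shows "(\<lambda>m. of_nat (r m) * of_nat m powr (- w)) sums
           (\<Sum>\<^sub>\<infinity>z\<in>R - {0}. complex_of_real (cmod z ^ e) powr (- (w / of_real (real e / 2))))"
proof (rule r_sums)
  let ?s = "w / of_real (real e / 2)"
  have s: "Re ?s > 1" using w e_pos by (simp add: Re_divide_of_real field_simps del: of_real_divide)
  have "((\<lambda>z. complex_of_real (cmod z ^ e) powr (- ?s)) has_sum
          (\<Sum>\<^sub>\<infinity>z\<in>R - {0}. complex_of_real (cmod z ^ e) powr (- ?s))) (R - {0})"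
    by (rule has_sum_infsum[OF abs_summable_summable[OF summable_term[OF s order.refl]]])
  hence "((\<lambda>z. of_nat (sqnorm z) powr (- w)) has_sum
          (\<Sum>\<^sub>\<infinity>z\<in>R - {0}. complex_of_real (cmod z ^ e) powr (- ?s))) (R - {0})"
    by (rule has_sum_cong[THEN iffD2, rotated]) (rule norm_term_sqnorm)
  \<comment> \<open>Adding the element 0 is harmless because \<open>0 powr (- w)\<close> is
    0.\<close>
  from has_sum_insert[OF _ this, of 0] zero_mem
  show "((\<lambda>z. of_nat (sqnorm z) powr (- w)) has_sum
          (\<Sum>\<^sub>\<infinity>z\<in>R - {0}. complex_of_real (cmod z ^ e) powr (- ?s))) R"
    by (simp add: insert_absorb sqnorm_def)
qed

sublocale theta_series "\<lambda>m. real (r m)" c "real e / 2"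
proof
  show "summable (\<lambda>m. real (r m) * real m powr (- \<sigma>))" if "\<sigma> > real e / 2" for \<sigma>
  proof -
    have "summable (\<lambda>m. complex_of_nat (r m) * of_nat m powr (- of_real \<sigma>))"
      using dirichlet_sums[of "of_real \<sigma>"] that by (auto intro: sums_summable)
    hence "summable (\<lambda>m. Re (complex_of_nat (r m) * of_nat m powr (- of_real \<sigma>)))"
      by (rule summable_Re)
    moreover have "complex_of_nat m powr (- of_real \<sigma>) = of_real (real m powr (- \<sigma>))" for m
      by (simp flip: powr_of_real)
    ultimately show ?thesis by simp
  qed
  have T: "(\<lambda>m. real (r m) * exp (- c * real m * y)) sums T y" if "y > 0" for y
  proof (rule r_sums)
    show "((\<lambda>z. exp (- c * real (sqnorm z) * y)) has_sum T y) R"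
      using theta_sum[OF that] by (rule has_sum_cong[THEN iffD2, rotated]) (simp add: sqnorm)
  qed
  show "(\<Sum>m. real (r m) * exp (- c * real m / y)) =
      y powr (real e / 2) * (\<Sum>m. real (r m) * exp (- c * real m * y))" if "y > 0" for y
    using theta_inversion[OF that] T[OF that] T[of "1 / y"] that by (simp add: sums_iff)
qed (use c_gt e_pos r_0 in auto)

theorem ring_random_variable:
  obtains M :: "real measure" where "prob_space M" "sets M = sets borel"
    "\<And>a. integrable M (\<lambda>v. exp (a * v))"
    "\<And>s. Re s > 1 \<Longrightarrow> (\<integral>v. exp (s * of_real (real e / 2) * of_real v) \<partial>M) =
       of_real (real e / 2) * s * (s - 1) * Gamma (of_real (real e / 2) * s) * of_real c powr (- (of_real (real e / 2) * s)) *
       (\<Sum>\<^sub>\<infinity>z\<in>R - {0}. complex_of_real (cmod z ^ e) powr (- s))"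
proof -
  obtain M :: "real measure" where M: "prob_space M" "sets M = sets borel"
    "\<And>a. integrable M (\<lambda>v. exp (a * v))"
    "\<And>w. Re w > real e / 2 \<Longrightarrow> (\<integral>v. exp (w * of_real v) \<partial>M) =
       w * (w - of_real (real e / 2)) / of_real (real e / 2) * Gamma w * of_real c powr (- w) *
       (\<Sum>m. of_real (real (r m)) * of_nat m powr (- w))"
    using theta_series_random_variable by blast
  define k where "k = complex_of_real (real e / 2)"
  have k0: "k \<noteq> 0" using e_pos by (simp add: k_def)
  show ?thesis
  proof (rule that[OF M(1-3)])
    fix s assume s: "Re s > 1"
    have w: "Re (s * k) > real e / 2" using s e_pos by (simp add: k_def del: of_real_divide)
    have "(\<integral>v. exp (s * k * of_real v) \<partial>M) =
       (s * k) * (s * k - k) / k * Gamma (s * k) * of_real c powr (- (s * k)) *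
       (\<Sum>m. of_nat (r m) * of_nat m powr (- (s * k)))"
      using M(4)[OF w] by (simp add: k_def del: of_real_divide)
    also have "(\<Sum>m. of_nat (r m) * of_nat m powr (- (s * k))) =
        (\<Sum>\<^sub>\<infinity>z\<in>R - {0}. complex_of_real (cmod z ^ e) powr (- s))"
      using dirichlet_sums[OF w, folded k_def] unfolding nonzero_mult_div_cancel_right[OF k0]
      by (rule sums_unique[symmetric])
    also have "(s * k) * (s * k - k) / k = k * s * (s - 1)" using k0 by (simp add: field_simps)
    finally show "(\<integral>v. exp (s * of_real (real e / 2) * of_real v) \<partial>M) =
       of_real (real e / 2) * s * (s - 1) * Gamma (of_real (real e / 2) * s) * of_real c powr (- (of_real (real e / 2) * s)) *
       (\<Sum>\<^sub>\<infinity>z\<in>R - {0}. complex_of_real (cmod z ^ e) powr (- s))"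
      by (simp only: k_def mult.commute[of s])
  qed
qed

end

section \<open>Identification with the xi function\<close>

lemma dedekind_zeta_eq:
  assumes "norm_euclidean_ring (ring_of_integers K) e" "Re s > 1"
  shows "dedekind_zeta K s = (\<Sum>\<^sub>\<infinity>z\<in>ring_of_integers K - {0}. complex_of_real (cmod z ^ e) powr (- s)) /
     of_nat (card {z \<in> ring_of_integers K. cmod z = 1})"
  unfolding dedekind_zeta_def
  by (rule tendsto_Lim[OF trivial_limit_at_top_linorder norm_euclidean_ring.euler_product[OF assms]])

text \<open>By the identity theorem on the half-plane, an entire function with the prescribed values
  there is the one selected by \<open>THE\<close>; exhibiting it settles existence as well.\<close>

lemma dedekind_xi_eq:
  assumes hol: "f holomorphic_on UNIV"
    and eq: "\<And>s. 1 < Re s \<Longrightarrow> f s = inverse (of_real (c_const K)) * s * (s - 1)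
            * of_real \<bar>real_of_int (discriminant K)\<bar> powr (s / 2) * completed_zeta K s"
  shows "dedekind_xi K = f"
  unfolding dedekind_xi_def
proof (rule the_equality)
  fix g :: "complex \<Rightarrow> complex"
  assume g: "g holomorphic_on UNIV \<and>
      (\<forall>s. 1 < Re s \<longrightarrow> g s = inverse (of_real (c_const K)) * s * (s - 1)
            * of_real \<bar>real_of_int (discriminant K)\<bar> powr (s / 2) * completed_zeta K s)"
  show "g = f"
  proof
    fix z
    show "g z = f z"
    proof (rule analytic_continuation_open[of "{s. Re s > 1}" UNIV g f])
      show "open {s. Re s > 1}" by (rule open_halfspace_Re_gt)
      show "{s. Re s > 1} \<noteq> {}" using exI[of "\<lambda>s. Re s > 1" 2] by auto
    qed (use g hol eq in auto)
  qed
qed (use hol eq in auto)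

text \<open>\<open>const\<close> matches everything apart from \<open>s (s - 1)\<close> and the zeta
  function. The number of units on its right side compensates the division in
  \<open>dedekind_zeta_eq\<close>.\<close>

theorem xi_random_variable:
  assumes ring: "theta_ring (ring_of_integers K) e c T"
    and const: "\<And>s. inverse (of_real (c_const K)) * of_real \<bar>real_of_int (discriminant K)\<bar> powr (s / 2) *
          (Gamma_R s ^ r1 K * Gamma_C s ^ r2 K) =
        of_real (real e / 2) * Gamma (of_real (real e / 2) * s) * of_real c powr (- (of_real (real e / 2) * s)) *
        of_nat (card {z \<in> ring_of_integers K. cmod z = 1})"
  shows "\<exists>(M :: real measure) (X :: real \<Rightarrow> real).
           prob_space M \<and> X \<in> borel_measurable M \<and> (\<forall>\<omega>\<in>space M. 0 < X \<omega>) \<and>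
           (\<forall>s::complex. integrable M (\<lambda>\<omega>. complex_of_real (X \<omega>) powr s) \<and>
              (\<integral>\<omega>. complex_of_real (X \<omega>) powr s \<partial>M)
                = of_real \<bar>real_of_int (discriminant K)\<bar> powr (- s / 2) * dedekind_xi K s)"
proof -
  interpret theta_ring "ring_of_integers K" e c T by fact
  obtain M :: "real measure" where M: "prob_space M" "sets M = sets borel"
    "\<And>a. integrable M (\<lambda>v. exp (a * v))"
    "\<And>s. Re s > 1 \<Longrightarrow> (\<integral>v. exp (s * of_real (real e / 2) * of_real v) \<partial>M) =
       of_real (real e / 2) * s * (s - 1) * Gamma (of_real (real e / 2) * s) * of_real c powr (- (of_real (real e / 2) * s)) *
       (\<Sum>\<^sub>\<infinity>z\<in>ring_of_integers K - {0}. complex_of_real (cmod z ^ e) powr (- s))"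
    using ring_random_variable by blast
  define k where "k = complex_of_real (real e / 2)"
  define f where "f s = (\<integral>v. exp (s * k * of_real v) \<partial>M)" for s
  note mgf = holomorphic_moment_generating_function[OF M(2,3)]
  have "((\<lambda>s. \<integral>v. exp (s * complex_of_real v) \<partial>M) \<circ> (\<lambda>s. s * k)) holomorphic_on UNIV"
    by (intro holomorphic_on_compose holomorphic_on_subset[OF mgf(2)] holomorphic_intros) auto
  hence hol: "f holomorphic_on UNIV" by (simp add: f_def [abs_def] o_def)
  have "1 \<in> {z \<in> ring_of_integers K. cmod z = 1}" using one_mem by simp
  moreover have "finite {z \<in> ring_of_integers K. cmod z = 1}"
    by (rule finite_subset[OF _ finite_norm_le[of 1]]) auto
  ultimately have U: "card {z \<in> ring_of_integers K. cmod z = 1} \<noteq> 0" by auto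
  have "dedekind_xi K = f"
  proof (rule dedekind_xi_eq[OF hol])
    fix s assume s: "1 < Re s"
    define \<zeta> where "\<zeta> = dedekind_zeta K s"
    have z: "(\<Sum>\<^sub>\<infinity>z\<in>ring_of_integers K - {0}. complex_of_real (cmod z ^ e) powr (- s)) =
      of_nat (card {z \<in> ring_of_integers K. cmod z = 1}) * \<zeta>"
      unfolding \<zeta>_def using U by (subst dedekind_zeta_eq[OF norm_euclidean_ring_axioms s]) simp
    have "f s = s * (s - 1) * (of_real (real e / 2) * Gamma (of_real (real e / 2) * s) * of_real c powr (- (of_real (real e / 2) * s)) *
        of_nat (card {z \<in> ring_of_integers K. cmod z = 1})) * \<zeta>"
      unfolding f_def k_def M(4)[OF s] z by (simp only: mult_ac)
    also have "\<dots> = s * (s - 1) * (inverse (of_real (c_const K)) * of_real \<bar>real_of_int (discriminant K)\<bar> powr (s / 2) *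
          (Gamma_R s ^ r1 K * Gamma_C s ^ r2 K)) * \<zeta>"
      by (simp only: const)
    finally show "f s = inverse (of_real (c_const K)) * s * (s - 1)
            * of_real \<bar>real_of_int (discriminant K)\<bar> powr (s / 2) * completed_zeta K s"
      unfolding completed_zeta_def \<zeta>_def by (simp only: mult_ac)
  qed
  moreover define D where "D = \<bar>real_of_int (discriminant K)\<bar>"
  have D: "D > 0" unfolding D_def discriminant_def by (cases K) auto
  \<comment> \<open>With \<open>v = ln y\<close>, \<open>X\<close> is \<open>y^k / sqrt D\<close>:
    the power \<open>k\<close> turns the Mellin variable into \<open>k s\<close>, and the scaling
    yields \<open>D powr (- s / 2)\<close>.\<close>
  define X where "X v = exp (real e / 2 * v - ln D / 2)" for v
  have X: "complex_of_real (X v) powr s = of_real D powr (- s / 2) * exp (s * k * of_real v)" for v s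
  proof -
    have "complex_of_real (X v) powr s = exp (s * of_real (real e / 2 * v - ln D / 2))"
      unfolding powr_def X_def using exp_not_eq_zero by (subst Ln_of_real) auto
    also have "\<dots> = exp (- s / 2 * of_real (ln D) + s * k * of_real v)"
      by (rule arg_cong[of _ _ exp]) (simp add: k_def algebra_simps)
    also have "\<dots> = of_real D powr (- s / 2) * exp (s * k * of_real v)"
      unfolding exp_add using D by (simp add: powr_def Ln_of_real)
    finally show ?thesis .
  qed
  show ?thesis
  proof (intro exI[of _ M] exI[of _ X] conjI allI ballI M(1))
    show "X \<in> borel_measurable M" unfolding X_def [abs_def] measurable_cong_sets[OF M(2) refl] by measurable
    show "0 < X \<omega>" for \<omega> by (simp add: X_def)
    fix s :: complex
    show "integrable M (\<lambda>\<omega>. complex_of_real (X \<omega>) powr s)"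
      unfolding X by (intro integrable_mult_right mgf)
    show "(\<integral>\<omega>. complex_of_real (X \<omega>) powr s \<partial>M) =
        of_real \<bar>real_of_int (discriminant K)\<bar> powr (- s / 2) * dedekind_xi K s"
      unfolding X calculation f_def D_def[symmetric] by simp
  qed
qed

section \<open>The three rings of integers\<close>

definition quad_ring :: "nat \<Rightarrow> complex set" where
  "quad_ring d = {Complex (of_int a) (of_int b * sqrt (real d)) | a b. True}"

lemma quad_ringI: "Complex (of_int a) (of_int b * sqrt (real d)) \<in> quad_ring d"
  by (auto simp: quad_ring_def)

lemma quad_ringE:
  assumes "z \<in> quad_ring d"
  obtains a b where "z = Complex (of_int a) (of_int b * sqrt (real d))"
  using assms by (auto simp: quad_ring_def)

lemma of_int_quad_ring: "of_int a \<in> quad_ring d"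
  using quad_ringI[of a 0 d] by (simp add: complex_of_real_def[symmetric])

lemma Complex_mult_sqrt:
  "Complex (of_int a) (of_int b * sqrt (real d)) * Complex (of_int a') (of_int b' * sqrt (real d)) =
   Complex (of_int (a * a' - int d * b * b')) (of_int (a * b' + b * a') * sqrt (real d))"
  by (simp add: complex_eq_iff algebra_simps)

lemma complex_subring_quad_ring: "complex_subring (quad_ring d)"
proof
  show "1 \<in> quad_ring d" using of_int_quad_ring[of 1 d] by simp
  fix x assume "x \<in> quad_ring d"
  then obtain a b where x: "x = Complex (of_int a) (of_int b * sqrt (real d))" by (rule quad_ringE)
  have "- x = Complex (of_int (- a)) (of_int (- b) * sqrt (real d))" by (simp add: x complex_eq_iff)
  thus "- x \<in> quad_ring d" by (simp only: quad_ringI)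
  fix y assume "y \<in> quad_ring d"
  then obtain a' b' where y: "y = Complex (of_int a') (of_int b' * sqrt (real d))" by (rule quad_ringE)
  have "x + y = Complex (of_int (a + a')) (of_int (b + b') * sqrt (real d))"
    by (simp add: x y complex_eq_iff distrib_right)
  thus "x + y \<in> quad_ring d" by (simp only: quad_ringI)
  show "x * y \<in> quad_ring d" unfolding x y Complex_mult_sqrt by (rule quad_ringI)
qed

lemma cnj_quad_ring: "x \<in> quad_ring d \<Longrightarrow> cnj x \<in> quad_ring d"
proof (elim quad_ringE)
  fix a b assume "x = Complex (of_int a) (of_int b * sqrt (real d))"
  thus ?thesis using quad_ringI[of a "- b" d] by (simp add: complex_cnj)
qed

lemma cmod_square_Complex_sqrt:
  "(cmod (Complex (of_int a) (of_int b * sqrt (real d))))\<^sup>2 = real_of_int (a\<^sup>2 + int d * b\<^sup>2)"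
  by (simp add: cmod_power2 power_mult_distrib)

lemma cmod_square_Nats: "z \<in> quad_ring d \<Longrightarrow> (cmod z)\<^sup>2 \<in> \<nat>"
proof (elim quad_ringE)
  fix a b assume z: "z = Complex (of_int a) (of_int b * sqrt (real d))"
  have "real_of_int (a\<^sup>2 + int d * b\<^sup>2) = real (nat (a\<^sup>2 + int d * b\<^sup>2))" by simp
  thus ?thesis unfolding z cmod_square_Complex_sqrt by (metis of_nat_in_Nats)
qed

lemma Complex_sqrt_eq_iff:
  assumes "d > 0"
  shows "Complex (of_int a) (of_int b * sqrt (real d)) = Complex (of_int a') (of_int b' * sqrt (real d)) \<longleftrightarrow> a = a' \<and> b = b'"
  using assms by simp

lemma residue_system_of_nat:
  assumes d: "d > 0" and n: "n > 0"
  defines "S \<equiv> (\<lambda>(a, b). Complex (of_int a) (of_int b * sqrt (real d))) ` ({0..<int n} \<times> {0..<int n})"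
  shows "complex_subring.residue_system (quad_ring d) (of_nat n) S" "card S = n\<^sup>2" "finite S"
proof -
  interpret complex_subring "quad_ring d" by (rule complex_subring_quad_ring)
  have inj: "inj_on (\<lambda>(a, b). Complex (of_int a) (of_int b * sqrt (real d))) ({0..<int n} \<times> {0..<int n})"
    using d by (auto simp: inj_on_def)
  show "card S = n\<^sup>2" unfolding S_def card_image[OF inj] by (simp add: card_cartesian_product power2_eq_square)
  show "finite S" by (simp add: S_def)
  have mult_n: "Complex (of_int a) (of_int b * sqrt (real d)) * of_nat n =
      Complex (of_int (a * int n)) (of_int (b * int n) * sqrt (real d))" for a b
    by (simp add: complex_eq_iff)
  have mem: "Complex (of_int a) (of_int b * sqrt (real d)) - Complex (of_int a') (of_int b' * sqrt (real d)) \<in> Rmult (of_nat n)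
      \<longleftrightarrow> int n dvd a - a' \<and> int n dvd b - b'" for a b a' b'
  proof -
    have diff: "Complex (of_int a) (of_int b * sqrt (real d)) - Complex (of_int a') (of_int b' * sqrt (real d)) =
       Complex (of_int (a - a')) (of_int (b - b') * sqrt (real d))"
      by (simp add: complex_eq_iff algebra_simps)
    show ?thesis unfolding diff
    proof
      assume "Complex (of_int (a - a')) (of_int (b - b') * sqrt (real d)) \<in> Rmult (of_nat n)"
      then obtain q where "q \<in> quad_ring d" "Complex (of_int (a - a')) (of_int (b - b') * sqrt (real d)) = q * of_nat n"
        by blast
      then obtain u v where "Complex (of_int (a - a')) (of_int (b - b') * sqrt (real d)) =
          Complex (of_int (u * int n)) (of_int (v * int n) * sqrt (real d))"
        by (metis mult_n quad_ringE)
      hence "a - a' = u * int n \<and> b - b' = v * int n" by (simp only: Complex_sqrt_eq_iff[OF d])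
      thus "int n dvd a - a' \<and> int n dvd b - b'" by simp
    next
      assume "int n dvd a - a' \<and> int n dvd b - b'"
      then obtain u v where "a - a' = u * int n" "b - b' = v * int n" by (metis dvdE mult.commute)
      thus "Complex (of_int (a - a')) (of_int (b - b') * sqrt (real d)) \<in> Rmult (of_nat n)"
        using mult_n[of u v] quad_ringI[of u v d] by (metis image_eqI)
    qed
  qed
  show "residue_system (of_nat n) S"
    unfolding residue_system_def
  proof (intro conjI ballI)
    show "S \<subseteq> quad_ring d" unfolding S_def using quad_ringI by auto
    fix x assume "x \<in> quad_ring d"
    then obtain a b where x: "x = Complex (of_int a) (of_int b * sqrt (real d))" by (rule quad_ringE)
    show "\<exists>!y. y \<in> S \<and> x - y \<in> Rmult (of_nat n)"
    proof (rule ex1I[of _ "Complex (of_int (a mod int n)) (of_int (b mod int n) * sqrt (real d))"], intro conjI)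
      show "Complex (of_int (a mod int n)) (of_int (b mod int n) * sqrt (real d)) \<in> S"
        unfolding S_def using n by (intro image_eqI[of _ _ "(a mod int n, b mod int n)"]) auto
      show "x - Complex (of_int (a mod int n)) (of_int (b mod int n) * sqrt (real d)) \<in> Rmult (of_nat n)"
        unfolding x mem by (simp add: dvd_minus_mod)
      fix y assume y: "y \<in> S \<and> x - y \<in> Rmult (of_nat n)"
      then obtain a' b' where y': "y = Complex (of_int a') (of_int b' * sqrt (real d))" "a' \<in> {0..<int n}" "b' \<in> {0..<int n}"
        unfolding S_def by (force elim: imageE)
      have "int n dvd a - a'" "int n dvd b - b'" using y mem unfolding x y'(1) by auto
      hence "a mod int n = a' mod int n" "b mod int n = b' mod int n" by (simp_all add: mod_eq_dvd_iff)
      thus "y = Complex (of_int (a mod int n)) (of_int (b mod int n) * sqrt (real d))"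
        using y' by simp
    qed
  qed
qed

text \<open>The index of \<open>(b)\<close> is multiplicative and invariant under conjugation, so its square is the
  index of \<open>(|b|\<^sup>2)\<close>.\<close>

lemma ideal_norm_quad_ring:
  assumes d: "d > 0" and b: "b \<in> quad_ring d" "b \<noteq> 0"
  shows "real (ideal_norm (quad_ring d) ((\<lambda>x. x * b) ` quad_ring d)) = (cmod b)\<^sup>2"
proof -
  interpret complex_subring "quad_ring d" by (rule complex_subring_quad_ring)
  obtain n where n: "(cmod b)\<^sup>2 = real n" using cmod_square_Nats[OF b(1)] by (rule Nats_cases)
  have bn: "b * cnj b = of_nat n" using complex_norm_square[of b] n by simp
  have "0 < (cmod b)\<^sup>2" using b by simp
  hence n0: "n > 0" unfolding n by simp
  obtain S where S: "residue_system (of_nat n) S" "card S = n\<^sup>2" "finite S"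
    using residue_system_of_nat[OF d n0] by blast
  define cls where "cls x = {y \<in> quad_ring d. x - y \<in> Rmult b}" for x
  have cls: "cls x = cls y \<longleftrightarrow> x - y \<in> Rmult b" if "x \<in> quad_ring d" "y \<in> quad_ring d" for x y
    unfolding cls_def by (rule residue_class_eq_iff[OF b(1) that])
  \<comment> \<open>One representative in \<open>S\<close> for each class modulo \<open>b\<close>.
    As \<open>b\<close> divides \<open>n = b * cnj b\<close>, every class modulo \<open>b\<close>
    already meets \<open>S\<close>.\<close>
  obtain V where V: "V \<subseteq> S" "inj_on cls V" "cls ` S = cls ` V"
    using subset_image_inj[of "cls ` S" cls S] by auto
  have SR: "S \<subseteq> quad_ring d" using S(1) by (simp add: residue_system_def)
  have V_res: "residue_system b V"
    unfolding residue_system_def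
  proof (intro conjI ballI)
    show "V \<subseteq> quad_ring d" using V SR by auto
    fix x assume x: "x \<in> quad_ring d"
    obtain y where y: "y \<in> S" "x - y \<in> Rmult (of_nat n)" using S(1) x unfolding residue_system_def by blast
    then obtain q where q: "q \<in> quad_ring d" "x - y = q * of_nat n" by blast
    have "x - y = (q * cnj b) * b" unfolding q bn[symmetric] by simp
    moreover have "q * cnj b \<in> quad_ring d" by (intro mult_mem q cnj_quad_ring b)
    ultimately have "x - y \<in> Rmult b" by blast
    hence "cls x = cls y" using cls[of x y] x y SR by auto
    moreover obtain v where v: "v \<in> V" "cls y = cls v" using V(3) y(1) by blast
    ultimately have xv: "cls x = cls v" by simp
    show "\<exists>!y. y \<in> V \<and> x - y \<in> Rmult b"
    proof (rule ex1I[of _ v])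
      show "v \<in> V \<and> x - v \<in> Rmult b" using xv v V SR x cls[of x v] by blast
      fix u assume u: "u \<in> V \<and> x - u \<in> Rmult b"
      hence "cls x = cls u" using V SR x cls[of x u] by blast
      thus "u = v" using xv u v V(2) by (auto dest: inj_onD)
    qed
  qed
  \<comment> \<open>Conjugation is an automorphism of the ring that takes the ideal of
    \<open>b\<close> to that of \<open>cnj b\<close>, so it carries the transversal along.\<close>
  have "residue_system (cnj b) (cnj ` V)"
    unfolding residue_system_def
  proof (intro conjI ballI)
    show "cnj ` V \<subseteq> quad_ring d" using V SR cnj_quad_ring by auto
    fix x assume "x \<in> quad_ring d"
    hence x: "cnj x \<in> quad_ring d" by (rule cnj_quad_ring)
    have iff: "x - cnj y \<in> Rmult (cnj b) \<longleftrightarrow> cnj x - y \<in> Rmult b" for y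
    proof
      assume "x - cnj y \<in> Rmult (cnj b)"
      then obtain q where q: "q \<in> quad_ring d" "x - cnj y = q * cnj b" by blast
      have "cnj x - y = cnj q * b" using arg_cong[OF q(2), of cnj] by simp
      thus "cnj x - y \<in> Rmult b" using cnj_quad_ring[OF q(1)] by blast
    next
      assume "cnj x - y \<in> Rmult b"
      then obtain q where q: "q \<in> quad_ring d" "cnj x - y = q * b" by blast
      have "x - cnj y = cnj q * cnj b" using arg_cong[OF q(2), of cnj] by simp
      thus "x - cnj y \<in> Rmult (cnj b)" using cnj_quad_ring[OF q(1)] by blast
    qed
    obtain v where v: "v \<in> V" "cnj x - v \<in> Rmult b" "\<And>u. u \<in> V \<Longrightarrow> cnj x - u \<in> Rmult b \<Longrightarrow> u = v"
      using V_res x unfolding residue_system_def by metis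
    show "\<exists>!y. y \<in> cnj ` V \<and> x - y \<in> Rmult (cnj b)"
    proof (rule ex1I[of _ "cnj v"])
      show "cnj v \<in> cnj ` V \<and> x - cnj v \<in> Rmult (cnj b)" using v(1,2) iff[of v] by simp
      fix y assume y: "y \<in> cnj ` V \<and> x - y \<in> Rmult (cnj b)"
      then obtain u where u: "u \<in> V" "y = cnj u" by blast
      have "cnj x - u \<in> Rmult b" using y iff[of u] unfolding u(2) by (rule iffD1[OF _ conjunct2, rotated])
      thus "y = cnj v" using v(3)[OF u(1)] u(2) by simp
    qed
  qed
  then obtain W where W: "residue_system (b * cnj b) W" "card W = card V * card (cnj ` V)"
    using residue_system_mult[OF b(1) cnj_quad_ring[OF b(1)] b(2) V_res] by blast
  have "card (cnj ` V) = card V" by (intro card_image) (auto simp: inj_on_def)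
  \<comment> \<open>Both are transversals modulo \<open>b * cnj b = n\<close>, so both have the
    index \<open>n^2\<close> as their size.\<close>
  moreover have "card W = card S"
    using ideal_norm_residue_system[OF _ S(1)] ideal_norm_residue_system[OF _ W(1)] of_int_quad_ring[of "int n" d]
    unfolding bn by simp
  ultimately have "card V * card V = n * n" using W S by (simp add: power2_eq_square)
  hence "card V = n" by (metis nat_le_linear mult_le_mono le_antisym power2_eq_square power2_eq_iff_nonneg zero_le)
  thus ?thesis unfolding ideal_norm_residue_system[OF b(1) V_res] n by simp
qed

text \<open>Rounding both coordinates of \<open>x / y\<close> leaves a squared error of at most
  \<open>1 / 4 + d / 4\<close>, which is below 1 because \<open>d\<close> is at most 2.\<close>

lemma quad_ring_euclid:
  assumes d: "d \<in> {1, 2}" and ab: "x \<in> quad_ring d" "y \<in> quad_ring d" "y \<noteq> 0"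
  shows "\<exists>q\<in>quad_ring d. cmod (x - q * y) < cmod y"
proof -
  define z where "z = x / y"
  define a where "a = round (Re z)"
  define b where "b = round (Im z / sqrt (real d))"
  define q where "q = Complex (of_int a) (of_int b * sqrt (real d))"
  have sd: "sqrt (real d) > 0" using d by auto
  have "(Re z - of_int a)\<^sup>2 \<le> (1/2)\<^sup>2"
    using of_int_round_abs_le[of "Re z"] unfolding a_def by (intro iffD1[OF abs_le_square_iff]) (simp add: abs_minus_commute)
  moreover have "(Im z / sqrt (real d) - of_int b)\<^sup>2 \<le> (1/2)\<^sup>2"
    using of_int_round_abs_le[of "Im z / sqrt (real d)"] unfolding b_def
    by (intro iffD1[OF abs_le_square_iff]) (simp add: abs_minus_commute)
  moreover have "Im z - of_int b * sqrt (real d) = sqrt (real d) * (Im z / sqrt (real d) - of_int b)"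
    using sd by (simp add: algebra_simps)
  hence "(Im z - of_int b * sqrt (real d))\<^sup>2 = real d * (Im z / sqrt (real d) - of_int b)\<^sup>2"
    by (simp add: power_mult_distrib)
  moreover have "real d * (Im z / sqrt (real d) - of_int b)\<^sup>2 \<le> 2 * (Im z / sqrt (real d) - of_int b)\<^sup>2"
    using d by (intro mult_right_mono) auto
  ultimately have "(Re z - of_int a)\<^sup>2 + (Im z - of_int b * sqrt (real d))\<^sup>2 < 1"
    by (simp add: power2_eq_square)
  hence "(cmod (z - q))\<^sup>2 < 1\<^sup>2" by (simp add: cmod_power2 q_def)
  hence "cmod (z - q) < 1" by (rule power2_less_imp_less) simp
  moreover have "x - q * y = (z - q) * y" using ab by (simp add: z_def algebra_simps)
  ultimately have "cmod (x - q * y) < cmod y" using ab by (simp add: norm_mult)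
  moreover have "q \<in> quad_ring d" unfolding q_def by (rule quad_ringI)
  ultimately show ?thesis by blast
qed

lemma bij_betw_quad_ring:
  assumes "d > 0"
  shows "bij_betw (\<lambda>(a, b). Complex (of_int a) (of_int b * sqrt (real d))) UNIV (quad_ring d)"
  unfolding bij_betw_def using assms by (auto simp: inj_on_def quad_ring_def image_def)

text \<open>Off the origin \<open>a^2 + d b^2\<close> is at least
  \<open>max 1 |a| * max 1 |b|\<close>, so the double series is dominated by a product of two
  convergent single series.\<close>

lemma summable_quad_ring:
  assumes d: "d > 0" and s: "\<sigma> > 1"
  shows "(\<lambda>z. ((cmod z)\<^sup>2) powr (- \<sigma>)) summable_on (quad_ring d - {0})"
proof -
  define m where "m a = max 1 \<bar>real_of_int a\<bar>" for a
  define \<phi> where "\<phi> = (\<lambda>(a, b). Complex (of_int a) (of_int b * sqrt (real d)))"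
  have m: "((\<lambda>a. m a powr (- \<sigma>)) has_sum (\<Sum>\<^sub>\<infinity>a. m a powr (- \<sigma>))) UNIV"
    unfolding m_def by (rule has_sum_infsum[OF summable_int_powr[OF s]])
  have "(\<lambda>(a, b). m a powr (- \<sigma>) * m b powr (- \<sigma>)) summable_on UNIV \<times> UNIV"
    by (rule has_sum_imp_summable[OF has_sum_product[OF m m]]) auto
  hence "(\<lambda>(a, b). m a powr (- \<sigma>) * m b powr (- \<sigma>)) summable_on - {(0, 0)}"
    by (rule summable_on_subset_banach) auto
  hence "(\<lambda>p. ((cmod (\<phi> p))\<^sup>2) powr (- \<sigma>)) summable_on - {(0, 0)}"
  proof (rule summable_on_comparison_test)
    fix p :: "int \<times> int" assume p: "p \<in> - {(0, 0)}"
    obtain a b where ab: "p = (a, b)" by (cases p)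
    have mb: "m a * m b \<le> (real_of_int a)\<^sup>2 + (real_of_int b)\<^sup>2"
    proof (cases "a = 0 \<or> b = 0")
      case True
      have sq: "\<bar>real_of_int x\<bar> \<le> (real_of_int x)\<^sup>2" "1 \<le> (real_of_int x)\<^sup>2" if "x \<noteq> 0" for x
      proof -
        have "1 \<le> \<bar>real_of_int x\<bar>" using that by linarith
        hence "\<bar>real_of_int x\<bar> * 1 \<le> \<bar>real_of_int x\<bar> * \<bar>real_of_int x\<bar>" by (intro mult_left_mono) auto
        thus "\<bar>real_of_int x\<bar> \<le> (real_of_int x)\<^sup>2" by (simp add: power2_eq_square)
        with \<open>1 \<le> \<bar>real_of_int x\<bar>\<close> show "1 \<le> (real_of_int x)\<^sup>2" by linarith
      qed
      show ?thesis using True p ab sq[of a] sq[of b] by (auto simp: m_def)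
    next
      case False
      hence "m a = \<bar>real_of_int a\<bar>" "m b = \<bar>real_of_int b\<bar>" by (auto simp: m_def)
      hence "m a * m b = \<bar>real_of_int a\<bar> * \<bar>real_of_int b\<bar>" by simp
      moreover have "2 * (\<bar>real_of_int a\<bar> * \<bar>real_of_int b\<bar>) \<le> (real_of_int a)\<^sup>2 + (real_of_int b)\<^sup>2"
        using sum_squares_bound[of "\<bar>real_of_int a\<bar>" "\<bar>real_of_int b\<bar>"] by simp
      moreover have "0 \<le> \<bar>real_of_int a\<bar> * \<bar>real_of_int b\<bar>" by simp
      ultimately show ?thesis by linarith
    qed
    have "1 * (real_of_int b)\<^sup>2 \<le> real d * (real_of_int b)\<^sup>2" using d by (intro mult_right_mono) auto
    hence "m a * m b \<le> (cmod (\<phi> p))\<^sup>2"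
      using mb unfolding ab \<phi>_def by (simp add: cmod_square_Complex_sqrt)
    moreover have "m a \<ge> 1" "m b \<ge> 1" by (auto simp: m_def)
    hence "m a * m b > 0" by simp
    ultimately have "((cmod (\<phi> p))\<^sup>2) powr (- \<sigma>) \<le> (m a * m b) powr (- \<sigma>)"
      using s by (intro powr_mono2') auto
    also have "\<dots> = m a powr (- \<sigma>) * m b powr (- \<sigma>)"
      by (rule powr_mult)
    finally show "((cmod (\<phi> p))\<^sup>2) powr (- \<sigma>) \<le> (case p of (a, b) \<Rightarrow> m a powr (- \<sigma>) * m b powr (- \<sigma>))"
      by (simp add: ab)
  qed auto
  moreover have "bij_betw \<phi> (- {(0, 0)}) (quad_ring d - {0})"
  proof -
    have "bij_betw \<phi> (UNIV - {(0, 0)}) (quad_ring d - {\<phi> (0, 0)})"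
      using bij_betw_quad_ring[OF d] unfolding \<phi>_def[symmetric]
      by (intro bij_betw_DiffI) (auto simp: bij_betw_def)
    moreover have "\<phi> (0, 0) = 0" by (simp add: \<phi>_def complex_eq_iff)
    ultimately show ?thesis by (simp add: Compl_eq_Diff_UNIV)
  qed
  ultimately show ?thesis by (subst (asm) summable_on_reindex_bij_betw) auto
qed

text \<open>For \<open>z = a + b sqrt(-d)\<close>, \<open>(cmod z)^2 / sqrt d\<close> equals
  \<open>a^2 / sqrt d + sqrt d * b^2\<close>, so the theta series is a product of two
  one-dimensional ones. The constant \<open>pi / sqrt d\<close> makes their scales reciprocal:
  replacing \<open>y\<close> by \<open>1 / y\<close> swaps the factors, and the two square root
  multipliers have product \<open>y\<close>.\<close>

lemma theta_ring_quad_ring: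
  assumes d: "d \<in> {1, 2}"
  shows "theta_ring (quad_ring d) 2 (pi / sqrt (real d))
           (\<lambda>y. jtheta (pi * (y / sqrt (real d))) * jtheta (pi * (sqrt (real d) * y)))"
proof -
  have d0: "d > 0" and sd: "sqrt (real d) > 0" using d by auto
  interpret complex_subring "quad_ring d" by (rule complex_subring_quad_ring)
  show ?thesis
  proof
    show "\<exists>q\<in>quad_ring d. cmod (a - q * b) < cmod b" if "a \<in> quad_ring d" "b \<in> quad_ring d" "b \<noteq> 0" for a b
      by (rule quad_ring_euclid[OF d that])
    show "real (ideal_norm (quad_ring d) (Rmult b)) = cmod b ^ 2" if "b \<in> quad_ring d" "b \<noteq> 0" for b
      by (rule ideal_norm_quad_ring[OF d0 that])
    show "(\<lambda>z. (cmod z ^ 2) powr (- \<sigma>)) summable_on (quad_ring d - {0})" if "\<sigma> > 1" for \<sigma>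
      by (rule summable_quad_ring[OF d0 that])
    \<comment> \<open>This is \<open>2 sqrt d < pi\<close>; for \<open>d = 2\<close> it follows from
      \<open>sqrt 2 < 3 / 2\<close> and \<open>pi > 3\<close>.\<close>
    show "1 + real 2 / 2 < pi / sqrt (real d)"
    proof -
      have "sqrt (real d) \<le> sqrt 2" using d by auto
      moreover have "sqrt 2 < 3 / 2" by (rule real_less_lsqrt) (auto simp: power2_eq_square)
      ultimately have "2 * sqrt (real d) < pi" using pi_gt3 by linarith
      thus ?thesis using sd by (simp add: field_simps)
    qed
    fix y :: real assume y: "y > 0"
    define \<phi> where "\<phi> = (\<lambda>(a, b). Complex (of_int a) (of_int b * sqrt (real d)))"
    have "((\<lambda>(a, b). exp (- (pi * (y / sqrt (real d))) * (real_of_int a)\<^sup>2) * exp (- (pi * (sqrt (real d) * y)) * (real_of_int b)\<^sup>2))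
        has_sum (jtheta (pi * (y / sqrt (real d))) * jtheta (pi * (sqrt (real d) * y)))) (UNIV \<times> UNIV)"
      using y sd by (intro has_sum_product has_sum_jtheta mult_pos_pos divide_pos_pos) auto
    also have "(\<lambda>(a, b). exp (- (pi * (y / sqrt (real d))) * (real_of_int a)\<^sup>2) * exp (- (pi * (sqrt (real d) * y)) * (real_of_int b)\<^sup>2))
        = (\<lambda>p. exp (- (pi / sqrt (real d)) * (cmod (\<phi> p))\<^sup>2 * y))"
    proof (rule ext, clarify)
      fix a b
      have dd: "real d / sqrt (real d) = sqrt (real d)" by (rule real_div_sqrt) simp
      have "- (pi / sqrt (real d)) * (cmod (\<phi> (a, b)))\<^sup>2 * y =
         - (pi * (y / sqrt (real d))) * (real_of_int a)\<^sup>2 - pi * (real d / sqrt (real d) * y) * (real_of_int b)\<^sup>2"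
        by (simp add: \<phi>_def cmod_square_Complex_sqrt algebra_simps add_divide_distrib)
      thus "exp (- (pi * (y / sqrt (real d))) * (real_of_int a)\<^sup>2) * exp (- (pi * (sqrt (real d) * y)) * (real_of_int b)\<^sup>2) =
        exp (- (pi / sqrt (real d)) * (cmod (\<phi> (a, b)))\<^sup>2 * y)"
        unfolding dd exp_add[symmetric] by simp
    qed
    finally show "((\<lambda>z. exp (- (pi / sqrt (real d)) * (cmod z)\<^sup>2 * y)) has_sum
        (jtheta (pi * (y / sqrt (real d))) * jtheta (pi * (sqrt (real d) * y)))) (quad_ring d)"
      unfolding UNIV_Times_UNIV
      by (rule iffD1[OF has_sum_reindex_bij_betw[OF bij_betw_quad_ring[OF d0, folded \<phi>_def]]])
    have "jtheta (pi * (1 / y / sqrt (real d))) = sqrt (sqrt (real d) * y) * jtheta (pi * (sqrt (real d) * y))"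
      using jtheta_inversion[of "sqrt (real d) * y"] y sd by (simp add: field_simps)
    moreover have "jtheta (pi * (sqrt (real d) * (1 / y))) = sqrt (y / sqrt (real d)) * jtheta (pi * (y / sqrt (real d)))"
      using jtheta_inversion[of "y / sqrt (real d)"] y sd by (simp add: field_simps)
    moreover have "sqrt (sqrt (real d) * y) * sqrt (y / sqrt (real d)) = y"
      using y sd by (simp add: real_sqrt_mult[symmetric])
    ultimately show "jtheta (pi * (1 / y / sqrt (real d))) * jtheta (pi * (sqrt (real d) * (1 / y))) =
       y powr (real 2 / 2) * (jtheta (pi * (y / sqrt (real d))) * jtheta (pi * (sqrt (real d) * y)))"
      using y by (simp add: mult_ac)
  qed (use cmod_square_Nats in auto)
qed

section \<open>The rational integers\<close>

lemma theta_ring_Ints: "theta_ring \<int> 1 pi (\<lambda>y. jtheta (pi * y))"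
proof -
  interpret complex_subring "\<int> :: complex set" by standard auto
  show ?thesis
  proof
    show "cmod z ^ 1 \<in> \<nat>" "(cmod z)\<^sup>2 \<in> \<nat>" if z: "z \<in> \<int>" for z
    proof -
      obtain n where n: "z = of_int n" using z by (rule Ints_cases)
      have "cmod z = real (nat \<bar>n\<bar>)" unfolding n by simp
      thus "cmod z ^ 1 \<in> \<nat>" "(cmod z)\<^sup>2 \<in> \<nat>" by (metis of_nat_in_Nats of_nat_power)+
    qed
    show "\<exists>q\<in>\<int>. cmod (a - q * b) < cmod b" if ab: "a \<in> \<int>" "b \<in> \<int>" "b \<noteq> 0" for a b
    proof -
      obtain m n where mn: "a = of_int m" "b = of_int n" using ab by (metis Ints_cases)
      have "a - of_int (m div n) * b = of_int (m mod n)"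
        unfolding mn by (simp add: minus_div_mult_eq_mod [symmetric])
      moreover have "\<bar>m mod n\<bar> < \<bar>n\<bar>" using mn ab abs_mod_less[of n m] by simp
      hence "real_of_int \<bar>m mod n\<bar> < real_of_int \<bar>n\<bar>" by simp
      ultimately have "cmod (a - of_int (m div n) * b) < cmod b" using mn by simp
      thus ?thesis by (intro bexI[of _ "of_int (m div n)"]) auto
    qed
    show "real (ideal_norm \<int> (Rmult b)) = cmod b ^ 1" if b: "b \<in> \<int>" "b \<noteq> 0" for b
    proof -
      obtain n where n: "b = of_int n" using b(1) by (rule Ints_cases)
      define S where "S = (of_int ` {0..<\<bar>n\<bar>} :: complex set)"
      have mem: "of_int x - of_int y \<in> Rmult b \<longleftrightarrow> n dvd x - y" for x y
      proof
        assume "of_int x - of_int y \<in> Rmult b"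
        then obtain q where "complex_of_int (x - y) = of_int q * of_int n" by (auto simp: n elim!: Ints_cases)
        hence "x - y = q * n" by (simp only: of_int_mult[symmetric] of_int_eq_iff)
        thus "n dvd x - y" by simp
      next
        assume "n dvd x - y"
        then obtain q where "x - y = q * n" by (metis dvdE mult.commute)
        hence "complex_of_int x - of_int y = of_int q * b" unfolding n by (metis of_int_diff of_int_mult)
        thus "of_int x - of_int y \<in> Rmult b" by auto
      qed
      have "residue_system b S"
        unfolding residue_system_def
      proof (intro conjI ballI)
        show "S \<subseteq> \<int>" by (auto simp: S_def)
        fix x :: complex assume "x \<in> \<int>"
        then obtain m where m: "x = of_int m" by (rule Ints_cases)
        have n0: "\<bar>n\<bar> > 0" using b n by simp
        show "\<exists>!y. y \<in> S \<and> x - y \<in> Rmult b"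
        proof (rule ex1I[of _ "of_int (m mod \<bar>n\<bar>)"], intro conjI)
          show "of_int (m mod \<bar>n\<bar>) \<in> S" using n0 by (simp add: S_def)
          have "\<bar>n\<bar> dvd m - m mod \<bar>n\<bar>" by (rule dvd_minus_mod)
          thus "x - of_int (m mod \<bar>n\<bar>) \<in> Rmult b" unfolding m mem by (simp only: abs_dvd_iff)
          fix y assume y: "y \<in> S \<and> x - y \<in> Rmult b"
          then obtain l where l: "y = of_int l" "l \<in> {0..<\<bar>n\<bar>}" unfolding S_def by blast
          have "\<bar>n\<bar> dvd m - l" using y unfolding m l(1) mem abs_dvd_iff by blast
          hence "m mod \<bar>n\<bar> = l mod \<bar>n\<bar>" by (simp only: mod_eq_dvd_iff)
          thus "y = of_int (m mod \<bar>n\<bar>)" using l by simp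
        qed
      qed
      from ideal_norm_residue_system[OF b(1) this] have "ideal_norm \<int> (Rmult b) = card S" .
      also have "card S = nat \<bar>n\<bar>" unfolding S_def by (subst card_image) (auto simp: inj_on_def)
      finally show ?thesis by (simp add: n)
    qed
    show "(\<lambda>z. (cmod z ^ 1) powr (- \<sigma>)) summable_on \<int> - {0}" if "\<sigma> > 1" for \<sigma>
    proof -
      have "(\<lambda>n::int. (max 1 \<bar>real_of_int n\<bar>) powr (- \<sigma>)) summable_on - {0}"
        by (rule summable_on_subset_banach[OF summable_int_powr[OF that]]) auto
      also have "?this \<longleftrightarrow> (\<lambda>n::int. (cmod (of_int n) ^ 1) powr (- \<sigma>)) summable_on - {0}"
        by (intro summable_on_cong) (auto intro!: arg_cong[of _ _ "\<lambda>x. x powr _"] simp: max_def)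
      also have "\<dots> \<longleftrightarrow> ?thesis"
        by (rule summable_on_reindex_bij_betw) (auto simp: bij_betw_def inj_on_def Ints_def)
      finally show ?thesis .
    qed
    show "1 + real 1 / 2 < pi" using pi_gt3 by simp
    fix y :: real assume y: "y > 0"
    have "((\<lambda>n. exp (- (pi * y) * (real_of_int n)\<^sup>2)) has_sum jtheta (pi * y)) UNIV"
      using y by (intro has_sum_jtheta) simp
    also have "(\<lambda>n. exp (- (pi * y) * (real_of_int n)\<^sup>2)) = (\<lambda>n. exp (- pi * (cmod (of_int n))\<^sup>2 * y))"
      by (simp add: mult_ac)
    also have "((\<lambda>n::int. exp (- pi * (cmod (of_int n))\<^sup>2 * y)) has_sum jtheta (pi * y)) UNIV \<longleftrightarrow>
       ((\<lambda>z. exp (- pi * (cmod z)\<^sup>2 * y)) has_sum jtheta (pi * y)) \<int>"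
      by (rule has_sum_reindex_bij_betw) (auto simp: bij_betw_def inj_on_def Ints_def)
    finally show "((\<lambda>z. exp (- pi * (cmod z)\<^sup>2 * y)) has_sum jtheta (pi * y)) \<int>" .
    show "jtheta (pi * (1 / y)) = y powr (real 1 / 2) * jtheta (pi * y)"
      using jtheta_inversion[OF y] y by (simp add: powr_half_sqrt)
  qed auto
qed

section \<open>Units and gamma factors of the three fields\<close>

lemma ring_of_integers_eq:
  "ring_of_integers FieldQ = \<int>"
  "ring_of_integers FieldQi = quad_ring 1"
  "ring_of_integers FieldQsqrtm2 = quad_ring 2"
  by (auto simp: ring_of_integers_def quad_ring_def Ints_def complex_eq_iff)

lemma card_units:
  "card {z \<in> ring_of_integers K. cmod z = 1} = num_roots_of_unity K"
proof (cases K)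
  case FieldQ
  have "{z \<in> \<int>. cmod z = 1} = {1, -1}"
  proof (intro equalityI subsetI)
    fix z assume "z \<in> {z \<in> \<int>. cmod z = 1}"
    then obtain n where "z = of_int n" "cmod (of_int n) = 1" by (auto elim!: Ints_cases)
    hence "z = of_int n" "\<bar>n\<bar> = 1" by (simp_all del: of_int_abs flip: of_int_abs)
    thus "z \<in> {1, -1}" by (cases "n \<ge> 0") auto
  qed auto
  thus ?thesis by (simp add: FieldQ ring_of_integers_eq num_roots_of_unity_def)
next
  case FieldQi
  have "{z \<in> quad_ring 1. cmod z = 1} = {1, -1, \<i>, -\<i>}"
  proof (intro equalityI subsetI)
    fix z assume z: "z \<in> {z \<in> quad_ring 1. cmod z = 1}"
    then obtain a b where ab: "z = Complex (of_int a) (of_int b * sqrt (real 1))" by (auto elim: quad_ringE)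
    have "real_of_int (a\<^sup>2 + int 1 * b\<^sup>2) = 1" unfolding cmod_square_Complex_sqrt[symmetric] ab[symmetric] using z by simp
    hence "a\<^sup>2 + b\<^sup>2 = 1" by linarith
    moreover have "\<bar>a\<bar> \<le> 1" "\<bar>b\<bar> \<le> 1"
      using calculation abs_le_square_iff[of a 1] abs_le_square_iff[of b 1] zero_le_power2[of a] zero_le_power2[of b]
      by (simp_all only: power_one abs_one; linarith)+
    hence "a \<in> {-1, 0, 1}" "b \<in> {-1, 0, 1}" by auto
    ultimately show "z \<in> {1, -1, \<i>, -\<i>}" unfolding ab by (auto simp: complex_eq_iff)
  next
    fix z :: complex assume "z \<in> {1, -1, \<i>, -\<i>}"
    moreover have "1 \<in> quad_ring 1" "-1 \<in> quad_ring 1" "\<i> \<in> quad_ring 1" "-\<i> \<in> quad_ring 1"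
      using quad_ringI[of 1 0 1] quad_ringI[of "-1" 0 1] quad_ringI[of 0 1 1] quad_ringI[of 0 "-1" 1]
      by (simp_all add: complex_eq_iff one_complex.code imaginary_unit.code uminus_complex.code)
    ultimately show "z \<in> {z \<in> quad_ring 1. cmod z = 1}" by auto
  qed
  moreover have "card {1, -1, \<i>, -\<i>} = 4" by (simp add: complex_eq_iff)
  ultimately show ?thesis by (simp add: FieldQi ring_of_integers_eq num_roots_of_unity_def)
next
  case FieldQsqrtm2
  have "{z \<in> quad_ring 2. cmod z = 1} = {1, -1}"
  proof (intro equalityI subsetI)
    fix z assume z: "z \<in> {z \<in> quad_ring 2. cmod z = 1}"
    then obtain a b where ab: "z = Complex (of_int a) (of_int b * sqrt (real 2))" by (auto elim: quad_ringE)
    have "real_of_int (a\<^sup>2 + int 2 * b\<^sup>2) = 1" unfolding cmod_square_Complex_sqrt[symmetric] ab[symmetric] using z by simp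
    hence eq: "a\<^sup>2 + 2 * b\<^sup>2 = 1" by linarith
    have "b\<^sup>2 = 0" using eq zero_le_power2[of a] zero_le_power2[of b] by linarith
    hence "b = 0" "a\<^sup>2 = 1" using eq by auto
    hence "b = 0" "a = 1 \<or> a = -1" by (auto simp: power2_eq_1_iff)
    thus "z \<in> {1, -1}" unfolding ab by (auto simp: complex_eq_iff)
  next
    fix z :: complex assume "z \<in> {1, -1}"
    moreover have "1 \<in> quad_ring 2" "-1 \<in> quad_ring 2"
      using of_int_quad_ring[of 1 2] of_int_quad_ring[of "-1" 2] by simp_all
    ultimately show "z \<in> {z \<in> quad_ring 2. cmod z = 1}" by auto
  qed
  thus ?thesis by (simp add: FieldQsqrtm2 ring_of_integers_eq num_roots_of_unity_def)
qed

lemma powr_of_real_pos: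
  "x > 0 \<Longrightarrow> complex_of_real x powr s = exp (s * of_real (ln x))"
  by (simp add: powr_def Ln_of_real)

theorem theorem1p1:
  fixes K :: qfield
  shows "\<exists>(M :: real measure) (X :: real \<Rightarrow> real).
           prob_space M \<and> X \<in> borel_measurable M \<and> (\<forall>\<omega>\<in>space M. 0 < X \<omega>) \<and>
           (\<forall>s::complex. integrable M (\<lambda>\<omega>. complex_of_real (X \<omega>) powr s) \<and>
              (\<integral>\<omega>. complex_of_real (X \<omega>) powr s \<partial>M)
                = of_real \<bar>real_of_int (discriminant K)\<bar> powr (- s / 2) * dedekind_xi K s)"
proof (cases K)
  case FieldQ
  show ?thesis
  proof (rule xi_random_variable)
    show "theta_ring (ring_of_integers K) 1 pi (\<lambda>y. jtheta (pi * y))"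
      unfolding FieldQ ring_of_integers_eq by (rule theta_ring_Ints)
  \<comment> \<open>Here \<open>c_const K\<close> and the discriminant are 1, and the factor
    \<open>e / 2 = 1 / 2\<close> cancels against the two units.\<close>
  qed (unfold card_units, simp add: FieldQ c_const_def discriminant_def r1_def r2_def class_number_def
        regulator_def num_roots_of_unity_def Gamma_R_def mult_ac)
next
  case FieldQi
  show ?thesis
  proof (rule xi_random_variable)
    show "theta_ring (ring_of_integers K) 2 (pi / sqrt (real 1))
           (\<lambda>y. jtheta (pi * (y / sqrt (real 1))) * jtheta (pi * (sqrt (real 1) * y)))"
      unfolding FieldQi ring_of_integers_eq by (rule theta_ring_quad_ring) simp
    fix s
    \<comment> \<open>\<open>|D|^(s / 2)\<close> times \<open>(2 pi)^(1 - s)\<close> is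
      \<open>2 pi c^(- s)\<close> with \<open>c = 2 pi / sqrt |D|\<close>; the remaining
      \<open>2 pi\<close> cancels the one in \<open>c_const\<close>.\<close>
    have "4 powr (s / 2) * (of_real (2 * pi)) powr (1 - s) = 2 * complex_of_real pi * of_real pi powr (- s)"
    proof -
      have "4 powr (s / 2) * (of_real (2 * pi)) powr (1 - s) = exp (s / 2 * of_real (ln 4) + (1 - s) * of_real (ln (2 * pi)))"
        using powr_of_real_pos[of 4 "s/2"] powr_of_real_pos[of "2 * pi" "1 - s"] by (simp add: exp_add)
      also have "s / 2 * of_real (ln 4) + (1 - s) * of_real (ln (2 * pi)) = of_real (ln (2 * pi)) + (- s) * complex_of_real (ln pi)"
      proof -
        have "ln (4::real) = 2 * ln 2" using ln_realpow[of 2 2] by simp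
        thus ?thesis by (simp add: ln_mult algebra_simps)
      qed
      also have "exp \<dots> = of_real (2 * pi) * of_real pi powr (- s)"
        unfolding exp_add exp_of_real by (simp add: powr_of_real_pos)
      finally show ?thesis by simp
    qed
    thus "inverse (of_real (c_const K)) * of_real \<bar>real_of_int (discriminant K)\<bar> powr (s / 2) *
          (Gamma_R s ^ r1 K * Gamma_C s ^ r2 K) =
        of_real (real 2 / 2) * Gamma (of_real (real 2 / 2) * s) * of_real (pi / sqrt (real 1)) powr (- (of_real (real 2 / 2) * s)) *
        of_nat (card {z \<in> ring_of_integers K. cmod z = 1})"
      unfolding card_units
      by (simp add: FieldQi c_const_def discriminant_def r1_def r2_def class_number_def
        regulator_def num_roots_of_unity_def Gamma_C_def field_simps)
  qed
next
  case FieldQsqrtm2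
  show ?thesis
  proof (rule xi_random_variable)
    show "theta_ring (ring_of_integers K) 2 (pi / sqrt (real 2))
           (\<lambda>y. jtheta (pi * (y / sqrt (real 2))) * jtheta (pi * (sqrt (real 2) * y)))"
      unfolding FieldQsqrtm2 ring_of_integers_eq by (rule theta_ring_quad_ring) simp
    fix s
    \<comment> \<open>The same cancellation with \<open>|D| = 8\<close>, where
      \<open>2 pi / sqrt 8 = pi / sqrt 2\<close>.\<close>
    have "8 powr (s / 2) * (of_real (2 * pi)) powr (1 - s) = 2 * complex_of_real pi * of_real (pi / sqrt 2) powr (- s)"
    proof -
      have "8 powr (s / 2) * (of_real (2 * pi)) powr (1 - s) = exp (s / 2 * of_real (ln 8) + (1 - s) * of_real (ln (2 * pi)))"
        using powr_of_real_pos[of 8 "s/2"] powr_of_real_pos[of "2 * pi" "1 - s"] by (simp add: exp_add)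
      also have "s / 2 * of_real (ln 8) + (1 - s) * of_real (ln (2 * pi)) = of_real (ln (2 * pi)) + (- s) * complex_of_real (ln (pi / sqrt 2))"
      proof -
        have "ln (8::real) = 3 * ln 2" using ln_realpow[of 2 3] by simp
        thus ?thesis by (simp add: ln_mult ln_div ln_sqrt algebra_simps)
      qed
      also have "exp \<dots> = of_real (2 * pi) * of_real (pi / sqrt 2) powr (- s)"
        unfolding exp_add exp_of_real using powr_of_real_pos[of "pi / sqrt 2" "- s"] by simp
      finally show ?thesis by simp
    qed
    thus "inverse (of_real (c_const K)) * of_real \<bar>real_of_int (discriminant K)\<bar> powr (s / 2) *
          (Gamma_R s ^ r1 K * Gamma_C s ^ r2 K) =
        of_real (real 2 / 2) * Gamma (of_real (real 2 / 2) * s) * of_real (pi / sqrt (real 2)) powr (- (of_real (real 2 / 2) * s)) *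
        of_nat (card {z \<in> ring_of_integers K. cmod z = 1})"
      unfolding card_units
      by (simp add: FieldQsqrtm2 c_const_def discriminant_def r1_def r2_def class_number_def
        regulator_def num_roots_of_unity_def Gamma_C_def field_simps)
  qed
qed

end
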